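(* Let $n,t\ge 1$ and $d\ge 2$ be integers, let $v=x_{j_1}x_{j_2}\cdots x_{j_d}$ (with $j_1<j_2<\dots<j_d$) be a $t$-spread monomial of degree $d$ of $S=K[x_1,\dots,x_n]$ with $j_1\ge 2$, and let $J=(\mathcal{L}_t^i(v))$ be the initial $t$-spread lexsegment ideal of $S$ determined by $v$. Then $\mathrm{pd}(S/J)=n-(d-1)t$, $\mathrm{depth}(S/J)=(d-1)t$ and $\dim(S/J)=n-j_1$.
   Context: $S=K[x_1,\dots,x_n]$ is a standard graded polynomial ring over a field $K$; $\mathrm{pd}$ is projective dimension over $S$ and $\dim$ is Krull dimension. For $t\ge1$, a monomial $x_{i_1}\cdots x_{i_d}$ with $i_1\le\dots\le i_d$ is $t$-spread if $i_{r+1}-i_r\ge t$ for $r=1,\dots,d-1$. $M_{n,d,t}$ is the set of $t$-spread monomials of degree $d$ of $S$. For squarefree monomials of the same degree, $x_{i_1}\cdots x_{i_d}>_{\mathrm{slex}}x_{j_1}\cdots x_{j_d}$ (indices increasing) if for some $s$ one has $i_1=j_1,\dots,i_{s-1}=j_{s-1}$ and $i_s<j_s$. For $v\in M_{n,d,t}$, $\mathcal{L}_t^i(v)=\{w\in M_{n,d,t}: w\ge_{\mathrm{slex}}v\}$, and $(\mathcal{L}_t^i(v))$ is the ideal of $S$ it generates. *)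

theory Defs
  imports "HOL-Algebra.Algebra" "HOL-Library.Poly_Mapping" "HOL-Library.Extended_Nat"
begin

section \<open>Modules, projective dimension, depth and Krull dimension\<close>

definition module_hom_set ::
    "('a, 'r) ring_scheme \<Rightarrow> ('a, 'b, 'm) module_scheme \<Rightarrow> ('a, 'c, 'n) module_scheme \<Rightarrow> ('b \<Rightarrow> 'c) set" where
  "module_hom_set R M N =
    {f. f \<in> carrier M \<rightarrow> carrier N
      \<and> (\<forall>x\<in>carrier M. \<forall>y\<in>carrier M. f (x \<oplus>\<^bsub>M\<^esub> y) = f x \<oplus>\<^bsub>N\<^esub> f y)
      \<and> (\<forall>r\<in>carrier R. \<forall>x\<in>carrier M. f (r \<odot>\<^bsub>M\<^esub> x) = r \<odot>\<^bsub>N\<^esub> f x)}"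

text \<open>
  The usual lifting property of projective modules. HOL cannot quantify over all types inside a
  definition, so the test surjections \<open>g: A \<rightarrow> B\<close> range over modules on two fixed types. These
  are large enough for the general lifting property: if \<open>'p\<close> is the type of elements of \<open>P\<close>, the
  canonical surjection onto \<open>P\<close> from the free module on the set \<open>carrier P\<close>, realised by finitely
  supported functions, is among the tests, and a splitting of it makes \<open>P\<close> a direct summand of a
  free module.
\<close>

definition projective_module :: "('a, 'r) ring_scheme \<Rightarrow> ('a, 'p) module \<Rightarrow> bool" where
  "projective_module R P \<longleftrightarrow>
    Module.module R P \<and>
    (\<forall>(A :: ('a, 'p \<Rightarrow> 'a) module) (B :: ('a, 'p) module) g f.
       Module.module R A \<longrightarrow> Module.module R B \<longrightarrow>
       g \<in> module_hom_set R A B \<longrightarrow> g ` carrier A = carrier B \<longrightarrow>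
       f \<in> module_hom_set R P B \<longrightarrow>
       (\<exists>h\<in>module_hom_set R P A. \<forall>x\<in>carrier P. g (h x) = f x))"

text \<open>The sequence \<open>\<dots> \<rightarrow> P 2 \<rightarrow> P 1 \<rightarrow> P 0 \<rightarrow> M \<rightarrow> 0\<close> with maps \<open>\<dots>, \<delta> 1, \<delta> 0, \<epsilon>\<close> is exact
  and every \<open>P i\<close> is projective.\<close>

definition projective_resolution ::
    "('a, 'r) ring_scheme \<Rightarrow> ('a, 'b, 'm) module_scheme \<Rightarrow>
     (nat \<Rightarrow> ('a, 'p) module) \<Rightarrow> (nat \<Rightarrow> 'p \<Rightarrow> 'p) \<Rightarrow> ('p \<Rightarrow> 'b) \<Rightarrow> bool" where
  "projective_resolution R M P \<delta> \<epsilon> \<longleftrightarrow>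
    (\<forall>i. projective_module R (P i)) \<and>
    \<epsilon> \<in> module_hom_set R (P 0) M \<and>
    (\<forall>i. \<delta> i \<in> module_hom_set R (P (Suc i)) (P i)) \<and>
    \<epsilon> ` carrier (P 0) = carrier M \<and>
    \<delta> 0 ` carrier (P (Suc 0)) = {x \<in> carrier (P 0). \<epsilon> x = \<zero>\<^bsub>M\<^esub>} \<and>
    (\<forall>i. \<delta> (Suc i) ` carrier (P (Suc (Suc i))) = {x \<in> carrier (P (Suc i)). \<delta> i x = \<zero>\<^bsub>P i\<^esub>})"

text \<open>
  Projective dimension: the least length of a projective resolution, \<open>\<infinity>\<close> if there is no finite one
  (and \<open>0\<close> for the zero module). The modules of a resolution are taken on the type
  \<open>'b \<times> 'a \<times> nat \<Rightarrow> 'a\<close>. This is no restriction: every module has a free resolution whose bases have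
  at most as many elements as \<open>'b \<times> 'a \<times> nat\<close>, it can be realised by finitely supported functions,
  and the projective dimension is at most \<open>l > 0\<close> iff the image of the map from the \<open>l\<close>-th to the
  \<open>(l - 1)\<close>-th free module, which is carried by the same type, is projective
  (for \<open>l = 0\<close>: a projective \<open>M\<close> is isomorphic to a direct summand of such a free module).
\<close>

definition proj_dim :: "('a, 'r) ring_scheme \<Rightarrow> ('a, 'b, 'm) module_scheme \<Rightarrow> enat" where
  "proj_dim R M = Inf {enat l | l.
     \<exists>(P :: nat \<Rightarrow> ('a, 'b \<times> 'a \<times> nat \<Rightarrow> 'a) module) \<delta> \<epsilon>.
       projective_resolution R M P \<delta> \<epsilon> \<and> (\<forall>i>l. carrier (P i) = {\<zero>\<^bsub>P i\<^esub>})}"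

text \<open>The submodule \<open>(r\<^sub>0, \<dots>, r\<^bsub>k-1\<^esub>) M\<close> generated by the first \<open>k\<close> elements of the list \<open>rs\<close>.\<close>

definition seq_submodule :: "('a, 'b, 'm) module_scheme \<Rightarrow> 'a list \<Rightarrow> nat \<Rightarrow> 'b set" where
  "seq_submodule M rs k =
    {(\<Oplus>\<^bsub>M\<^esub>j\<in>{..<k}. (rs ! j) \<odot>\<^bsub>M\<^esub> m j) | m. m \<in> {..<k} \<rightarrow> carrier M}"

text \<open>\<open>M\<close>-regular sequences: each \<open>rs ! i\<close> is a nonzerodivisor on \<open>M / (r\<^sub>0, \<dots>, r\<^bsub>i-1\<^esub>) M\<close>, and
  \<open>M \<noteq> (rs) M\<close>.\<close>

definition regular_sequence ::
    "('a, 'r) ring_scheme \<Rightarrow> ('a, 'b, 'm) module_scheme \<Rightarrow> 'a list \<Rightarrow> bool" where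
  "regular_sequence R M rs \<longleftrightarrow>
    set rs \<subseteq> carrier R \<and>
    (\<forall>i<length rs. \<forall>x\<in>carrier M.
       (rs ! i) \<odot>\<^bsub>M\<^esub> x \<in> seq_submodule M rs i \<longrightarrow> x \<in> seq_submodule M rs i) \<and>
    seq_submodule M rs (length rs) \<noteq> carrier M"

definition depth :: "('a, 'r) ring_scheme \<Rightarrow> 'a set \<Rightarrow> ('a, 'b, 'm) module_scheme \<Rightarrow> enat" where
  "depth R I M = Sup {enat (length rs) | rs. set rs \<subseteq> I \<and> regular_sequence R M rs}"

definition krull_dim :: "('a, 'r) ring_scheme \<Rightarrow> enat" where
  "krull_dim R = Sup {enat l | l.
     \<exists>p. (\<forall>i\<le>l. primeideal (p i) R) \<and> (\<forall>i<l. p i \<subset> p (Suc i))}"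

definition quotient_module :: "('a, 'r) ring_scheme \<Rightarrow> 'a set \<Rightarrow> ('a, 'a set) module" where
  "quotient_module R I =
    ring.extend (R Quot I) \<lparr>smult = (\<lambda>r Y. rcoset_mult R I (I +>\<^bsub>R\<^esub> r) Y)\<rparr>"


section \<open>Polynomial rings\<close>

text \<open>
  Monomials are exponent vectors \<open>nat \<Rightarrow>\<^sub>0 nat\<close>, polynomials are finitely supported functions from
  monomials to coefficients. \<open>poly_ring_vars n\<close> is \<open>K[x\<^sub>1, \<dots>, x\<^sub>n]\<close>, where \<open>K\<close> is the field given
  by the type \<open>'k\<close>.
\<close>

type_synonym 'k mpoly = "(nat \<Rightarrow>\<^sub>0 nat) \<Rightarrow>\<^sub>0 'k"

definition poly_ring_vars :: "nat \<Rightarrow> 'k::field mpoly ring" where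
  "poly_ring_vars n =
    \<lparr>carrier = {p. \<forall>m\<in>Poly_Mapping.keys p. Poly_Mapping.keys m \<subseteq> {1..n}},
     monoid.mult = (*), one = 1, ring.zero = 0, add = (+)\<rparr>"

definition monom_poly :: "(nat \<Rightarrow>\<^sub>0 nat) \<Rightarrow> 'k::field mpoly" where
  "monom_poly m = Poly_Mapping.single m 1"

definition monomial_ideal :: "nat \<Rightarrow> (nat \<Rightarrow>\<^sub>0 nat) set \<Rightarrow> 'k::field mpoly set" where
  "monomial_ideal n G = genideal (poly_ring_vars n) (monom_poly ` G)"

definition graded_maximal_ideal :: "nat \<Rightarrow> 'k::field mpoly set" where
  "graded_maximal_ideal n = monomial_ideal n {Poly_Mapping.single i 1 | i. i \<in> {1..n}}"


section \<open>Spread monomials and initial lexsegments\<close>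

text \<open>The monomial \<open>x\<^bsub>i\<^sub>1\<^esub> \<cdots> x\<^bsub>i\<^sub>d\<^esub>\<close> for the list \<open>[i\<^sub>1, \<dots>, i\<^sub>d]\<close>.\<close>

definition index_monom :: "nat list \<Rightarrow> nat \<Rightarrow>\<^sub>0 nat" where
  "index_monom is = (\<Sum>i\<leftarrow>is. Poly_Mapping.single i 1)"

definition spread_monoms :: "nat \<Rightarrow> nat \<Rightarrow> nat \<Rightarrow> (nat \<Rightarrow>\<^sub>0 nat) set" where
  "spread_monoms n d t =
    {index_monom is | is.
       length is = d \<and> set is \<subseteq> {1..n} \<and> sorted is \<and>
       (\<forall>r. Suc r < d \<longrightarrow> is ! r + t \<le> is ! Suc r)}"

definition slex_greater :: "(nat \<Rightarrow>\<^sub>0 nat) \<Rightarrow> (nat \<Rightarrow>\<^sub>0 nat) \<Rightarrow> bool" where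
  "slex_greater u w \<longleftrightarrow>
    (\<exists>is js. sorted_wrt (<) is \<and> sorted_wrt (<) js \<and> length is = length js \<and>
       u = index_monom is \<and> w = index_monom js \<and>
       (\<exists>s<length is. (\<forall>r<s. is ! r = js ! r) \<and> is ! s < js ! s))"

definition initial_lexsegment ::
    "nat \<Rightarrow> nat \<Rightarrow> nat \<Rightarrow> (nat \<Rightarrow>\<^sub>0 nat) \<Rightarrow> (nat \<Rightarrow>\<^sub>0 nat) set" where
  "initial_lexsegment n d t v = {w \<in> spread_monoms n d t. w = v \<or> slex_greater w v}"

end

theory Submission
  imports Defs "HOL-Library.Function_Algebras"
begin

text \<open>
  Put \<open>e = (d - 1) t\<close>. The ideal \<open>J\<close> is the Stanley--Reisner ideal of the complex \<open>\<Delta>\<close> of those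
  subsets of \<open>{1..n}\<close> that contain no \<open>t\<close>-spread \<open>d\<close>-subset which is lexicographically at least \<open>v\<close>.
  Starting with the simplex \<open>{j\<^sub>1 + 1..n}\<close> and going through the faces with minimum
  \<open>j\<^sub>1, j\<^sub>1 - 1, \<dots>, 1\<close>, one builds up \<open>\<Delta>\<close> by intervals \<open>[R, F]\<close> of faces with \<open>|F| \<ge> e\<close>. So \<open>S/J\<close> has
  a filtration whose factors are polynomial rings \<open>K[F]\<close> with \<open>|F| \<ge> e\<close>. The complete homogeneous
  symmetric polynomials \<open>h\<^sub>1, \<dots>, h\<^sub>e\<close> are regular on each factor, hence on \<open>S/J\<close>, and by the horseshoe
  lemma the Koszul resolutions of the factors give \<open>pd(S/J) \<le> n - e\<close>.

  Conversely, \<open>j\<^sub>1 \<ge> 2\<close> implies that \<open>{1..e}\<close> is a facet of \<open>\<Delta>\<close>, so the annihilator of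
  \<open>u = x\<^sub>1 \<cdots> x\<^sub>e\<close> in \<open>S/J\<close> is \<open>P = (x\<^bsub>e+1\<^esub>, \<dots>, x\<^sub>n)\<close>. These \<open>n - e\<close> variables are a regular
  sequence on \<open>S\<close> that annihilates \<open>u \<noteq> 0\<close>, which is impossible in a module of projective dimension less
  than \<open>n - e\<close>. More than \<open>e\<close> polynomials are algebraically dependent modulo \<open>P\<close>; this bounds the
  length of regular sequences. The same dependence argument bounds chains of primes in \<open>K[F]\<close> by \<open>|F|\<close>,
  and the largest faces of \<open>\<Delta>\<close> have \<open>n - j\<^sub>1\<close> elements.
\<close>

section \<open>Weakly regular sequences\<close>

text \<open>On K[F] the h_i restrict to the complete symmetric polynomials in the variables of F.
  Modulo its predecessors, h_i may be replaced by h_i with the first i - 1 variables dropped, which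
  is monic in its first remaining variable; |F| \<ge> e leaves a variable for each member.

  The number e arises in a recursion on v: the faces with minimum i lead to a list with one entry
  less on the vertices from i + t on, and the t vertices i, ..., i + t - 1 are added to each F. The
  hypothesis j_1 \<ge> 2 puts every spread list with first entry 1 into the segment, which is why
  {1..e} cannot be enlarged.

  Depth and projective dimension are bounded separately, without the Auslander--Buchsbaum formula.
  The bounds on regular sequences and on chains of primes share one core: a nontrivial algebraic
  relation from which the terms of smallest exponent are cancelled, one factor after the
  other.\<close>

locale subring_set =
  fixes C :: "'a::comm_ring_1 set"
  assumes zero_mem [simp, intro]: "0 \<in> C"
    and one_mem [simp, intro]: "1 \<in> C"
    and add_mem [simp, intro]: "a \<in> C \<Longrightarrow> b \<in> C \<Longrightarrow> a + b \<in> C"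
    and mult_mem [simp, intro]: "a \<in> C \<Longrightarrow> b \<in> C \<Longrightarrow> a * b \<in> C"
    and uminus_mem [simp, intro]: "a \<in> C \<Longrightarrow> - a \<in> C"
begin

lemma diff_mem [simp, intro]: "a \<in> C \<Longrightarrow> b \<in> C \<Longrightarrow> a - b \<in> C"
  using add_mem[of a "- b"] by simp

lemma power_mem [simp, intro]: "a \<in> C \<Longrightarrow> a ^ k \<in> C"
  by (induction k) auto

lemma sum_mem [intro]: "(\<And>i. i \<in> A \<Longrightarrow> f i \<in> C) \<Longrightarrow> sum f A \<in> C"
  by (induction A rule: infinite_finite_induct) auto

definition idl :: "'a set \<Rightarrow> bool" where
  "idl I \<longleftrightarrow> I \<subseteq> C \<and> 0 \<in> I \<and> (\<forall>a\<in>I. \<forall>b\<in>I. a + b \<in> I) \<and> (\<forall>r\<in>C. \<forall>a\<in>I. r * a \<in> I)"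

definition nzd :: "'a set \<Rightarrow> 'a \<Rightarrow> bool" where
  "nzd I r \<longleftrightarrow> (\<forall>x\<in>C. r * x \<in> I \<longrightarrow> x \<in> I)"

definition adj :: "'a set \<Rightarrow> 'a \<Rightarrow> 'a set" where
  "adj I r = {a + r * x | a x. a \<in> I \<and> x \<in> C}"

text \<open>Weak regularity on \<open>C / I\<close>, that is, without the condition that \<open>I\<close> and \<open>rs\<close> generate a
  proper ideal.\<close>

fun wreg :: "'a set \<Rightarrow> 'a list \<Rightarrow> bool" where
  "wreg I [] \<longleftrightarrow> True"
| "wreg I (r # rs) \<longleftrightarrow> nzd I r \<and> wreg (adj I r) rs"

lemma idlD:
  assumes "idl I"
  shows "a \<in> I \<Longrightarrow> a \<in> C" "0 \<in> I" "a \<in> I \<Longrightarrow> b \<in> I \<Longrightarrow> a + b \<in> I"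
    "r \<in> C \<Longrightarrow> a \<in> I \<Longrightarrow> r * a \<in> I" "r \<in> C \<Longrightarrow> a \<in> I \<Longrightarrow> a * r \<in> I"
    "a \<in> I \<Longrightarrow> - a \<in> I" "a \<in> I \<Longrightarrow> b \<in> I \<Longrightarrow> a - b \<in> I"
proof -
  show *: "r \<in> C \<Longrightarrow> a \<in> I \<Longrightarrow> r * a \<in> I" for r a
    using assms by (auto simp: idl_def)
  show "r \<in> C \<Longrightarrow> a \<in> I \<Longrightarrow> a * r \<in> I" using * by (metis mult.commute)
  show m: "a \<in> I \<Longrightarrow> - a \<in> I" for a using *[of "-1" a] by simp
  show p: "a \<in> I \<Longrightarrow> b \<in> I \<Longrightarrow> a + b \<in> I" for a b using assms by (auto simp: idl_def)
  show "a \<in> I \<Longrightarrow> b \<in> I \<Longrightarrow> a - b \<in> I" using p[of a "-b"] m by simp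
qed (use assms in \<open>auto simp: idl_def\<close>)

lemma idl_carrier: "idl C"
  by (auto simp: idl_def)

lemma sum_idl: "idl I \<Longrightarrow> (\<And>i. i \<in> A \<Longrightarrow> f i \<in> I) \<Longrightarrow> sum f A \<in> I"
  by (induction A rule: infinite_finite_induct) (auto dest: idlD)

lemma adjI: "a \<in> I \<Longrightarrow> x \<in> C \<Longrightarrow> a + r * x \<in> adj I r"
  by (auto simp: adj_def)

lemma adjE: "z \<in> adj I r \<Longrightarrow> (\<And>a x. a \<in> I \<Longrightarrow> x \<in> C \<Longrightarrow> z = a + r * x \<Longrightarrow> thesis) \<Longrightarrow> thesis"
  by (auto simp: adj_def)

lemma adj_superset: "a \<in> I \<Longrightarrow> a \<in> adj I r"
  using adjI[of a I 0 r] by simp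

text \<open>This is the zero module: the start of the induction over interval filtrations, where the
  empty complex has the ideal \<open>C\<close>.\<close>

lemma wreg_carrier: "set rs \<subseteq> C \<Longrightarrow> wreg C rs"
proof (induction rs)
  case (Cons r rs)
  have "adj C r = C"
    using Cons.prems by (auto elim!: adjE intro: adj_superset)
  with Cons show ?case by (auto simp: nzd_def)
qed simp

lemma adj_gen: "idl I \<Longrightarrow> x \<in> C \<Longrightarrow> r * x \<in> adj I r"
  using adjI[of 0 I x r] by (simp add: idlD)

lemma adj_least: "idl B \<Longrightarrow> I \<subseteq> B \<Longrightarrow> r \<in> B \<Longrightarrow> adj I r \<subseteq> B"
  by (auto elim!: adjE intro!: idlD(3)[of B] idlD(5)[of B])

lemma idl_adj:
  assumes "idl I" "r \<in> C" shows "idl (adj I r)"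
  unfolding idl_def
proof (intro conjI ballI)
  show "adj I r \<subseteq> C" using assms by (auto simp: adj_def dest: idlD)
  show "0 \<in> adj I r" using adj_superset assms idlD by blast
  fix a b assume "a \<in> adj I r" "b \<in> adj I r"
  then obtain i x j y where "i \<in> I" "x \<in> C" "j \<in> I" "y \<in> C" "a = i + r * x" "b = j + r * y"
    by (auto elim!: adjE)
  then show "a + b \<in> adj I r"
    using adjI[of "i + j" I "x + y" r] assms idlD(3) by (auto simp: algebra_simps)
next
  fix s a assume "s \<in> C" "a \<in> adj I r"
  then obtain i x where "i \<in> I" "x \<in> C" "a = i + r * x" by (auto elim!: adjE)
  then show "s * a \<in> adj I r"
    using adjI[of "s * i" I "s * x" r] idlD(4)[OF assms(1), of s i] \<open>s \<in> C\<close>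
    by (simp add: algebra_simps)
qed

lemma adj_commute: "adj (adj I r) s = adj (adj I s) r"
proof -
  have "adj (adj I r) s \<subseteq> adj (adj I s) r" for r s
  proof
    fix z assume "z \<in> adj (adj I r) s"
    then obtain i x y where z: "i \<in> I" "x \<in> C" "y \<in> C" "z = i + r * x + s * y"
      by (auto elim!: adjE)
    then have "z = (i + s * y) + r * x" by simp
    then show "z \<in> adj (adj I s) r" using z adjI by metis
  qed
  then show ?thesis by blast
qed

lemma adj_cong:
  assumes "idl I" "r - s \<in> I" "r \<in> C" "s \<in> C"
  shows "adj I r = adj I s"
proof -
  have "adj I r \<subseteq> adj I s" if "r - s \<in> I" "r \<in> C" "s \<in> C" for r s
  proof (rule adj_least)
    show "idl (adj I s)" using assms that by (simp add: idl_adj)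
    have "(r - s) + s * 1 \<in> adj I s" using that by (intro adjI) auto
    then show "r \<in> adj I s" by simp
  qed (auto intro: adj_superset)
  moreover have "s - r \<in> I" using idlD(6)[OF assms(1,2)] by simp
  ultimately show ?thesis using assms by blast
qed

lemma nzd_cong:
  assumes "idl I" "r - s \<in> I" "nzd I s"
  shows "nzd I r"
  unfolding nzd_def
proof (intro ballI impI)
  fix x assume x: "x \<in> C" "r * x \<in> I"
  have "r * x - (r - s) * x \<in> I"
    using x(2) idlD(5)[OF assms(1) x(1) assms(2)] by (rule idlD(7)[OF assms(1)])
  then show "x \<in> I" using assms(3) x by (simp add: nzd_def algebra_simps)
qed

lemma nzdD: "nzd I r \<Longrightarrow> r * x \<in> I \<Longrightarrow> x \<in> C \<Longrightarrow> x \<in> I"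
  by (auto simp: nzd_def)

text \<open>Regularity on the two outer terms of \<open>0 \<rightarrow> C/(A:x) \<rightarrow> C/A \<rightarrow> C/(A + xC) \<rightarrow> 0\<close> gives
  regularity on the middle one.\<close>

lemma wreg_extension:
  assumes "idl A" "x \<in> C" "set ys \<subseteq> C" "wreg (adj A x) ys" "wreg {z \<in> C. x * z \<in> A} ys"
  shows "wreg A ys"
  using assms
proof (induction ys arbitrary: A)
  case (Cons y ys)
  let ?B = "adj A x" and ?Q = "{z \<in> C. x * z \<in> A}"
  have y: "y \<in> C" using Cons.prems by simp
  have yB: "nzd ?B y" and yQ: "nzd ?Q y" using Cons.prems by auto
  have 1: "nzd A y"
    unfolding nzd_def
  proof (intro ballI impI)
    fix z assume z: "z \<in> C" "y * z \<in> A"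
    then have "z \<in> ?B" using yB adj_superset nzdD by blast
    then obtain a w where w: "a \<in> A" "w \<in> C" "z = a + x * w" by (rule adjE)
    then have "x * (y * w) = y * z - y * a" by (simp add: algebra_simps)
    then have "x * (y * w) \<in> A" using z w y idlD[OF Cons.prems(1)] by metis
    then have "w \<in> ?Q" using yQ w y by (auto simp: nzd_def)
    then show "z \<in> A" using w idlD[OF Cons.prems(1)] by auto
  qed
  \<comment> \<open>Multiplication by \<open>x\<close> identifies \<open>C/(A:x)\<close> with the
    kernel of \<open>C/A \<rightarrow> C/(A + xC)\<close>. As \<open>y\<close> is a nonzerodivisor
    on the last term, dividing by \<open>y\<close> keeps the sequence exact; for the first term this
    is the equality stated here.\<close>
  have 2: "{z \<in> C. x * z \<in> adj A y} = adj ?Q y"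
  proof (intro equalityI subsetI)
    fix z assume "z \<in> {z \<in> C. x * z \<in> adj A y}"
    then obtain a w where z: "z \<in> C" and w: "a \<in> A" "w \<in> C" "x * z = a + y * w"
      by (auto elim: adjE)
    have "y * w = - a + x * z" using w by simp
    then have "y * w \<in> ?B" using w z idlD(6)[OF Cons.prems(1)] adjI by metis
    then have "w \<in> ?B" using yB w nzdD by blast
    then obtain b v where v: "b \<in> A" "v \<in> C" "w = b + x * v" by (rule adjE)
    have "x * (z - y * v) = a + y * b" using w(3) unfolding v(3) by (simp add: algebra_simps)
    then have "x * (z - y * v) \<in> A" using w v y idlD[OF Cons.prems(1)] by metis
    then have "z - y * v \<in> ?Q" using z y v by auto
    then show "z \<in> adj ?Q y" using adjI[of "z - y * v" ?Q v y] v by simp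
  next
    fix z assume "z \<in> adj ?Q y"
    then obtain b v where v: "b \<in> C" "x * b \<in> A" "v \<in> C" "z = b + y * v" by (auto elim: adjE)
    then have "x * z = x * b + y * (x * v)" by (simp add: algebra_simps)
    then show "z \<in> {z \<in> C. x * z \<in> adj A y}" using v y Cons.prems(2) adjI[of "x * b" A "x * v" y] by auto
  qed
  have "wreg (adj A y) ys"
  proof (rule Cons.IH)
    show "wreg (adj (adj A y) x) ys" using Cons.prems(4) by (simp add: adj_commute[of A y x])
    show "wreg {z \<in> C. x * z \<in> adj A y} ys" using Cons.prems(5) 2 by simp
  qed (use Cons.prems in \<open>auto simp: idl_adj\<close>)
  with 1 show ?case by simp
qed simp

text \<open>Multiplication by \<open>x\<close> gives an exact sequence from
  \<open>C/(I + yC)\<close> over \<open>C/(I + xyC)\<close> to \<open>C/(I + xC)\<close>, and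
  \<open>rs\<close> is weakly regular on both ends.\<close>

lemma wreg_mult:
  assumes "idl I" "x \<in> C" "y \<in> C" "set rs \<subseteq> C" "wreg I (x # rs)" "wreg I (y # rs)"
  shows "wreg I (x * y # rs)"
proof -
  have "nzd I (x * y)" using assms unfolding nzd_def wreg.simps by (metis mult.assoc mult_mem)
  moreover have "wreg (adj I (x * y)) rs"
  proof (rule wreg_extension)
    show "idl (adj I (x * y))" using assms by (simp add: idl_adj)
    have "adj (adj I (x * y)) x = adj I x"
    proof
      show "adj (adj I (x * y)) x \<subseteq> adj I x"
      proof (rule adj_least)
        show "x \<in> adj I x" using adj_gen[of I 1 x] assms by simp
        show "adj I (x * y) \<subseteq> adj I x"
          using assms by (intro adj_least) (auto simp: idl_adj intro: adj_superset adj_gen)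
      qed (use assms in \<open>auto simp: idl_adj\<close>)
    qed (auto elim!: adjE intro!: adjI[OF adj_superset])
    then show "wreg (adj (adj I (x * y)) x) rs" using assms by simp
    have "{z \<in> C. x * z \<in> adj I (x * y)} = adj I y"
    proof (intro equalityI subsetI)
      fix z assume "z \<in> {z \<in> C. x * z \<in> adj I (x * y)}"
      then obtain a w where w: "z \<in> C" "a \<in> I" "w \<in> C" "x * z = a + x * y * w" by (auto elim: adjE)
      then have "x * (z - y * w) = a" by (simp add: algebra_simps)
      then have "z - y * w \<in> I" using assms w by (auto simp: nzd_def)
      then show "z \<in> adj I y" using adjI[of "z - y * w" I w y] w by simp
    next
      fix z assume "z \<in> adj I y"
      then obtain a w where w: "a \<in> I" "w \<in> C" "z = a + y * w" by (auto elim: adjE)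
      then have "x * z = x * a + x * y * w" by (simp add: algebra_simps)
      then show "z \<in> {z \<in> C. x * z \<in> adj I (x * y)}"
        using w assms adjI[of "x * a" I w "x * y"] idlD(4,1)[OF assms(1)] by auto
    qed
    then show "wreg {z \<in> C. x * z \<in> adj I (x * y)} rs" using assms by simp
  qed (use assms in auto)
  ultimately show ?thesis by simp
qed

lemma wreg_power_Cons:
  assumes "idl I" "x \<in> C" "set rs \<subseteq> C" "wreg I (x # rs)"
  shows "wreg I (x ^ Suc k # rs)"
proof (induction k)
  case (Suc k)
  then show ?case using wreg_mult[of I x "x ^ Suc k" rs] assms by simp
qed (use assms in simp)

text \<open>The head is replaced first. This leaves the tail weakly regular modulo the new head, and
  the induction continues over the enlarged ideal.\<close>

lemma wreg_powers:
  assumes "idl I" "set rs \<subseteq> C" "wreg I rs"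
  shows "wreg I (map (\<lambda>r. r ^ Suc k) rs)"
  using assms
proof (induction rs arbitrary: I)
  case (Cons r rs)
  then have "wreg I (r ^ Suc k # rs)" by (intro wreg_power_Cons) auto
  then show ?case using Cons by (auto simp del: power_Suc intro!: Cons.IH idl_adj)
qed simp

lemma wreg_append: "wreg I (rs @ ss) \<longleftrightarrow> wreg I rs \<and> wreg (foldl adj I rs) ss"
  by (induction rs arbitrary: I) auto

lemma idl_foldl_adj: "idl I \<Longrightarrow> set rs \<subseteq> C \<Longrightarrow> idl (foldl adj I rs)"
  by (induction rs arbitrary: I) (auto simp: idl_adj)

lemma wreg_iff_nth: "wreg I rs \<longleftrightarrow> (\<forall>i<length rs. nzd (foldl adj I (take i rs)) (rs ! i))"
proof (induction rs rule: rev_induct)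
  case (snoc r rs)
  then show ?case by (auto simp: wreg_append nth_append less_Suc_eq)
qed simp

text \<open>The lexicographically smallest term of the relation is peeled off one factor at a time.\<close>

lemma lex_peel:
  assumes "\<And>i. i \<le> length fs \<Longrightarrow> idl (I i)"
    and "\<And>i. i < length fs \<Longrightarrow> fs ! i \<in> C \<and> nzd (I i) (fs ! i) \<and> adj (I i) (fs ! i) \<subseteq> I (Suc i)"
    and "finite A" "A \<noteq> {}" "\<And>\<alpha>. \<alpha> \<in> A \<Longrightarrow> length \<alpha> = length fs"
    and "\<And>\<alpha>. \<alpha> \<in> A \<Longrightarrow> c \<alpha> \<in> C \<and> (\<exists>b\<in>C. b * c \<alpha> = 1)"
    and "u \<in> C" "(\<Sum>\<alpha>\<in>A. c \<alpha> * prod_list (map2 (^) fs \<alpha>)) * u \<in> I 0"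
  shows "u \<in> I (length fs)"
  using assms
proof (induction fs arbitrary: I A c)
  case Nil
  \<comment> \<open>All exponent lists have length 0, so the relation is a single unit times
    \<open>u\<close>.\<close>
  then have "A = {[]}" by auto
  then obtain b where "b \<in> C" "b * c [] = 1" using Nil.prems(6) by auto
  moreover have "c [] * u \<in> I 0" using Nil.prems(8) \<open>A = {[]}\<close> by simp
  moreover have "idl (I 0)" using Nil.prems(1) by simp
  ultimately have "b * (c [] * u) \<in> I 0" using idlD by blast
  then show ?case using \<open>b * c [] = 1\<close> by (simp flip: mult.assoc)
next
  case (Cons f fs)
  have f: "f \<in> C" "nzd (I 0) f" "adj (I 0) f \<subseteq> I 1" using Cons.prems(2)[of 0] by auto
  have fsC: "set fs \<subseteq> C" using Cons.prems(2)[of "Suc _"] by (auto simp: in_set_conv_nth)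
  \<comment> \<open>\<open>a\<close> is the least exponent of \<open>f\<close> in the relation. The
    terms from \<open>A1\<close> have exactly this exponent, all others carry a further factor
    \<open>f\<close>; cancelling \<open>f ^ a\<close> and reducing modulo \<open>f\<close> leaves
    the relation over \<open>A1\<close> with one factor less.\<close>
  define a where "a = Min (hd ` A)"
  define A1 where "A1 = {\<beta>. a # \<beta> \<in> A}"
  define A2 where "A2 = {\<alpha> \<in> A. hd \<alpha> \<noteq> a}"
  define tm where "tm \<alpha> = c \<alpha> * prod_list (map2 (^) (f # fs) \<alpha>)" for \<alpha>
  have monC: "prod_list (map2 (^) gs \<beta>) \<in> C" if "set gs \<subseteq> C" for gs and \<beta> :: "nat list"
    using that
  proof (induction gs arbitrary: \<beta>)
    case (Cons g gs) then show ?case by (cases \<beta>) auto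
  qed simp
  have ne: "\<alpha> \<noteq> []" if "\<alpha> \<in> A" for \<alpha> using Cons.prems(5)[OF that] by auto
  have "a \<in> hd ` A" unfolding a_def using Cons.prems(3,4) by (intro Min_in) auto
  then obtain \<beta>0 where "a # \<beta>0 \<in> A" using ne by (metis imageE list.collapse)
  then have A1ne: "A1 \<noteq> {}" by (auto simp: A1_def)
  have A_split: "A = (#) a ` A1 \<union> A2"
  proof (intro equalityI subsetI)
    fix \<alpha> assume "\<alpha> \<in> A"
    moreover then have "\<alpha> = hd \<alpha> # tl \<alpha>" using ne by simp
    ultimately show "\<alpha> \<in> (#) a ` A1 \<union> A2"
      by (cases "hd \<alpha> = a") (auto simp: A1_def A2_def intro!: image_eqI[of _ _ "tl \<alpha>"])
  qed (auto simp: A1_def A2_def)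
  have fin: "finite A1" "finite A2"
    using Cons.prems(3) finite_vimageI[of A "(#) a"] by (auto simp: A1_def A2_def vimage_def)
  have disj: "(#) a ` A1 \<inter> A2 = {}" by (auto simp: A2_def)
  have A2_term: "\<exists>w\<in>C. tm \<alpha> = f ^ Suc a * w" if "\<alpha> \<in> A2" for \<alpha>
  proof -
    have "\<alpha> \<in> A" using that by (simp add: A2_def)
    then obtain b \<beta> where \<alpha>: "\<alpha> = b # \<beta>" using ne[of \<alpha>] by (cases \<alpha>) auto
    have "a \<le> hd \<alpha>" using \<open>\<alpha> \<in> A\<close> unfolding a_def using Cons.prems(3) by (intro Min_le) auto
    moreover have "hd \<alpha> \<noteq> a" using that by (simp add: A2_def)
    ultimately have "a < b" using \<alpha> by simp
    then have "f ^ b = f ^ Suc a * f ^ (b - Suc a)" by (metis Suc_leI le_add_diff_inverse power_add)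
    then have "tm \<alpha> = f ^ Suc a * (f ^ (b - Suc a) * (c \<alpha> * prod_list (map2 (^) fs \<beta>)))"
      unfolding tm_def \<alpha> by (simp add: algebra_simps)
    moreover have "f ^ (b - Suc a) * (c \<alpha> * prod_list (map2 (^) fs \<beta>)) \<in> C"
      using f Cons.prems(6)[OF \<open>\<alpha> \<in> A\<close>] monC[OF fsC] by auto
    ultimately show ?thesis by blast
  qed
  then obtain w where w: "\<And>\<alpha>. \<alpha> \<in> A2 \<Longrightarrow> w \<alpha> \<in> C \<and> tm \<alpha> = f ^ Suc a * w \<alpha>" by metis
  define W where "W = sum w A2"
  have W: "W \<in> C" unfolding W_def using w by blast
  define s where "s = (\<Sum>\<beta>\<in>A1. c (a # \<beta>) * prod_list (map2 (^) fs \<beta>))"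
  have s: "s \<in> C" unfolding s_def using Cons.prems(6) monC[OF fsC] by (auto simp: A1_def intro!: sum_mem)
  have "(\<Sum>\<alpha>\<in>A. tm \<alpha>) = (\<Sum>\<alpha>\<in>(#) a ` A1. tm \<alpha>) + (\<Sum>\<alpha>\<in>A2. tm \<alpha>)"
    unfolding A_split using fin disj by (intro sum.union_disjoint) auto
  also have "(\<Sum>\<alpha>\<in>(#) a ` A1. tm \<alpha>) = f ^ a * s"
    by (subst sum.reindex) (auto simp: tm_def s_def sum_distrib_left algebra_simps inj_on_def intro!: sum.cong)
  also have "(\<Sum>\<alpha>\<in>A2. tm \<alpha>) = f ^ Suc a * W"
    unfolding W_def sum_distrib_left using w by (intro sum.cong) auto
  finally have "(\<Sum>\<alpha>\<in>A. tm \<alpha>) * u = f ^ a * (s * u + f * (W * u))" by (simp add: algebra_simps)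
  then have "f ^ a * (s * u + f * (W * u)) \<in> I 0" using Cons.prems(8) by (simp add: tm_def)
  moreover have "x \<in> I 0" if "f ^ k * x \<in> I 0" "x \<in> C" for k x
    using that
  proof (induction k)
    case (Suc k)
    have "f * (f ^ k * x) \<in> I 0" using Suc.prems by (simp add: mult.assoc)
    then have "f ^ k * x \<in> I 0" using f Suc.prems by (auto simp: nzd_def)
    then show ?case using Suc by simp
  qed simp
  ultimately have "s * u + f * (W * u) \<in> I 0" using s W f Cons.prems(7) by blast
  then have "(s * u + f * (W * u)) + f * (- (W * u)) \<in> adj (I 0) f"
    using W Cons.prems(7) by (intro adjI) auto
  then have su: "s * u \<in> I 1" using f by auto
  have "u \<in> (I \<circ> Suc) (length fs)"
  proof (rule Cons.IH[of "I \<circ> Suc" A1 "\<lambda>\<beta>. c (a # \<beta>)"])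
    show "idl ((I \<circ> Suc) i)" if "i \<le> length fs" for i using Cons.prems(1) that by simp
    show "fs ! i \<in> C \<and> nzd ((I \<circ> Suc) i) (fs ! i) \<and> adj ((I \<circ> Suc) i) (fs ! i) \<subseteq> (I \<circ> Suc) (Suc i)"
      if "i < length fs" for i using Cons.prems(2)[of "Suc i"] that by simp
    show "length \<beta> = length fs" if "\<beta> \<in> A1" for \<beta>
      using Cons.prems(5)[of "a # \<beta>"] that by (simp add: A1_def)
    show "c (a # \<beta>) \<in> C \<and> (\<exists>b\<in>C. b * c (a # \<beta>) = 1)" if "\<beta> \<in> A1" for \<beta>
      using Cons.prems(6)[of "a # \<beta>"] that by (simp add: A1_def)
  qed (use fin A1ne Cons.prems(7) su in \<open>auto simp: s_def\<close>)
  then show ?case by simp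
qed

text \<open>Weak regularity refers to the predecessors of each member of the sequence, this condition to
  its successors, as is natural for triangular sequences.\<close>

fun strongly_regular :: "'a set \<Rightarrow> 'a list \<Rightarrow> bool" where
  "strongly_regular I [] \<longleftrightarrow> True"
| "strongly_regular I (f # gs) \<longleftrightarrow>
    (\<forall>hs. set hs \<subseteq> set gs \<longrightarrow> nzd (foldl adj I hs) f) \<and> strongly_regular I gs"

lemma foldl_adj_commute: "foldl adj (adj I f) hs = adj (foldl adj I hs) f"
  by (induction hs arbitrary: I) (auto simp: adj_commute)

text \<open>Half of the exchange of neighbours in a regular sequence, valid in every ring: if
  \<open>b\<close>, \<open>a\<close> is regular, then \<open>b\<close> remains a nonzerodivisor
  modulo \<open>a\<close>. The other half, that \<open>a\<close> is one modulo \<open>I\<close>, is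
  a matter of Nakayama and therefore built into \<open>strongly_regular\<close>.\<close>

lemma nzd_swap:
  assumes "idl I" "a \<in> C" "b \<in> C" "nzd I b" "nzd (adj I b) a"
  shows "nzd (adj I a) b"
  unfolding nzd_def
proof (intro ballI impI)
  fix z assume z: "z \<in> C" "b * z \<in> adj I a"
  then obtain i w where w: "i \<in> I" "w \<in> C" "b * z = i + a * w" by (auto elim: adjE)
  have "a * w = - i + b * z" using w by simp
  then have "a * w \<in> adj I b" using w z idlD(6)[OF assms(1)] adjI by metis
  then have "w \<in> adj I b" using assms w nzdD by blast
  then obtain j v where v: "j \<in> I" "v \<in> C" "w = j + b * v" by (rule adjE)
  have "b * (z - a * v) = i + a * j" using w(3) unfolding v(3) by (simp add: algebra_simps)
  then have "b * (z - a * v) \<in> I" using w v assms idlD[OF assms(1)] by metis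
  then have "z - a * v \<in> I" using assms z v by (auto simp: nzd_def)
  then show "z \<in> adj I a" using adjI[of "z - a * v" I v a] v by simp
qed

text \<open>\<open>gs'\<close> is the whole tail and stays fixed while \<open>gs\<close> shrinks:
  the exchange of \<open>f\<close> with a member \<open>g\<close> refers to \<open>f\<close> modulo
  \<open>hs @ [g]\<close>, so the assumption on \<open>f\<close> has to keep covering
  \<open>g\<close>.\<close>

lemma strongly_regular_adj:
  assumes "idl I" "f \<in> C" "set gs \<subseteq> set gs'" "set gs' \<subseteq> C"
    "\<And>hs. set hs \<subseteq> set gs' \<Longrightarrow> nzd (foldl adj I hs) f" "strongly_regular I gs"
  shows "strongly_regular (adj I f) gs"
  using assms
proof (induction gs)
  case (Cons g gs)
  have "nzd (foldl adj (adj I f) hs) g" if "set hs \<subseteq> set gs" for hs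
    unfolding foldl_adj_commute
  proof (rule nzd_swap)
    show "idl (foldl adj I hs)" using that Cons.prems by (intro idl_foldl_adj) auto
    show "nzd (foldl adj I hs) g" using that Cons.prems by simp
    have "nzd (foldl adj I (hs @ [g])) f" using that Cons.prems by (intro Cons.prems(5)) auto
    then show "nzd (adj (foldl adj I hs) g) f" by simp
  qed (use Cons.prems in auto)
  then show ?case using Cons by simp
qed simp

lemma strongly_regular_imp_wreg:
  assumes "idl I" "set fs \<subseteq> C" "strongly_regular I fs"
  shows "wreg I fs"
  using assms
proof (induction fs arbitrary: I)
  case (Cons f gs)
  have "nzd I f" using Cons.prems(3) by (auto dest: spec[of _ "[]"])
  moreover have "strongly_regular (adj I f) gs"
    using Cons.prems strongly_regular_adj[of I f gs gs] by auto
  ultimately show ?case using Cons by (simp add: idl_adj)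
qed simp

end

section \<open>Quotients as rings and as modules\<close>

lemma cring_idealI:
  fixes R (structure)
  assumes "cring R" "I \<subseteq> carrier R" "\<zero> \<in> I"
    "\<And>a b. a \<in> I \<Longrightarrow> b \<in> I \<Longrightarrow> a \<oplus> b \<in> I"
    "\<And>a r. a \<in> I \<Longrightarrow> r \<in> carrier R \<Longrightarrow> r \<otimes> a \<in> I"
  shows "ideal I R"
proof -
  interpret cring R by fact
  have inv: "\<ominus> a \<in> I" if "a \<in> I" for a
  proof -
    have "\<ominus> a = (\<ominus> \<one>) \<otimes> a" using that assms(2) by (auto simp: l_minus)
    then show ?thesis using assms(5)[OF that, of "\<ominus> \<one>"] by simp
  qed
  show ?thesis
  proof (rule idealI)
    show "ring R" by (rule ring_axioms)
    show "subgroup I (add_monoid R)"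
      using assms inv by (intro subgroup.intro) (auto simp: a_inv_def)
    show "r \<otimes> a \<in> I" if "a \<in> I" "r \<in> carrier R" for a r using assms that by blast
    then show "a \<otimes> r \<in> I" if "a \<in> I" "r \<in> carrier R" for a r
      using that assms(2) m_comm by (metis subsetD)
  qed
qed

context subring_set
begin

definition RR :: "'a ring" where
  "RR = \<lparr>carrier = C, monoid.mult = (*), one = 1, ring.zero = 0, add = (+)\<rparr>"

lemma RR_simps [simp]:
  "carrier RR = C" "monoid.mult RR = (*)" "one RR = 1" "ring.zero RR = 0" "add RR = (+)"
  by (simp_all add: RR_def)

lemma cring_RR: "cring RR"
proof (rule cringI)
  show "abelian_group RR"
    by (rule abelian_groupI) (auto simp: algebra_simps intro: bexI[of _ "- _"])
  show "comm_monoid RR"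
    by (rule comm_monoidI) (auto simp: algebra_simps)
qed (auto simp: algebra_simps)

lemma ideal_RR_iff: "ideal I RR \<longleftrightarrow> idl I"
proof
  assume "ideal I RR"
  then interpret ideal I RR .
  show "idl I" unfolding idl_def
    using a_Hcarr additive_subgroup.zero_closed[OF is_additive_subgroup]
      additive_subgroup.a_closed[OF is_additive_subgroup] I_l_closed by auto
next
  assume "idl I"
  then show "ideal I RR"
    using idlD[of I] by (intro cring_idealI cring_RR) auto
qed

definition prim :: "'a set \<Rightarrow> bool" where
  "prim P \<longleftrightarrow> idl P \<and> P \<noteq> C \<and> (\<forall>a\<in>C. \<forall>b\<in>C. a * b \<in> P \<longrightarrow> a \<in> P \<or> b \<in> P)"

definition coset :: "'a set \<Rightarrow> 'a \<Rightarrow> 'a set" where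
  "coset I x = I +>\<^bsub>RR\<^esub> x"

lemma coset_eq: "coset I x = (\<lambda>i. i + x) ` I"
  by (auto simp: coset_def a_r_coset_def')

lemma coset_eq_iff:
  assumes "idl I" shows "coset I x = coset I y \<longleftrightarrow> x - y \<in> I"
proof
  assume "coset I x = coset I y"
  moreover have "0 + x \<in> coset I x" unfolding coset_eq using assms idlD(2) by blast
  ultimately obtain i where "i \<in> I" "x = i + y" by (auto simp: coset_eq)
  then show "x - y \<in> I" by simp
next
  have sub: "coset I x \<subseteq> coset I y" if "x - y \<in> I" for x y
  proof
    fix z assume "z \<in> coset I x"
    then obtain i where "i \<in> I" "z = i + x" by (auto simp: coset_eq)
    then have "z = (i + (x - y)) + y" "i + (x - y) \<in> I" using that idlD(3)[OF assms] by auto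
    then show "z \<in> coset I y" unfolding coset_eq by blast
  qed
  assume xy: "x - y \<in> I"
  moreover have "y - x \<in> I" using idlD(6)[OF assms xy] by simp
  ultimately show "coset I x = coset I y" using sub by blast
qed

lemma coset_image_iff:
  assumes "idl I" "idl L" "I \<subseteq> L"
  shows "coset I x \<in> coset I ` L \<longleftrightarrow> x \<in> L"
proof
  assume "coset I x \<in> coset I ` L"
  then obtain y where "y \<in> L" "x - y \<in> I" using coset_eq_iff[OF assms(1)] by auto
  then have "(x - y) + y \<in> L" using assms by (intro idlD(3)[OF assms(2)]) auto
  then show "x \<in> L" by simp
qed simp

lemma Quot_simps:
  assumes "idl I"
  shows "carrier (RR Quot I) = coset I ` C"
    and "one (RR Quot I) = coset I 1" "ring.zero (RR Quot I) = coset I 0"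
    and "x \<in> C \<Longrightarrow> y \<in> C \<Longrightarrow> monoid.mult (RR Quot I) (coset I x) (coset I y) = coset I (x * y)"
    and "x \<in> C \<Longrightarrow> y \<in> C \<Longrightarrow> add (RR Quot I) (coset I x) (coset I y) = coset I (x + y)"
proof -
  interpret ideal I RR using assms by (simp add: ideal_RR_iff)
  show "carrier (RR Quot I) = coset I ` C"
    by (auto simp: FactRing_def A_RCOSETS_def' coset_def)
  show "one (RR Quot I) = coset I 1" by (simp add: FactRing_def coset_def)
  show "ring.zero (RR Quot I) = coset I 0" by (auto simp add: FactRing_def coset_eq)
  note h = rcos_ring_hom
  show "x \<in> C \<Longrightarrow> y \<in> C \<Longrightarrow> monoid.mult (RR Quot I) (coset I x) (coset I y) = coset I (x * y)"
    using ring_hom_mult[OF h, of x y] by (simp add: coset_def)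
  show "x \<in> C \<Longrightarrow> y \<in> C \<Longrightarrow> add (RR Quot I) (coset I x) (coset I y) = coset I (x + y)"
    using ring_hom_add[OF h, of x y] by (simp add: coset_def)
qed

lemma quotient_module_simps:
  assumes "idl I"
  shows "carrier (quotient_module RR I) = coset I ` C"
    and "ring.zero (quotient_module RR I) = coset I 0"
    and "x \<in> C \<Longrightarrow> y \<in> C \<Longrightarrow> add (quotient_module RR I) (coset I x) (coset I y) = coset I (x + y)"
    and "r \<in> C \<Longrightarrow> x \<in> C \<Longrightarrow> smult (quotient_module RR I) r (coset I x) = coset I (r * x)"
proof -
  interpret ideal I RR using assms by (simp add: ideal_RR_iff)
  have e: "carrier (quotient_module RR I) = carrier (RR Quot I)"
    "add (quotient_module RR I) = add (RR Quot I)"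
    "ring.zero (quotient_module RR I) = ring.zero (RR Quot I)"
    "smult (quotient_module RR I) = (\<lambda>r Y. rcoset_mult RR I (I +>\<^bsub>RR\<^esub> r) Y)"
    by (simp_all add: quotient_module_def ring.extend_def)
  show "carrier (quotient_module RR I) = coset I ` C" "ring.zero (quotient_module RR I) = coset I 0"
    "x \<in> C \<Longrightarrow> y \<in> C \<Longrightarrow> add (quotient_module RR I) (coset I x) (coset I y) = coset I (x + y)"
    using Quot_simps[OF assms] e by simp_all
  show "r \<in> C \<Longrightarrow> x \<in> C \<Longrightarrow> smult (quotient_module RR I) r (coset I x) = coset I (r * x)"
    using rcoset_mult_add[of r x] by (simp add: e coset_def)
qed

lemma module_quotient:
  assumes "idl I" shows "Module.module RR (quotient_module RR I)"
proof (rule moduleI)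
  note s = quotient_module_simps[OF assms]
  show "cring RR" by (rule cring_RR)
  show "abelian_group (quotient_module RR I)"
  proof (rule abelian_groupI)
    fix x assume "x \<in> carrier (quotient_module RR I)"
    then obtain a where "a \<in> C" "x = coset I a" by (auto simp: s)
    then show "\<exists>y\<in>carrier (quotient_module RR I).
        add (quotient_module RR I) y x = ring.zero (quotient_module RR I)"
      by (intro bexI[of _ "coset I (- a)"]) (auto simp: s)
  qed (auto simp: s algebra_simps)
qed (auto simp: quotient_module_simps[OF assms] algebra_simps)

end

section \<open>Regular sequences on a quotient module\<close>

lemma (in Module.module) seq_submodule_0: "seq_submodule M rs 0 = {\<zero>\<^bsub>M\<^esub>}"
  by (auto simp: seq_submodule_def)

lemma (in Module.module) seq_submodule_Suc:
  assumes "\<And>j. j \<le> k \<Longrightarrow> rs ! j \<in> carrier R"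
  shows "seq_submodule M rs (Suc k) =
    {s \<oplus>\<^bsub>M\<^esub> (rs ! k) \<odot>\<^bsub>M\<^esub> m | s m. s \<in> seq_submodule M rs k \<and> m \<in> carrier M}" (is "?L = ?R")
proof (intro equalityI subsetI)
  fix z assume "z \<in> ?L"
  then obtain m where m: "m \<in> {..<Suc k} \<rightarrow> carrier M"
    "z = (\<Oplus>\<^bsub>M\<^esub>j\<in>{..<Suc k}. (rs ! j) \<odot>\<^bsub>M\<^esub> m j)" by (auto simp: seq_submodule_def)
  have "z = (\<Oplus>\<^bsub>M\<^esub>j\<in>insert k {..<k}. (rs ! j) \<odot>\<^bsub>M\<^esub> m j)"
    using m by (simp add: lessThan_Suc)
  also have "\<dots> = (rs ! k) \<odot>\<^bsub>M\<^esub> m k \<oplus>\<^bsub>M\<^esub> (\<Oplus>\<^bsub>M\<^esub>j\<in>{..<k}. (rs ! j) \<odot>\<^bsub>M\<^esub> m j)"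
    using m assms by (intro M.finsum_insert) (auto intro!: smult_closed)
  also have "\<dots> = (\<Oplus>\<^bsub>M\<^esub>j\<in>{..<k}. (rs ! j) \<odot>\<^bsub>M\<^esub> m j) \<oplus>\<^bsub>M\<^esub> (rs ! k) \<odot>\<^bsub>M\<^esub> m k"
    using m assms by (intro M.a_comm) (auto intro!: smult_closed M.finsum_closed)
  finally have "z = (\<Oplus>\<^bsub>M\<^esub>j\<in>{..<k}. (rs ! j) \<odot>\<^bsub>M\<^esub> m j) \<oplus>\<^bsub>M\<^esub> (rs ! k) \<odot>\<^bsub>M\<^esub> m k" .
  moreover have "(\<Oplus>\<^bsub>M\<^esub>j\<in>{..<k}. (rs ! j) \<odot>\<^bsub>M\<^esub> m j) \<in> seq_submodule M rs k"
    using m unfolding seq_submodule_def by (intro CollectI exI[of _ m]) auto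
  ultimately show "z \<in> ?R" using m by blast
next
  fix z assume "z \<in> ?R"
  then obtain m' x where m: "m' \<in> {..<k} \<rightarrow> carrier M" "x \<in> carrier M"
    "z = (\<Oplus>\<^bsub>M\<^esub>j\<in>{..<k}. (rs ! j) \<odot>\<^bsub>M\<^esub> m' j) \<oplus>\<^bsub>M\<^esub> (rs ! k) \<odot>\<^bsub>M\<^esub> x"
    by (auto simp: seq_submodule_def)
  define m where "m = m'(k := x)"
  have mc: "m \<in> {..<Suc k} \<rightarrow> carrier M" using m by (auto simp: m_def Pi_iff less_Suc_eq)
  have "(\<Oplus>\<^bsub>M\<^esub>j\<in>{..<Suc k}. (rs ! j) \<odot>\<^bsub>M\<^esub> m j) = (\<Oplus>\<^bsub>M\<^esub>j\<in>insert k {..<k}. (rs ! j) \<odot>\<^bsub>M\<^esub> m j)"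
    by (simp add: lessThan_Suc)
  also have "\<dots> = (rs ! k) \<odot>\<^bsub>M\<^esub> m k \<oplus>\<^bsub>M\<^esub> (\<Oplus>\<^bsub>M\<^esub>j\<in>{..<k}. (rs ! j) \<odot>\<^bsub>M\<^esub> m j)"
    using mc assms by (intro M.finsum_insert) (auto intro!: smult_closed)
  also have "(\<Oplus>\<^bsub>M\<^esub>j\<in>{..<k}. (rs ! j) \<odot>\<^bsub>M\<^esub> m j) = (\<Oplus>\<^bsub>M\<^esub>j\<in>{..<k}. (rs ! j) \<odot>\<^bsub>M\<^esub> m' j)"
    using m assms by (intro M.finsum_cong') (auto simp: m_def intro!: smult_closed)
  also have "(rs ! k) \<odot>\<^bsub>M\<^esub> m k \<oplus>\<^bsub>M\<^esub> \<dots> = z"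
    unfolding m(3) using m assms
    by (subst M.a_comm) (auto simp: m_def intro!: smult_closed M.finsum_closed)
  finally show "z \<in> ?L" using mc by (auto simp: seq_submodule_def)
qed

context subring_set
begin

text \<open>The submodules in the definition of regular sequences on \<open>C/I\<close> are images
  of ideals of \<open>C\<close>. This moves regular sequences from the module record to the
  predicates \<open>nzd\<close> and \<open>wreg\<close>.\<close>

lemma seq_submodule_quotient:
  assumes "idl I" "set rs \<subseteq> C" "k \<le> length rs"
  shows "seq_submodule (quotient_module RR I) rs k = coset I ` foldl adj I (take k rs)"
  using assms(3)
proof (induction k)
  case 0
  interpret Module.module RR "quotient_module RR I" by (rule module_quotient) fact
  have "coset I ` I = {coset I 0}"
    using coset_eq_iff[OF assms(1)] idlD(2)[OF assms(1)]
    by (intro equalityI image_subsetI) (auto simp del: Set.image_iff)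
  then show ?case by (simp add: seq_submodule_0 quotient_module_simps[OF assms(1)])
next
  case (Suc k)
  interpret Module.module RR "quotient_module RR I" by (rule module_quotient) fact
  note s = quotient_module_simps[OF assms(1)]
  define L where "L = foldl adj I (take k rs)"
  have L: "idl L" unfolding L_def using assms by (intro idl_foldl_adj) (auto dest: in_set_takeD)
  have r: "rs ! j \<in> C" if "j \<le> k" for j using assms Suc.prems that by auto
  have "seq_submodule (quotient_module RR I) rs (Suc k) =
     {add (quotient_module RR I) s (smult (quotient_module RR I) (rs ! k) m) | s m.
       s \<in> coset I ` L \<and> m \<in> coset I ` C}"
    using Suc r by (subst seq_submodule_Suc) (auto simp: s L_def)
  also have "\<dots> = coset I ` adj L (rs ! k)"
  proof (intro equalityI subsetI)
    fix z assume "z \<in> {add (quotient_module RR I) s (smult (quotient_module RR I) (rs ! k) m) | s m.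
       s \<in> coset I ` L \<and> m \<in> coset I ` C}"
    then obtain a x where a: "a \<in> L" "x \<in> C"
      "z = add (quotient_module RR I) (coset I a) (smult (quotient_module RR I) (rs ! k) (coset I x))"
      by auto
    then have "z = coset I (a + rs ! k * x)" using r[of k] idlD(1)[OF L] by (simp add: s)
    then show "z \<in> coset I ` adj L (rs ! k)" using a by (auto intro: adjI)
  next
    fix z assume "z \<in> coset I ` adj L (rs ! k)"
    then obtain a x where a: "a \<in> L" "x \<in> C" "z = coset I (a + rs ! k * x)" by (auto elim!: adjE)
    then have "z = add (quotient_module RR I) (coset I a) (smult (quotient_module RR I) (rs ! k) (coset I x))"
      using r[of k] idlD(1)[OF L] by (simp add: s)
    with a show "z \<in> {add (quotient_module RR I) s (smult (quotient_module RR I) (rs ! k) m) | s m.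
       s \<in> coset I ` L \<and> m \<in> coset I ` C}" by blast
  qed
  finally show ?case using Suc.prems by (simp add: L_def take_Suc_conv_app_nth)
qed

lemma subset_foldl_adj: "I \<subseteq> foldl adj I rs"
  by (induction rs arbitrary: I) (use adj_superset in \<open>force+\<close>)

lemma regular_sequence_quotient_iff:
  assumes "idl I"
  shows "regular_sequence RR (quotient_module RR I) rs \<longleftrightarrow>
    set rs \<subseteq> C \<and> wreg I rs \<and> foldl adj I rs \<noteq> C"
proof (cases "set rs \<subseteq> C")
  case True
  note s = quotient_module_simps[OF assms]
  have L: "idl (foldl adj I (take k rs))" for k
    using assms True by (intro idl_foldl_adj) (auto dest: in_set_takeD)
  have "coset I ` foldl adj I rs = coset I ` C \<longleftrightarrow> foldl adj I rs = C"
    using coset_image_iff[OF assms _ subset_foldl_adj] L[of "length rs"] idlD(1) 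
    by (simp, metis image_eqI subsetI subset_antisym)
  moreover have "(\<forall>x\<in>carrier (quotient_module RR I).
       smult (quotient_module RR I) (rs ! i) x \<in> coset I ` foldl adj I (take i rs) \<longrightarrow>
       x \<in> coset I ` foldl adj I (take i rs)) \<longleftrightarrow> nzd (foldl adj I (take i rs)) (rs ! i)"
    if "i < length rs" for i
  proof -
    have "rs ! i \<in> C" using True that by auto
    then show ?thesis
      using coset_image_iff[OF assms L subset_foldl_adj]
      by (auto simp: s nzd_def)
  qed
  ultimately show ?thesis
    unfolding regular_sequence_def wreg_iff_nth
    using True seq_submodule_quotient[OF assms True] by (auto simp: s)
qed (auto simp: regular_sequence_def)

section \<open>Primes of a quotient ring\<close>

lemma prim_preimage:
  assumes "idl I" "primeideal Q (RR Quot I)"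
  shows "prim {x \<in> C. coset I x \<in> Q}" "I \<subseteq> {x \<in> C. coset I x \<in> Q}"
proof -
  note s = Quot_simps[OF assms(1)]
  interpret Q: primeideal Q "RR Quot I" by fact
  have "{x \<in> C. coset I x \<in> Q} \<noteq> C"
  proof
    assume "{x \<in> C. coset I x \<in> Q} = C"
    then have "carrier (RR Quot I) \<subseteq> Q" by (auto simp: s)
    then show False using Q.I_notcarr Q.a_subset by blast
  qed
  moreover have "idl {x \<in> C. coset I x \<in> Q}"
    unfolding idl_def
    using Q.zero_closed Q.a_closed Q.I_l_closed by (fastforce simp: s simp flip: s(3-5))
  moreover have "a \<in> {x \<in> C. coset I x \<in> Q} \<or> b \<in> {x \<in> C. coset I x \<in> Q}"
    if "a \<in> C" "b \<in> C" "a * b \<in> {x \<in> C. coset I x \<in> Q}" for a b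
    using Q.I_prime[of "coset I a" "coset I b"] that by (auto simp: s)
  ultimately show "prim {x \<in> C. coset I x \<in> Q}" by (auto simp: prim_def)
  have "coset I x = coset I 0" if "x \<in> I" for x using that coset_eq_iff[OF assms(1)] by simp
  then show "I \<subseteq> {x \<in> C. coset I x \<in> Q}"
    using additive_subgroup.zero_closed[OF Q.is_additive_subgroup] idlD(1)[OF assms(1)]
    unfolding s by auto
qed

lemma primeideal_image:
  assumes "idl I" "prim P" "I \<subseteq> P"
  shows "primeideal (coset I ` P) (RR Quot I)"
proof -
  note s = Quot_simps[OF assms(1)]
  have P: "idl P" using assms(2) by (simp add: prim_def)
  note m = coset_image_iff[OF assms(1) P assms(3)]
  have cr: "cring (RR Quot I)"
    using ideal.quotient_is_cring[of I RR] ideal_RR_iff assms(1) cring_RR by blast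
  show ?thesis
  proof (rule primeidealI)
    show "ideal (coset I ` P) (RR Quot I)"
      using idlD[OF P] by (intro cring_idealI cr) (auto simp: s intro!: imageI)
    show "carrier (RR Quot I) \<noteq> coset I ` P"
    proof
      assume "carrier (RR Quot I) = coset I ` P"
      then have "coset I x \<in> coset I ` P" if "x \<in> C" for x using that unfolding s by blast
      then have "x \<in> P" if "x \<in> C" for x using m that by blast
      then show False using assms(2) idlD(1)[OF P] by (auto simp: prim_def)
    qed
    show "a \<in> coset I ` P \<or> b \<in> coset I ` P"
      if ab: "a \<in> carrier (RR Quot I)" "b \<in> carrier (RR Quot I)"
        "a \<otimes>\<^bsub>RR Quot I\<^esub> b \<in> coset I ` P" for a b
    proof -
      obtain x y where xy: "x \<in> C" "y \<in> C" "a = coset I x" "b = coset I y"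
        using ab(1,2) by (auto simp: s)
      then have "x * y \<in> P" using ab(3) m by (simp add: s)
      then show ?thesis using xy assms(2) by (auto simp: prim_def)
    qed
  qed (rule cr)
qed

text \<open>Preimages and images translate the chains into each other. Strict inclusions survive in
  both directions: elements of a prime of the quotient are cosets, and a coset lies in the image of
  an ideal above \<open>I\<close> exactly if its representatives lie in that ideal.\<close>

lemma krull_dim_quotient:
  assumes "idl I"
  shows "krull_dim (RR Quot I) = Sup {enat l | l.
     \<exists>p. (\<forall>i\<le>l. prim (p i) \<and> I \<subseteq> p i) \<and> (\<forall>i<l. p i \<subset> p (Suc i))}"
proof -
  note s = Quot_simps[OF assms]
  have "(\<exists>p. (\<forall>i\<le>l. primeideal (p i) (RR Quot I)) \<and> (\<forall>i<l. p i \<subset> p (Suc i))) \<longleftrightarrow>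
    (\<exists>p. (\<forall>i\<le>l. prim (p i) \<and> I \<subseteq> p i) \<and> (\<forall>i<l. p i \<subset> p (Suc i)))" (is "?L \<longleftrightarrow> ?R") for l
  proof
    assume ?L
    then obtain q where q: "\<And>i. i \<le> l \<Longrightarrow> primeideal (q i) (RR Quot I)" "\<And>i. i < l \<Longrightarrow> q i \<subset> q (Suc i)"
      by auto
    have "{x \<in> C. coset I x \<in> q i} \<subset> {x \<in> C. coset I x \<in> q (Suc i)}" if i: "i < l" for i
    proof -
      obtain Y where Y: "Y \<in> q (Suc i)" "Y \<notin> q i" using q(2)[OF i] by auto
      have "Y \<in> carrier (RR Quot I)"
        using q(1)[of "Suc i"] i Y additive_subgroup.a_subset ideal.axioms(1) primeideal.axioms(1)
        by (metis Suc_leI subsetD)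
      then show ?thesis using q(2)[OF i] Y by (auto simp: s)
    qed
    then show ?R using prim_preimage[OF assms q(1)]
      by (intro exI[of _ "\<lambda>i. {x \<in> C. coset I x \<in> q i}"]) auto
  next
    assume ?R
    then obtain p where p: "\<And>i. i \<le> l \<Longrightarrow> prim (p i) \<and> I \<subseteq> p i" "\<And>i. i < l \<Longrightarrow> p i \<subset> p (Suc i)"
      by auto
    have "coset I ` p i \<subset> coset I ` p (Suc i)" if i: "i < l" for i
    proof -
      have ip: "idl (p i)" "I \<subseteq> p i" using p(1)[of i] i by (auto simp: prim_def)
      obtain x where "x \<in> p (Suc i)" "x \<notin> p i" using p(2)[OF i] by auto
      then have "coset I x \<in> coset I ` p (Suc i)" "coset I x \<notin> coset I ` p i"
        using coset_image_iff[OF assms ip] by auto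
      then show ?thesis using p(2)[OF i] by blast
    qed
    then show ?L using primeideal_image[OF assms] p(1) by (intro exI[of _ "\<lambda>i. coset I ` p i"]) auto
  qed
  then show ?thesis by (simp add: krull_dim_def)
qed

end

section \<open>Polynomials and Stanley--Reisner ideals\<close>

abbreviation "keys \<equiv> Poly_Mapping.keys"
abbreviation "lookup \<equiv> Poly_Mapping.lookup"
abbreviation "single \<equiv> Poly_Mapping.single"

lemma keys_add_nat: "keys (a + b) = keys a \<union> keys b"
  for a b :: "'a \<Rightarrow>\<^sub>0 nat"
  by (auto simp: in_keys_iff lookup_add)

definition polys :: "nat \<Rightarrow> 'k::field mpoly set" where
  "polys n = {p. \<forall>m\<in>keys p. keys m \<subseteq> {1..n}}"

text \<open>The part of \<open>p\<close> in the monomials that satisfy \<open>Q\<close>. With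
  \<open>keys m \<subseteq> F\<close> it is the projection onto K[F]; with a condition on the
  exponent of one variable it is a homogeneous part with respect to that variable.\<close>

definition restr :: "((nat \<Rightarrow>\<^sub>0 nat) \<Rightarrow> bool) \<Rightarrow> 'k::field mpoly \<Rightarrow> 'k mpoly" where
  "restr Q p = Poly_Mapping.mapp (\<lambda>m c. if Q m then c else 0) p"

lemma lookup_restr: "lookup (restr Q p) m = (if Q m then lookup p m else 0)"
  by (auto simp: restr_def lookup_mapp in_keys_iff when_def)

lemma keys_restr: "keys (restr Q p) = {m \<in> keys p. Q m}"
  by (auto simp: in_keys_iff lookup_restr split: if_splits)

lemma restr_add: "restr Q (p + q) = restr Q p + restr Q q"
  by (rule poly_mapping_eqI) (simp add: lookup_restr lookup_add)

lemma keys_minus: "keys (- p) = keys p" for p :: "'a \<Rightarrow>\<^sub>0 'b::ab_group_add"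
  by (auto simp: in_keys_iff)

lemma polys_mult: "p \<in> polys n \<Longrightarrow> q \<in> polys n \<Longrightarrow> p * q \<in> polys n"
  using keys_mult[of p q] by (fastforce simp: polys_def keys_add_nat)

text \<open>The polynomials in x_1, ..., x_n are a subset of a type that is a ring by itself, so
  arithmetic with them is plain type-class arithmetic. The ring record is reached through
  \<open>RR\<close>.\<close>

interpretation pr: subring_set "polys n :: 'k::field mpoly set" for n
proof
  fix a b :: "'k mpoly"
  show "a \<in> polys n \<Longrightarrow> b \<in> polys n \<Longrightarrow> a + b \<in> polys n"
    using keys_add[of a b] by (auto simp: polys_def)
qed (auto simp: polys_mult, auto simp: polys_def keys_minus)

lemma poly_ring_vars_eq: "poly_ring_vars n = pr.RR n"
  by (simp only: poly_ring_vars_def pr.RR_def) (simp add: polys_def)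

lemma lookup_single_mult:
  "lookup (single m c * p) (m + k) = c * lookup p k" for p :: "'k::field mpoly"
  by (simp add: lookup_mult lookup_single when_mult mult_when Sum_any_right_distrib)

lemma keys_single_mult:
  "c \<noteq> 0 \<Longrightarrow> keys (single m c * p) = (+) m ` keys p"
  for p :: "'k::field mpoly"
  using keys_mult[of "single m c" p]
  by (auto simp: in_keys_iff lookup_single_mult)

lemma poly_sum_monoms: "p = (\<Sum>m\<in>keys p. single m (lookup p m))"
  for p :: "'a \<Rightarrow>\<^sub>0 'b::comm_monoid_add"
  by (rule poly_mapping_eqI)
    (auto simp: lookup_sum lookup_single when_def in_keys_iff sum.delta intro: sum.neutral)

lemma single_in_polys: "keys m \<subseteq> {1..n} \<Longrightarrow> single m c \<in> polys n"
  by (auto simp: polys_def)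

lemma restr_in_polys: "p \<in> polys n \<Longrightarrow> restr Q p \<in> polys n"
  by (auto simp: polys_def keys_restr)

text \<open>The Stanley--Reisner ideal of \<open>D\<close>, if \<open>D\<close> is a simplicial complex.\<close>

definition sr_ideal :: "nat \<Rightarrow> nat set set \<Rightarrow> 'k::field mpoly set" where
  "sr_ideal n D = {p \<in> polys n. \<forall>m\<in>keys p. keys m \<notin> D}"

definition down_closed :: "'a set set \<Rightarrow> bool" where
  "down_closed D \<longleftrightarrow> (\<forall>G\<in>D. Pow G \<subseteq> D)"

lemma down_closedD: "down_closed D \<Longrightarrow> G \<in> D \<Longrightarrow> H \<subseteq> G \<Longrightarrow> H \<in> D"
  by (auto simp: down_closed_def)

lemma down_closed_Pow [simp]: "down_closed (Pow F)"
  by (auto simp: down_closed_def)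

lemma sr_ideal_idl: "down_closed D \<Longrightarrow> pr.idl n (sr_ideal n D :: 'k::field mpoly set)"
  unfolding pr.idl_def
proof (intro conjI ballI)
  fix p q :: "'k mpoly" assume D: "down_closed D"
  show "p \<in> sr_ideal n D \<Longrightarrow> q \<in> sr_ideal n D \<Longrightarrow> p + q \<in> sr_ideal n D"
    using keys_add[of p q] by (auto simp: sr_ideal_def)
  assume p: "p \<in> polys n" and q: "q \<in> sr_ideal n D"
  have "keys m \<notin> D" if "m \<in> keys (p * q)" for m
  proof -
    obtain a b where "m = a + b" "b \<in> keys q"
      using \<open>m \<in> keys (p * q)\<close> keys_mult[of p q] by blast
    then show ?thesis using q down_closedD[OF D, of "keys m" "keys b"]
      by (auto simp: sr_ideal_def keys_add_nat)
  qed
  then show "p * q \<in> sr_ideal n D" using p q by (auto simp: sr_ideal_def)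
qed (auto simp: sr_ideal_def)

lemma sr_ideal_mono: "D \<subseteq> E \<Longrightarrow> sr_ideal n E \<subseteq> sr_ideal n D"
  by (auto simp: sr_ideal_def)

lemma sr_ideal_empty [simp]: "sr_ideal n {} = polys n"
  by (auto simp: sr_ideal_def)

lemma single_in_sr_ideal:
  "keys m \<subseteq> {1..n} \<Longrightarrow> keys m \<notin> D \<Longrightarrow> single m c \<in> sr_ideal n D"
  by (auto simp: sr_ideal_def single_in_polys)

lemma idl_monomsI:
  assumes "pr.idl n I" "\<And>m. m \<in> keys p \<Longrightarrow> single m (lookup p m) \<in> I"
  shows "p \<in> I"
  using pr.sum_idl[of n I "keys p" "\<lambda>m. single m (lookup p m)"] assms
    poly_sum_monoms[of p] by simp

lemma restr_diff: "p - restr Q p = restr (\<lambda>m. \<not> Q m) p"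
  by (rule poly_mapping_eqI) (simp add: lookup_restr lookup_minus)

lemma diff_restr_sr_ideal:
  "p \<in> polys n \<Longrightarrow> p - restr (\<lambda>m. keys m \<subseteq> F) p \<in> sr_ideal n (Pow F)"
  by (auto simp: restr_diff sr_ideal_def restr_in_polys keys_restr)

lemma sr_ideal_Pow_iff:
  "p \<in> sr_ideal n (Pow F) \<longleftrightarrow> p \<in> polys n \<and> restr (\<lambda>m. keys m \<subseteq> F) p = 0"
proof -
  have "restr (\<lambda>m. keys m \<subseteq> F) p = 0 \<longleftrightarrow>
    keys (restr (\<lambda>m. keys m \<subseteq> F) p) = {}" by simp
  then show ?thesis unfolding keys_restr by (auto simp: sr_ideal_def)
qed

text \<open>Modulo the ideal each polynomial is congruent to its part in K[F]. The product of two
  such parts lies again in K[F], which meets the ideal only in 0, and polynomials over a field have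
  no zero divisors.\<close>

lemma sr_ideal_Pow_prim: "pr.prim n (sr_ideal n (Pow F) :: 'k::field mpoly set)"
  unfolding pr.prim_def
proof (intro conjI ballI impI)
  let ?P = "sr_ideal n (Pow F) :: 'k mpoly set" and ?r = "restr (\<lambda>m. keys m \<subseteq> F)"
  show idl: "pr.idl n ?P" by (simp add: sr_ideal_idl)
  have "1 \<notin> ?P" by (simp add: sr_ideal_def)
  then show "?P \<noteq> polys n" by auto
  fix p q :: "'k mpoly" assume pq: "p \<in> polys n" "q \<in> polys n" "p * q \<in> ?P"
  note d = pr.idlD[OF idl]
  have "p * q - ?r p * ?r q = (p - ?r p) * q + ?r p * (q - ?r q)" by (simp add: algebra_simps)
  moreover have "(p - ?r p) * q \<in> ?P" by (rule d(5)[OF pq(2) diff_restr_sr_ideal[OF pq(1)]])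
  moreover have "?r p * (q - ?r q) \<in> ?P"
    by (rule d(4)[OF restr_in_polys[OF pq(1)] diff_restr_sr_ideal[OF pq(2)]])
  ultimately have "p * q - ?r p * ?r q \<in> ?P" using d(3) by simp
  then have "p * q - (p * q - ?r p * ?r q) \<in> ?P" using pq(3) d(7) by blast
  then have "?r p * ?r q \<in> ?P" by simp
  moreover have "keys m \<subseteq> F" if "m \<in> keys (?r p * ?r q)" for m
    using that keys_mult[of "?r p" "?r q"] by (fastforce simp: keys_add_nat keys_restr)
  ultimately have "keys (?r p * ?r q) = {}"
    unfolding sr_ideal_def by blast
  then have "?r p = 0 \<or> ?r q = 0" by simp
  then show "p \<in> ?P \<or> q \<in> ?P" using pq by (auto simp: sr_ideal_Pow_iff)
qed

section \<open>Squarefree monomials acting on Stanley--Reisner ideals\<close>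

definition sqf_monom :: "nat set \<Rightarrow> nat \<Rightarrow>\<^sub>0 nat" where
  "sqf_monom V = (\<Sum>i\<in>V. single i 1)"

definition sqf :: "nat set \<Rightarrow> 'k::field mpoly" where
  "sqf V = monom_poly (sqf_monom V)"

lemma lookup_sqf_monom: "finite V \<Longrightarrow> lookup (sqf_monom V) i = (if i \<in> V then 1 else 0)"
  by (simp add: sqf_monom_def lookup_sum lookup_single when_def)

lemma keys_sqf_monom [simp]: "finite V \<Longrightarrow> keys (sqf_monom V) = V"
  by (simp add: set_eq_iff in_keys_iff lookup_sqf_monom)

lemma keys_sqf_mult: "keys (sqf V * p) = (+) (sqf_monom V) ` keys p"
  by (simp add: sqf_def monom_poly_def keys_single_mult)

lemma sqf_in_polys: "V \<subseteq> {1..n} \<Longrightarrow> sqf V \<in> polys n"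
  using finite_subset[of V "{1..n}"] by (auto simp: sqf_def monom_poly_def intro!: single_in_polys)

lemma sqf_monom_add_diff:
  assumes "finite V" "V \<subseteq> keys m"
  shows "sqf_monom V + (m - sqf_monom V) = m"
  using assms
  by (intro poly_mapping_eqI)
    (auto simp: lookup_add lookup_minus lookup_sqf_monom in_keys_iff Suc_le_eq)

lemma sqf_monom_dvd_iff:
  assumes "finite V"
  shows "(\<exists>k. m = sqf_monom V + k) \<longleftrightarrow> V \<subseteq> keys m"
  using sqf_monom_add_diff[OF assms] assms by (metis Un_upper1 keys_add_nat keys_sqf_monom)

lemma sqf_dvd_single:
  assumes "finite V" "V \<subseteq> keys m"
  shows "single m c = sqf V * single (m - sqf_monom V) c"
  using sqf_monom_add_diff[OF assms] by (simp add: sqf_def monom_poly_def mult_single)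

text \<open>On monomials, multiplication by \<open>sqf R\<close> adds \<open>R\<close> to the
  support. The sets \<open>G\<close> with \<open>G \<union> R \<in> D\<close> form the star of
  \<open>R\<close>.\<close>

lemma sr_ideal_colon:
  assumes "R \<subseteq> {1..n}"
  shows "{z \<in> polys n. sqf R * z \<in> sr_ideal n D} = sr_ideal n {G. G \<union> R \<in> D}"
proof -
  have "finite R" using assms by (rule finite_subset) simp
  then show ?thesis
    using sqf_in_polys[OF assms] by (auto simp: sr_ideal_def keys_sqf_mult keys_add_nat Un_commute)
qed

text \<open>The monomials in the ideal of \<open>D\<close> but not in that of \<open>E\<close> have
  their support in \<open>E - D\<close>. Such supports contain \<open>R\<close>, so these monomials
  are multiples of \<open>sqf R\<close>.\<close>

lemma sr_ideal_adj_sqf: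
  assumes D: "down_closed D" "down_closed E" "D \<subseteq> E" "R \<notin> D" "R \<subseteq> {1..n}"
    and E: "\<And>G. G \<in> E \<Longrightarrow> G \<notin> D \<Longrightarrow> R \<subseteq> G"
  shows "pr.adj n (sr_ideal n E) (sqf R) = (sr_ideal n D :: 'k::field mpoly set)"
proof
  have fin: "finite R" using D(5) by (rule finite_subset) simp
  show "pr.adj n (sr_ideal n E) (sqf R) \<subseteq> (sr_ideal n D :: 'k mpoly set)"
  proof (rule pr.adj_least)
    show "sqf R \<in> (sr_ideal n D :: 'k mpoly set)"
      using D fin by (auto simp: sqf_def monom_poly_def intro!: single_in_sr_ideal)
  qed (use D in \<open>auto simp: sr_ideal_idl intro!: sr_ideal_mono\<close>)
  show "(sr_ideal n D :: 'k mpoly set) \<subseteq> pr.adj n (sr_ideal n E) (sqf R)"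
  proof
    fix p :: "'k mpoly" assume p: "p \<in> sr_ideal n D"
    have idl: "pr.idl n (sr_ideal n E :: 'k mpoly set)" using D by (simp add: sr_ideal_idl)
    show "p \<in> pr.adj n (sr_ideal n E) (sqf R)"
    proof (rule idl_monomsI)
      show "pr.idl n (pr.adj n (sr_ideal n E) (sqf R) :: 'k mpoly set)"
        using idl D by (intro pr.idl_adj sqf_in_polys) auto
      fix m assume "m \<in> keys p"
      then have m: "keys m \<notin> D" "keys m \<subseteq> {1..n}"
        using p by (auto simp: sr_ideal_def polys_def)
      show "single m (lookup p m) \<in> pr.adj n (sr_ideal n E) (sqf R)"
      proof (cases "keys m \<in> E")
        case True
        then have "R \<subseteq> keys m" using E m by auto
        moreover have "keys (m - sqf_monom R) \<subseteq> {1..n}"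
          using m by (auto simp: in_keys_iff lookup_minus)
        ultimately show ?thesis
          using sqf_dvd_single[OF fin] idl by (metis pr.adj_gen single_in_polys)
      next
        case False
        then show ?thesis using m by (intro pr.adj_superset single_in_sr_ideal)
      qed
    qed
  qed
qed

lemma monomial_ideal_eq:
  assumes G: "\<And>g. g \<in> G \<Longrightarrow> keys g \<subseteq> {1..n}"
  shows "(monomial_ideal n G :: 'k::field mpoly set) =
    {p \<in> polys n. \<forall>m\<in>keys p. \<exists>g\<in>G. \<exists>k. m = g + k}" (is "_ = ?I")
proof -
  have idl: "pr.idl n ?I"
    unfolding pr.idl_def
  proof (intro conjI ballI)
    fix p q :: "'k mpoly"
    show "p \<in> ?I \<Longrightarrow> q \<in> ?I \<Longrightarrow> p + q \<in> ?I"
      using keys_add[of p q] by auto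
    assume p: "p \<in> polys n" and q: "q \<in> ?I"
    have "\<exists>g\<in>G. \<exists>k. m = g + k" if "m \<in> keys (p * q)" for m
    proof -
      obtain a b where ab: "m = a + b" "b \<in> keys q"
        using \<open>m \<in> keys (p * q)\<close> keys_mult[of p q] by blast
      then obtain g k where "g \<in> G" "b = g + k" using q by auto
      then have "m = g + (a + k)" using ab by (simp add: algebra_simps)
      then show ?thesis using \<open>g \<in> G\<close> by blast
    qed
    then show "p * q \<in> ?I" using p q by auto
  qed auto
  have "ideal ?I (poly_ring_vars n)" using idl by (simp add: poly_ring_vars_eq pr.ideal_RR_iff)
  moreover have "monom_poly ` G \<subseteq> ?I"
    using G by (fastforce simp: monom_poly_def single_in_polys intro: exI[of _ 0])
  ultimately have "monomial_ideal n G \<subseteq> ?I"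
    unfolding monomial_ideal_def genideal_def by blast
  moreover have "?I \<subseteq> I" if I: "ideal I (poly_ring_vars n)" "monom_poly ` G \<subseteq> I" for I :: "'k mpoly set"
  proof
    fix p assume p: "p \<in> ?I"
    have idl: "pr.idl n I" using I by (simp add: poly_ring_vars_eq pr.ideal_RR_iff)
    then show "p \<in> I"
    proof (rule idl_monomsI)
      fix m assume m: "m \<in> keys p"
      then obtain g k where gk: "g \<in> G" "m = g + k" using p by blast
      have "keys m \<subseteq> {1..n}" using p m by (auto simp: polys_def)
      then have "keys k \<subseteq> {1..n}" using gk by (simp add: keys_add_nat)
      moreover have "single m (lookup p m) = single k (lookup p m) * monom_poly g"
        using gk by (simp add: monom_poly_def mult_single add.commute)
      ultimately show "single m (lookup p m) \<in> I"
        using pr.idlD(4)[OF idl] I(2) gk single_in_polys by (metis image_subset_iff)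
    qed
  qed
  ultimately show ?thesis unfolding monomial_ideal_def genideal_def by blast
qed

section \<open>The complex of a lexsegment ideal\<close>

text \<open>Stated for all pairs, so that a list can be split at its head; by transitivity it is the
  condition on neighbouring entries.\<close>

definition tspread :: "nat \<Rightarrow> nat list \<Rightarrow> bool" where
  "tspread t = sorted_wrt (\<lambda>a b. a + t \<le> b)"

text \<open>A smaller list is a larger monomial in the squarefree order, so for equal lengths
  \<open>lexle is js\<close> is membership in the initial segment of \<open>js\<close>. The value
  \<open>True\<close> for an exhausted list makes the order reflexive.\<close>

fun lexle :: "nat list \<Rightarrow> nat list \<Rightarrow> bool" where
  "lexle (a # as) (b # bs) \<longleftrightarrow> a < b \<or> a = b \<and> lexle as bs"
| "lexle _ _ \<longleftrightarrow> True"

text \<open>\<open>lex_complex t m n js\<close> is the simplicial complex on \<open>{m..n}\<close> whose Stanley--Reisner ideal is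
  the initial \<open>t\<close>-spread lexsegment ideal of \<open>js\<close>.\<close>

definition lex_nonface :: "nat \<Rightarrow> nat list \<Rightarrow> nat set \<Rightarrow> bool" where
  "lex_nonface t js G \<longleftrightarrow>
    (\<exists>is. tspread t is \<and> length is = length js \<and> set is \<subseteq> G \<and> lexle is js)"

definition lex_complex :: "nat \<Rightarrow> nat \<Rightarrow> nat \<Rightarrow> nat list \<Rightarrow> nat set set" where
  "lex_complex t m n js = {G. G \<subseteq> {m..n} \<and> \<not> lex_nonface t js G}"

text \<open>If \<open>D\<close> and its union \<open>E\<close> with the interval \<open>[R, F]\<close> are complexes, the kernel of
  \<open>K[E] \<rightarrow> K[D]\<close> is generated by the monomial with support \<open>R\<close>, and isomorphic to \<open>K[F]\<close>. So an
  interval filtration is a filtration by polynomial rings in at least \<open>e\<close> variables.\<close>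

inductive interval_filt :: "nat \<Rightarrow> nat \<Rightarrow> nat \<Rightarrow> nat set set \<Rightarrow> bool" for m n e where
  empty: "interval_filt m n e {}"
| step: "interval_filt m n e D \<Longrightarrow> R \<subseteq> F \<Longrightarrow> F \<subseteq> {m..n} \<Longrightarrow> e \<le> card F \<Longrightarrow> R \<notin> D \<Longrightarrow>
    (\<And>G. G \<subseteq> F \<Longrightarrow> \<not> R \<subseteq> G \<Longrightarrow> G \<in> D) \<Longrightarrow> interval_filt m n e (D \<union> {G. R \<subseteq> G \<and> G \<subseteq> F})"

lemma interval_filt_down_closed: "interval_filt m n e D \<Longrightarrow> down_closed D"
proof (induction rule: interval_filt.induct)
  case (step D R F)
  show ?case unfolding down_closed_def
  proof (intro ballI subsetI)
    fix G H assume GH: "G \<in> D \<union> {G. R \<subseteq> G \<and> G \<subseteq> F}" "H \<in> Pow G"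
    show "H \<in> D \<union> {G. R \<subseteq> G \<and> G \<subseteq> F}"
    proof (cases "G \<in> D")
      case True
      then show ?thesis using down_closedD[OF step.IH, of G H] GH by auto
    next
      case False
      then have "H \<subseteq> F" using GH by auto
      then show ?thesis using step.hyps(6)[of H] by auto
    qed
  qed
qed (simp add: down_closed_def)

lemma interval_filt_mono: "interval_filt m n e D \<Longrightarrow> m' \<le> m \<Longrightarrow> interval_filt m' n e D"
proof (induction rule: interval_filt.induct)
  case (step D R F)
  moreover have "F \<subseteq> {m'..n}" using step.hyps(3) step.prems by fastforce
  ultimately show ?case by (intro interval_filt.step) auto
qed (rule interval_filt.empty)

text \<open>The faces to be added contain \<open>i\<close>, are arbitrary on
  \<open>i + 1, ..., i + t - 1\<close>, and restrict to \<open>D'\<close> from \<open>i + t\<close>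
  on. So an interval of \<open>D'\<close> from \<open>R\<close> to \<open>F\<close> becomes one from
  \<open>R\<close> with \<open>i\<close> added to \<open>F\<close> with all of
  \<open>i, ..., i + t - 1\<close> added. The upper ends gain \<open>t\<close> elements.\<close>

lemma interval_filt_lift:
  assumes "interval_filt (i + t) n e D'" "t \<ge> 1" "i + t \<le> Suc n"
    and "interval_filt i n (e + t) D" "\<And>G. G \<in> D \<Longrightarrow> i \<notin> G"
    and "\<And>G. G \<subseteq> {Suc i..n} \<Longrightarrow> G \<inter> {i + t..n} \<in> D' \<Longrightarrow> G \<in> D"
  shows "interval_filt i n (e + t) (D \<union> {G. i \<in> G \<and> G \<subseteq> {i..n} \<and> G \<inter> {i + t..n} \<in> D'})"
  using assms
proof (induction rule: interval_filt.induct)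
  case (step D' R F)
  define E where "E = D \<union> {G. i \<in> G \<and> G \<subseteq> {i..n} \<and> G \<inter> {i + t..n} \<in> D'}"
  define R1 where "R1 = insert i R"
  define F1 where "F1 = {i..<i + t} \<union> F"
  have E: "interval_filt i n (e + t) E" unfolding E_def using step by auto
  have fin: "finite F" using step.hyps(3) by (rule finite_subset) simp
  have RF: "R \<subseteq> {i + t..n}" using step.hyps by auto
  have "interval_filt i n (e + t) (E \<union> {G. R1 \<subseteq> G \<and> G \<subseteq> F1})"
  proof (rule interval_filt.step[OF E])
    show "R1 \<subseteq> F1" using step.hyps(2) step.prems(1) by (auto simp: R1_def F1_def)
    show "F1 \<subseteq> {i..n}" using step.hyps(3) step.prems(2) by (auto simp: F1_def)
    have "card F1 = t + card F"
      unfolding F1_def using fin step.hyps(3) by (subst card_Un_disjoint) auto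
    then show "e + t \<le> card F1" using step.hyps by simp
    have "R1 \<inter> {i + t..n} = R" using RF step.prems(1) by (auto simp: R1_def)
    then show "R1 \<notin> E" using step.hyps(5) step.prems(4) by (auto simp: E_def R1_def)
    fix G assume G: "G \<subseteq> F1" "\<not> R1 \<subseteq> G"
    have GF: "G \<inter> {i + t..n} \<subseteq> F" using G by (auto simp: F1_def)
    have Gn: "G \<subseteq> {i..n}" using G(1) \<open>F1 \<subseteq> {i..n}\<close> by blast
    show "G \<in> E"
    proof (cases "i \<in> G")
      case True
      then have "\<not> R \<subseteq> G \<inter> {i + t..n}" using G by (auto simp: R1_def)
      then show ?thesis using step.hyps(6)[OF GF] True Gn by (auto simp: E_def)
    next
      case False
      \<comment> \<open>Without \<open>i\<close> the face is old: its restriction lies in the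
        complex filtered so far or in the new interval, and the last hypothesis puts such sets into
        \<open>D\<close>.\<close>
      have "G \<subseteq> {Suc i..n}"
      proof
        fix x assume x: "x \<in> G"
        then have "x \<noteq> i" "x \<in> {i..n}" using False Gn by auto
        then show "x \<in> {Suc i..n}" by auto
      qed
      moreover have "G \<inter> {i + t..n} \<in> D' \<union> {G. R \<subseteq> G \<and> G \<subseteq> F}"
        using step.hyps(6)[OF GF] GF by blast
      ultimately show ?thesis using step.prems(5) by (auto simp: E_def)
    qed
  qed
  also have "E \<union> {G. R1 \<subseteq> G \<and> G \<subseteq> F1} =
    D \<union> {G. i \<in> G \<and> G \<subseteq> {i..n} \<and> G \<inter> {i + t..n} \<in> D' \<union> {G. R \<subseteq> G \<and> G \<subseteq> F}}"
  proof -
    have "R1 \<subseteq> G \<and> G \<subseteq> F1 \<longleftrightarrow>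
      i \<in> G \<and> G \<subseteq> {i..n} \<and> R \<subseteq> G \<inter> {i + t..n} \<and> G \<inter> {i + t..n} \<subseteq> F" for G
    proof
      assume "R1 \<subseteq> G \<and> G \<subseteq> F1"
      then show "i \<in> G \<and> G \<subseteq> {i..n} \<and> R \<subseteq> G \<inter> {i + t..n} \<and> G \<inter> {i + t..n} \<subseteq> F"
        using RF step.hyps(3) step.prems(2) by (fastforce simp: R1_def F1_def)
    next
      assume *: "i \<in> G \<and> G \<subseteq> {i..n} \<and> R \<subseteq> G \<inter> {i + t..n} \<and> G \<inter> {i + t..n} \<subseteq> F"
      have "x \<in> F1" if "x \<in> G" for x
      proof (cases "x < i + t")
        case True then show ?thesis using * that by (auto simp: F1_def)
      next
        case False
        then have "x \<in> G \<inter> {i + t..n}" using * that by auto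
        then show ?thesis using * by (auto simp: F1_def)
      qed
      then show "R1 \<subseteq> G \<and> G \<subseteq> F1" using * by (auto simp: R1_def)
    qed
    then have "{G. R1 \<subseteq> G \<and> G \<subseteq> F1} =
      {G. i \<in> G \<and> G \<subseteq> {i..n} \<and> R \<subseteq> G \<inter> {i + t..n} \<and> G \<inter> {i + t..n} \<subseteq> F}" by simp
    then show ?thesis unfolding E_def by (simp only: Un_iff mem_Collect_eq Un_assoc) (auto simp only: Un_iff mem_Collect_eq)
  qed
  finally show ?case .
qed simp

section \<open>Spread lists and the recursion on the least vertex\<close>

lemma tspread_Cons: "tspread t (a # is) \<longleftrightarrow> (\<forall>b\<in>set is. a + t \<le> b) \<and> tspread t is"
  by (auto simp: tspread_def)

lemma tspread_last: "tspread t is \<Longrightarrow> is \<noteq> [] \<Longrightarrow> hd is + (length is - 1) * t \<le> last is"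
proof (induction "is")
  case (Cons a "is")
  show ?case
  proof (cases "is")
    case (Cons b bs)
    then show ?thesis using Cons.IH Cons.prems by (auto simp: tspread_Cons)
  qed simp
qed simp

lemma tspread_hd_le: "tspread t is \<Longrightarrow> b \<in> set is \<Longrightarrow> hd is \<le> b"
  by (cases "is") (auto simp: tspread_Cons)

lemma tspread_le_last: "tspread t is \<Longrightarrow> b \<in> set is \<Longrightarrow> b \<le> last is"
proof (induction "is")
  case (Cons a "is")
  show ?case
  proof (cases "is = []")
    case False
    then have "last is \<in> set is" by simp
    then have "a + t \<le> last is" using Cons.prems by (auto simp: tspread_Cons)
    then have "a \<le> last is" by simp
    then show ?thesis using Cons False by (auto simp: tspread_Cons)
  qed (use Cons.prems in simp)
qed simp

text \<open>The lexicographically last spread list with \<open>k + 1\<close> entries up to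
  \<open>n\<close>. As a bound for \<open>lexle\<close> it imposes no condition, so it turns the
  bare existence of a spread list into a lexsegment condition.\<close>

fun top_list :: "nat \<Rightarrow> nat \<Rightarrow> nat \<Rightarrow> nat list" where
  "top_list n t 0 = [n]"
| "top_list n t (Suc k) = (n - Suc k * t) # top_list n t k"

lemma length_top_list [simp]: "length (top_list n t k) = Suc k"
  by (induction k) auto

lemma hd_top_list: "hd (top_list n t k) = n - k * t"
  by (cases k) auto

lemma last_top_list: "last (top_list n t k) = n"
proof (induction k)
  case (Suc k)
  then show ?case by (cases k) auto
qed simp

lemma tspread_top_list: "k * t \<le> n \<Longrightarrow> tspread t (top_list n t k)"
proof (induction k)
  case (Suc k)
  then have t: "tspread t (top_list n t k)" by simp
  then have "n - k * t \<le> b" if "b \<in> set (top_list n t k)" for b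
    using tspread_hd_le[OF t that] by (simp add: hd_top_list)
  moreover have "n - Suc k * t + t \<le> n - k * t" using Suc.prems by simp
  ultimately show ?case using t by (auto simp: tspread_Cons intro: order_trans)
qed (simp add: tspread_def)

text \<open>An entry with \<open>r\<close> successors is at most \<open>n - r * t\<close>, because
  each successor costs \<open>t\<close>.\<close>

lemma lexle_top_list: "tspread t is \<Longrightarrow> length is = Suc k \<Longrightarrow> set is \<subseteq> {..n} \<Longrightarrow> lexle is (top_list n t k)"
proof (induction k arbitrary: "is")
  case 0
  then show ?case by (cases "is") auto
next
  case (Suc k)
  then obtain a is' where a: "is = a # is'" "length is' = Suc k" by (cases "is") auto
  have "last is \<in> set is" using a by auto
  then have "a + Suc k * t \<le> n"
    using tspread_last[OF Suc.prems(1)] a Suc.prems(3) by (auto intro: order_trans)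
  then have "a \<le> n - Suc k * t" by simp
  moreover have "lexle is' (top_list n t k)" using Suc.IH a Suc.prems by (simp add: tspread_Cons)
  ultimately show ?case using a by auto
qed

text \<open>A list in \<open>G\<close> starts at \<open>i\<close> or later, so its tail lies in
  \<open>{i + t..n}\<close> and its head may be replaced by \<open>i\<close>. If
  \<open>i = j\<close>, the tail must still be compared with \<open>js\<close>. If
  \<open>i < j\<close>, the comparison is already decided and any spread tail will do, which is the
  condition with \<open>top_list\<close>.\<close>

lemma lex_nonface_Cons:
  assumes "i \<le> j" "G \<subseteq> {i..n}" "i \<in> G" "length js = Suc k"
    and "js' = (if i = j then js else top_list n t k)"
  shows "lex_nonface t (j # js) G \<longleftrightarrow> lex_nonface t js' (G \<inter> {i + t..n})"
proof
  assume "lex_nonface t (j # js) G"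
  then obtain a "is" where a: "tspread t (a # is)" "length is = Suc k" "set (a # is) \<subseteq> G"
    "lexle (a # is) (j # js)"
    using assms(4) unfolding lex_nonface_def by (metis length_Suc_conv)
  have "i \<le> a" using a assms by auto
  then have s: "set is \<subseteq> G \<inter> {i + t..n}" using a assms(2) by (fastforce simp: tspread_Cons)
  have "lexle is js'"
  proof (cases "i = j")
    case True then show ?thesis using a assms \<open>i \<le> a\<close> by auto
  next
    case False
    then show ?thesis using a s assms by (auto simp: tspread_Cons intro!: lexle_top_list)
  qed
  then show "lex_nonface t js' (G \<inter> {i + t..n})"
    unfolding lex_nonface_def using a s assms by (intro exI[of _ "is"]) (auto simp: tspread_Cons)
next
  assume "lex_nonface t js' (G \<inter> {i + t..n})"
  then obtain "is" where a: "tspread t is" "length is = length js'" "set is \<subseteq> G \<inter> {i + t..n}"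
    "lexle is js'"
    unfolding lex_nonface_def by auto
  then show "lex_nonface t (j # js) G"
    unfolding lex_nonface_def using assms
    by (intro exI[of _ "i # is"]) (auto simp: tspread_Cons split: if_splits)
qed

lemma interval_filt_lex_complex:
  assumes "tspread t js" "length js = Suc k" "m \<le> hd js" "last js \<le> n" "t \<ge> 1"
  shows "interval_filt m n (k * t) (lex_complex t m n js)"
  using assms
proof (induction k arbitrary: js m)
  case 0
  then obtain j where j: "js = [j]" "m \<le> j" "j \<le> n" by (cases js) auto
  have "lex_nonface t [j] G \<longleftrightarrow> (\<exists>a\<in>G. a \<le> j)" for G
    unfolding lex_nonface_def
  proof
    assume "\<exists>a\<in>G. a \<le> j"
    then obtain a where "a \<in> G" "a \<le> j" by auto
    then show "\<exists>is. tspread t is \<and> length is = length [j] \<and> set is \<subseteq> G \<and> lexle is [j]"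
      by (intro exI[of _ "[a]"]) (auto simp: tspread_def)
  next
    assume "\<exists>is. tspread t is \<and> length is = length [j] \<and> set is \<subseteq> G \<and> lexle is [j]"
    then obtain a where "{a} \<subseteq> G" "lexle [a] [j]" by (auto simp: length_Suc_conv)
    then have "a \<in> G" "a \<le> j" by auto
    then show "\<exists>a\<in>G. a \<le> j" by blast
  qed
  then have "lex_complex t m n js = {} \<union> {G. {} \<subseteq> G \<and> G \<subseteq> {Suc j..n}}"
    using j by (fastforce simp: lex_complex_def subset_eq not_le Suc_le_eq)
  then show ?case
    using interval_filt.step[OF interval_filt.empty, of "{}" "{Suc j..n}" m n 0] j by auto
next
  case (Suc k)
  then obtain j js' where js: "js = j # js'" "length js' = Suc k" by (cases js) auto
  have ts: "tspread t js'" "\<And>b. b \<in> set js' \<Longrightarrow> j + t \<le> b" using Suc.prems js by (auto simp: tspread_Cons)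
  have jn: "j + Suc k * t \<le> n" using tspread_last[OF Suc.prems(1)] js Suc.prems(4) by auto
  \<comment> \<open>Descending induction on the least vertex, inside the induction on the length of
    the list. It starts at \<open>Suc j\<close>: a list in \<open>{Suc j..n}\<close> has its head
    above \<open>j\<close>, so every subset is a face, and the simplex is large enough because
    \<open>js\<close> itself spans \<open>Suc k * t\<close> places after \<open>j\<close>.\<close>
  have "interval_filt i n (Suc k * t) (lex_complex t i n js)" if "i \<le> Suc j" for i
    using that
  proof (induction rule: inc_induct)
    case base
    have "\<not> lex_nonface t js G" if "G \<subseteq> {Suc j..n}" for G
      using that js unfolding lex_nonface_def by (fastforce simp: length_Suc_conv)
    then have "lex_complex t (Suc j) n js = {} \<union> {G. {} \<subseteq> G \<and> G \<subseteq> {Suc j..n}}"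
      by (auto simp: lex_complex_def)
    moreover have "Suc k * t \<le> card {Suc j..n}" using jn by simp
    ultimately show ?case
      using interval_filt.step[OF interval_filt.empty, of "{}" "{Suc j..n}" "Suc j" n "Suc k * t"] by simp
  next
    case (step i)
    then have ij: "i \<le> j" by simp
    define js'' where "js'' = (if i = j then js' else top_list n t k)"
    define D' where "D' = lex_complex t (i + t) n js''"
    define D where "D = lex_complex t (Suc i) n js"
    note rec = lex_nonface_Cons[OF ij _ _ js(2) js''_def, folded js(1)]
    have "i + t \<le> hd js''"
    proof (cases "i = j")
      case True
      then show ?thesis using ts(2)[of "hd js'"] js(2) by (cases js') (auto simp: js''_def)
    next
      case False
      then show ?thesis using jn ij by (simp add: js''_def hd_top_list algebra_simps)
    qed
    moreover have "tspread t js''" "last js'' \<le> n" "length js'' = Suc k"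
      using ts js Suc.prems(4) jn tspread_top_list[of k t n]
      by (auto simp: js''_def last_top_list split: if_splits)
    ultimately have D': "interval_filt (i + t) n (k * t) D'"
      unfolding D'_def using Suc.prems(5) by (intro Suc.IH) auto
    have D: "interval_filt i n (Suc k * t) D"
      using step.IH unfolding D_def by (rule interval_filt_mono) simp
    have "interval_filt i n (k * t + t) (D \<union> {G. i \<in> G \<and> G \<subseteq> {i..n} \<and> G \<inter> {i + t..n} \<in> D'})"
    proof (rule interval_filt_lift[OF D' Suc.prems(5)])
      show "i + t \<le> Suc n" using jn ij by simp
      show "interval_filt i n (k * t + t) D" using D by (simp add: add.commute)
      show "i \<notin> G" if "G \<in> D" for G using that by (auto simp: D_def lex_complex_def)
      fix G assume G: "G \<subseteq> {Suc i..n}" "G \<inter> {i + t..n} \<in> D'"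
      \<comment> \<open>\<open>G\<close> avoids \<open>i\<close>, while the recursion speaks of sets
        that contain \<open>i\<close>. Adding \<open>i\<close> keeps a nonface a nonface and does
        not change the part from \<open>i + t\<close> on.\<close>
      have "lex_nonface t js'' (G \<inter> {i + t..n})" if "lex_nonface t js G"
      proof -
        have sub: "insert i G \<subseteq> {i..n}" using G ij jn by auto
        have "lex_nonface t js (insert i G)"
          using that unfolding lex_nonface_def by blast
        then have "lex_nonface t js'' (insert i G \<inter> {i + t..n})" using rec[OF sub] by simp
        moreover have "insert i G \<inter> {i + t..n} = G \<inter> {i + t..n}" using Suc.prems(5) by auto
        ultimately show ?thesis by simp
      qed
      then show "G \<in> D" using G by (auto simp: D_def D'_def lex_complex_def)
    qed
    also have "D \<union> {G. i \<in> G \<and> G \<subseteq> {i..n} \<and> G \<inter> {i + t..n} \<in> D'} = lex_complex t i n js"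
    proof -
      have "{Suc i..n} = {i..n} - {i}" by auto
      then have "G \<subseteq> {Suc i..n} \<longleftrightarrow> i \<notin> G \<and> G \<subseteq> {i..n}" for G by blast
      moreover have "G \<inter> {i + t..n} \<in> D' \<longleftrightarrow> \<not> lex_nonface t js G" if "i \<in> G" "G \<subseteq> {i..n}" for G
        using rec[OF that(2,1)] by (auto simp: D'_def lex_complex_def)
      ultimately show ?thesis unfolding D_def lex_complex_def by blast
    qed
    finally show ?case by (simp add: add.commute)
  qed
  then show ?case using Suc.prems js by simp
qed

section \<open>Facets and dimension of the complex\<close>

lemma down_closed_lex_complex: "down_closed (lex_complex t m n js)"
  unfolding down_closed_def lex_complex_def lex_nonface_def by blast

text \<open>A spread list with \<open>k + 1\<close> entries spans more than \<open>k * t\<close>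
  consecutive numbers.\<close>

lemma initial_face:
  assumes "length js = Suc k"
  shows "\<not> lex_nonface t js {1..k * t}"
proof
  assume "lex_nonface t js {1..k * t}"
  then obtain "is" where i: "tspread t is" "length is = Suc k" "set is \<subseteq> {1..k * t}"
    using assms by (auto simp: lex_nonface_def)
  then have "hd is \<in> set is" "last is \<in> set is" by (metis hd_in_set last_in_set length_0_conv nat.distinct(1))+
  then have "1 \<le> hd is" "last is \<le> k * t" using i by auto
  moreover have "is \<noteq> []" using i(2) by auto
  then have "hd is + k * t \<le> last is" using tspread_last[OF i(1)] i(2) by simp
  ultimately show False by simp
qed

text \<open>The list 1, 1 + t, ..., 1 + (k - 1) t, i is contained in \<open>G\<close>, and it
  precedes \<open>js\<close> because \<open>js\<close> starts with at least 2. The condition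
  \<open>k \<ge> 1\<close> ensures that its first entry is 1 and not \<open>i\<close>.\<close>

lemma initial_face_maximal:
  assumes "length js = Suc k" "k \<ge> 1" "hd js \<ge> 2" "k * t < i" "{1..k * t} \<subseteq> G" "i \<in> G" "t \<ge> 1"
  shows "lex_nonface t js G"
proof -
  define xs where "xs = map (\<lambda>r. 1 + r * t) [0..<k]"
  have xs: "sorted_wrt (\<lambda>a b. a + t \<le> b) xs"
    unfolding xs_def sorted_wrt_map
    by (rule sorted_wrt_mono_rel[OF _ sorted_wrt_upt])
      (metis (no_types, lifting) Suc_leI add.assoc add.commute add_left_mono mult_Suc mult_le_mono1)
  have le: "1 + r * t + t \<le> 1 + k * t" if "r < k" for r
    using that by (metis Suc_leI add.assoc add.commute add_left_mono mult_Suc mult_le_mono1)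
  have "tspread t (xs @ [i])"
    unfolding tspread_def sorted_wrt_append using xs le assms(4) by (force simp: xs_def)
  moreover have "length (xs @ [i]) = length js" using assms(1) by (simp add: xs_def)
  moreover have "set (xs @ [i]) \<subseteq> G"
  proof -
    have "1 + r * t \<in> {1..k * t}" if "r < k" for r using le[OF that] assms(7) by auto
    then show ?thesis using assms(5,6) by (auto simp: xs_def)
  qed
  moreover have "lexle (xs @ [i]) js"
  proof -
    obtain ys where "xs = 1 # ys" using assms(2) by (cases k) (auto simp: xs_def upt_conv_Cons simp del: upt_Suc)
    moreover obtain j js' where "js = j # js'" "j \<ge> 2" using assms(1,3) by (cases js) auto
    ultimately show ?thesis by simp
  qed
  ultimately show ?thesis unfolding lex_nonface_def by blast
qed

text \<open>Greedy choice: taking the minimum of \<open>G\<close> excludes at most \<open>t\<close>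
  elements of \<open>G\<close>, itself included, from the rest of the list.\<close>

lemma tspread_subset_exists:
  assumes "finite G" "card G > k * t"
  shows "\<exists>is. tspread t (Min G # is) \<and> length is = k \<and> set is \<subseteq> G"
  using assms
proof (induction k arbitrary: G)
  case 0
  then show ?case by (auto simp: tspread_def)
next
  case (Suc k)
  define G' where "G' = G \<inter> {Min G + t..}"
  have ne: "G \<noteq> {}" using Suc.prems by auto
  have "G \<subseteq> G' \<union> {Min G..<Min G + t}" using Suc.prems(1) by (auto simp: G'_def not_le)
  then have "card G \<le> card (G' \<union> {Min G..<Min G + t})"
    using Suc.prems(1) by (intro card_mono) (auto simp: G'_def)
  also have "\<dots> \<le> card G' + t" by (rule order_trans[OF card_Un_le]) simp
  finally have c: "card G' > k * t" using Suc.prems by simp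
  have fin: "finite G'" using Suc.prems by (simp add: G'_def)
  then obtain "is" where i: "tspread t (Min G' # is)" "length is = k" "set is \<subseteq> G'"
    using Suc.IH c by blast
  have "G' \<noteq> {}" using c by auto
  then have "Min G' \<in> G'" using fin by simp
  then have "tspread t (Min G # Min G' # is)" "set (Min G' # is) \<subseteq> G"
    using i by (auto simp: tspread_Cons[of t "Min G"] G'_def)
  then show ?case using i by (intro exI[of _ "Min G' # is"]) simp
qed

text \<open>A face with more than \<open>n - hd js\<close> elements is large enough for a spread
  list of full length that starts with its minimum. Hence the minimum is not below
  \<open>hd js\<close>, which leaves only \<open>{hd js..n}\<close>, and this set contains
  \<open>js\<close>.\<close>

lemma card_face_le:
  assumes "tspread t js" "length js = Suc k" "last js \<le> n" "G \<in> lex_complex t 1 n js"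
  shows "card G \<le> n - hd js"
proof (rule ccontr)
  assume c: "\<not> card G \<le> n - hd js"
  have G: "G \<subseteq> {1..n}" "\<not> lex_nonface t js G" using assms(4) by (auto simp: lex_complex_def)
  then have fin: "finite G" by (meson finite_atLeastAtMost finite_subset)
  obtain j js' where js: "js = j # js'" using assms(2) by (cases js) auto
  have jn: "j + k * t \<le> n" using tspread_last[OF assms(1)] assms js by auto
  then have "card G > k * t" using c js by simp
  then obtain "is" where i: "tspread t (Min G # is)" "length is = k" "set is \<subseteq> G"
    using tspread_subset_exists[OF fin] by blast
  have ne: "G \<noteq> {}" using c by auto
  have "\<not> Min G < j"
  proof
    assume "Min G < j"
    then have "lex_nonface t js G"
      unfolding lex_nonface_def using i js assms(2) fin ne by (intro exI[of _ "Min G # is"]) auto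
    then show False using G by simp
  qed
  have sub: "G \<subseteq> {j..n}"
  proof
    fix x assume "x \<in> G"
    then have "Min G \<le> x" "x \<le> n" using fin G by auto
    then show "x \<in> {j..n}" using \<open>\<not> Min G < j\<close> by simp
  qed
  have "G = {j..n}"
    using c js jn sub by (intro card_subset_eq) (auto intro!: antisym card_mono[of "{j..n}" G, simplified])
  moreover have "set js \<subseteq> {j..n}"
  proof
    fix b assume b: "b \<in> set js"
    then have "j \<le> b" using tspread_hd_le[OF assms(1)] js by auto
    moreover have "b \<le> last js" by (rule tspread_le_last[OF assms(1) b])
    ultimately show "b \<in> {j..n}" using assms(3) by auto
  qed
  moreover have "lexle js js" by (induction js) auto
  ultimately have "lex_nonface t js G" unfolding lex_nonface_def using assms(1) by blast
  then show False using G by simp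
qed

lemma tail_face:
  assumes "js \<noteq> []" shows "{Suc (hd js)..n} \<in> lex_complex t 1 n js"
proof -
  have "\<not> lex_nonface t js {Suc (hd js)..n}"
    unfolding lex_nonface_def using assms by (cases js) (force simp: length_Suc_conv)+
  then show ?thesis by (auto simp: lex_complex_def)
qed

lemma sr_ideal_interval:
  assumes "interval_filt 1 n e D" "R \<subseteq> F" "F \<subseteq> {1..n}" "e \<le> card F" "R \<notin> D"
    "\<forall>G. G \<subseteq> F \<longrightarrow> \<not> R \<subseteq> G \<longrightarrow> G \<in> D"
  defines "E \<equiv> D \<union> {G. R \<subseteq> G \<and> G \<subseteq> F}"
  shows "pr.idl n (sr_ideal n E :: 'k::field mpoly set)"
    and "pr.adj n (sr_ideal n E) (sqf R) = (sr_ideal n D :: 'k mpoly set)"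
    and "{z \<in> polys n. sqf R * z \<in> sr_ideal n E} = (sr_ideal n (Pow F) :: 'k mpoly set)"
proof -
  have D: "down_closed D" using assms(1) by (rule interval_filt_down_closed)
  have E: "down_closed E"
    unfolding E_def
    using interval_filt.step[OF assms(1-5)] assms(6) by (blast intro: interval_filt_down_closed)
  have R: "R \<subseteq> {1..n}" using assms by auto
  show "pr.idl n (sr_ideal n E :: 'k mpoly set)" using E by (rule sr_ideal_idl)
  show "pr.adj n (sr_ideal n E) (sqf R) = (sr_ideal n D :: 'k mpoly set)"
    using D E assms(5) R by (intro sr_ideal_adj_sqf) (auto simp: E_def)
  have "{G. G \<union> R \<in> E} = Pow F"
    unfolding E_def using assms(2,5) by (auto dest: down_closedD[OF D, of _ R])
  then show "{z \<in> polys n. sqf R * z \<in> sr_ideal n E} = (sr_ideal n (Pow F) :: 'k mpoly set)"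
    unfolding sr_ideal_colon[OF R] by (rule arg_cong)
qed

section \<open>Index lists and the generators of the lexsegment ideal\<close>

lemma index_monom_distinct: "distinct is \<Longrightarrow> index_monom is = sqf_monom (set is)"
  by (simp add: index_monom_def sqf_monom_def sum_list_distinct_conv_sum_set)

lemma tspread_strict: "tspread t is \<Longrightarrow> t \<ge> 1 \<Longrightarrow> sorted_wrt (<) is"
  by (induction "is") (auto simp: tspread_Cons)

lemma strict_sorted_distinct: "sorted_wrt (<) is \<Longrightarrow> distinct is" for "is" :: "nat list"
  by (simp add: strict_sorted_iff)

lemma index_monom_inj:
  assumes "sorted_wrt (<) is" "sorted_wrt (<) js" "index_monom is = index_monom js"
  shows "is = js"
proof -
  have "sqf_monom (set is) = sqf_monom (set js)"
    using assms by (simp add: index_monom_distinct strict_sorted_distinct)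
  then have "set is = set js" using keys_sqf_monom by (metis List.finite_set)
  then show ?thesis using assms strict_sorted_equal by blast
qed

lemma tspread_iff_nth:
  "tspread t is \<longleftrightarrow> (\<forall>r. Suc r < length is \<longrightarrow> is ! r + t \<le> is ! Suc r)"
proof -
  have "transp (\<lambda>a b. a + t \<le> (b::nat))" by (auto simp: transp_def)
  then show ?thesis unfolding tspread_def by (simp add: sorted_wrt_iff_nth_Suc_transp)
qed

lemma spread_monoms_eq:
  "spread_monoms n d t = {index_monom is | is. tspread t is \<and> length is = d \<and> set is \<subseteq> {1..n}}"
proof -
  have "sorted is" if "tspread t is" for "is"
    using that unfolding tspread_def by (rule sorted_wrt_mono_rel[rotated]) auto
  then show ?thesis unfolding spread_monoms_def tspread_iff_nth[symmetric]
    by (auto simp: tspread_iff_nth)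
qed

lemma lexle_iff_nth:
  "length is = length js \<Longrightarrow> lexle is js \<longleftrightarrow>
    is = js \<or> (\<exists>s<length is. (\<forall>r<s. is ! r = js ! r) \<and> is ! s < js ! s)"
proof (induction "is" js rule: list_induct2)
  case (Cons a "is" b js)
  have "(\<exists>s<length (a # is). (\<forall>r<s. (a # is) ! r = (b # js) ! r) \<and> (a # is) ! s < (b # js) ! s) \<longleftrightarrow>
    a < b \<or> a = b \<and> (\<exists>s<length is. (\<forall>r<s. is ! r = js ! r) \<and> is ! s < js ! s)" (is "?L \<longleftrightarrow> ?R")
  proof
    assume ?L
    then obtain s where s: "s < length (a # is)" "\<And>r. r < s \<Longrightarrow> (a # is) ! r = (b # js) ! r"
      "(a # is) ! s < (b # js) ! s" by blast
    show ?R
    proof (cases s)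
      case 0 then show ?thesis using s by simp
    next
      case (Suc s')
      then have "a = b" "\<And>r. r < s' \<Longrightarrow> is ! r = js ! r" using s(2)[of 0] s(2)[of "Suc _"] by auto
      then show ?thesis using s Suc by auto
    qed
  next
    assume ?R
    then show ?L
    proof
      assume "a < b" then show ?L by (intro exI[of _ 0]) simp
    next
      assume "a = b \<and> (\<exists>s<length is. (\<forall>r<s. is ! r = js ! r) \<and> is ! s < js ! s)"
      then obtain s where "a = b" "s < length is" "\<forall>r<s. is ! r = js ! r" "is ! s < js ! s" by blast
      then show ?L by (intro exI[of _ "Suc s"]) (auto simp: nth_Cons')
    qed
  qed
  then show ?case using Cons by auto
qed simp

lemma initial_lexsegment_eq:
  assumes "t \<ge> 1" "sorted_wrt (<) js" "length js = d" "index_monom js \<in> spread_monoms n d t"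
  shows "initial_lexsegment n d t (index_monom js) =
    {index_monom is | is. tspread t is \<and> length is = d \<and> set is \<subseteq> {1..n} \<and> lexle is js}"
proof -
  have "index_monom is = index_monom js \<or> slex_greater (index_monom is) (index_monom js) \<longleftrightarrow> lexle is js"
    if i: "tspread t is" "length is = d" for "is"
  proof -
    have s: "sorted_wrt (<) is" by (rule tspread_strict[OF i(1) assms(1)])
    have "slex_greater (index_monom is) (index_monom js) \<longleftrightarrow>
      (\<exists>s<length is. (\<forall>r<s. is ! r = js ! r) \<and> is ! s < js ! s)"
      unfolding slex_greater_def using index_monom_inj[OF s] index_monom_inj[OF assms(2)] s assms(2,3) i(2)
      by metis
    then show ?thesis using lexle_iff_nth[of "is" js] index_monom_inj[OF s assms(2)] i(2) assms(3) by auto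
  qed
  then show ?thesis unfolding initial_lexsegment_def spread_monoms_eq by blast
qed

lemma tspread_of_spread_monoms:
  assumes "t \<ge> 1" "sorted_wrt (<) js" "index_monom js \<in> spread_monoms n d t"
  shows "tspread t js" "set js \<subseteq> {1..n}"
proof -
  obtain "is" where i: "tspread t is" "set is \<subseteq> {1..n}" "index_monom js = index_monom is"
    using assms(3) unfolding spread_monoms_eq by blast
  then have "js = is" using index_monom_inj[OF assms(2) tspread_strict[OF i(1) assms(1)]] by simp
  then show "tspread t js" "set js \<subseteq> {1..n}" using i by auto
qed

text \<open>All generators are squarefree, so divisibility of a monomial by one of them depends only
  on its support, and the supports that contain no generator are the faces.\<close>

lemma monomial_ideal_lexsegment:
  assumes "t \<ge> 1" "sorted_wrt (<) js" "length js = d" "index_monom js \<in> spread_monoms n d t"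
  shows "monomial_ideal n (initial_lexsegment n d t (index_monom js)) =
    (sr_ideal n (lex_complex t 1 n js) :: 'k::field mpoly set)"
proof -
  let ?G = "initial_lexsegment n d t (index_monom js)"
  note G = initial_lexsegment_eq[OF assms]
  have G1: "index_monom is = sqf_monom (set is)" if "tspread t is" for "is"
    using that assms(1) by (intro index_monom_distinct strict_sorted_distinct tspread_strict)
  have "keys g \<subseteq> {1..n}" if "g \<in> ?G" for g
    using that G1 unfolding G by auto
  moreover have "(\<exists>g\<in>?G. \<exists>k. m = g + k) \<longleftrightarrow> keys m \<notin> lex_complex t 1 n js"
    if m: "keys m \<subseteq> {1..n}" for m
  proof -
    have "(\<exists>g\<in>?G. \<exists>k. m = g + k) \<longleftrightarrow>
      (\<exists>is. tspread t is \<and> length is = d \<and> set is \<subseteq> {1..n} \<and> lexle is js \<and> (\<exists>k. m = index_monom is + k))"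
      unfolding G by blast
    also have "\<dots> \<longleftrightarrow>
      (\<exists>is. tspread t is \<and> length is = d \<and> set is \<subseteq> {1..n} \<and> lexle is js \<and> set is \<subseteq> keys m)"
      using G1 sqf_monom_dvd_iff by (metis List.finite_set)
    also have "\<dots> \<longleftrightarrow> lex_nonface t js (keys m)"
      unfolding lex_nonface_def using assms(3) m by (intro ex_cong1) auto
    finally show ?thesis using m by (simp add: lex_complex_def)
  qed
  ultimately show ?thesis
    by (subst monomial_ideal_eq) (auto simp: sr_ideal_def polys_def)
qed

section \<open>A sequence regular on all large faces\<close>

definition var :: "nat \<Rightarrow> 'k::field mpoly" where
  "var i = single (single i 1) 1"

lemma sqf_singleton: "sqf {i} = var i"
  by (simp add: sqf_def var_def sqf_monom_def monom_poly_def)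

lemma var_in_polys [simp, intro]: "i \<in> {1..n} \<Longrightarrow> var i \<in> polys n"
  by (auto simp: var_def intro!: single_in_polys)

lemma var_neq_0 [simp]: "(var i :: 'k::field mpoly) \<noteq> 0"
proof
  assume "(var i :: 'k mpoly) = 0"
  then have "keys (var i :: 'k mpoly) = {}" by simp
  then show False by (simp add: var_def)
qed

lemma keys_var [simp]: "keys (var i) = {single i 1}"
  by (simp add: var_def)

lemma restr_id: "(\<And>m. m \<in> keys p \<Longrightarrow> Q m) \<Longrightarrow> restr Q p = p"
  by (rule poly_mapping_eqI) (auto simp: lookup_restr in_keys_iff)

lemma restr_0: "(\<And>m. m \<in> keys p \<Longrightarrow> \<not> Q m) \<Longrightarrow> restr Q p = 0"
  by (rule poly_mapping_eqI) (auto simp: lookup_restr in_keys_iff)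

section \<open>Grading by the degree in one variable\<close>

abbreviation slice :: "nat \<Rightarrow> nat \<Rightarrow> 'k::field mpoly \<Rightarrow> 'k mpoly" where
  "slice x k \<equiv> restr (\<lambda>m. lookup m x = k)"

definition free_of :: "nat \<Rightarrow> 'k::field mpoly \<Rightarrow> bool" where
  "free_of x p \<longleftrightarrow> (\<forall>m\<in>keys p. lookup m x = 0)"

lemma keys_multE:
  assumes "m \<in> keys (p * q)"
  obtains a b where "m = a + b" "a \<in> keys p" "b \<in> keys q"
  using assms keys_mult[of p q] by blast

lemma slice_mult_free:
  assumes "free_of x g"
  shows "slice x k (g * p) = g * slice x k p"
proof -
  have "g * p = g * slice x k p + g * (p - slice x k p)" by (simp add: algebra_simps)
  then have "slice x k (g * p) = slice x k (g * slice x k p) + slice x k (g * (p - slice x k p))"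
    by (metis restr_add)
  also have "slice x k (g * slice x k p) = g * slice x k p"
    using assms by (intro restr_id)
      (auto elim!: keys_multE simp: keys_restr free_of_def lookup_add)
  also have "slice x k (g * (p - slice x k p)) = 0"
    unfolding restr_diff using assms
    by (intro restr_0) (auto elim!: keys_multE simp: keys_restr free_of_def lookup_add)
  finally show ?thesis by simp
qed

lemma var_dvd:
  assumes "\<And>m. m \<in> keys p \<Longrightarrow> lookup m x > 0" "p \<in> polys n"
  shows "\<exists>q\<in>polys n. p = var x * q"
proof -
  let ?q = "\<Sum>m\<in>keys p. single (m - sqf_monom {x}) (lookup p m)"
  have "p = (\<Sum>m\<in>keys p. single m (lookup p m))"
    by (rule poly_sum_monoms)
  also have "\<dots> = (\<Sum>m\<in>keys p. var x * single (m - sqf_monom {x}) (lookup p m))"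
    using assms(1) by (intro sum.cong) (auto simp: sqf_dvd_single[of "{x}"] sqf_singleton in_keys_iff)
  also have "\<dots> = var x * ?q" by (simp add: sum_distrib_left)
  finally have "p = var x * ?q" .
  moreover have "?q \<in> polys n"
  proof (rule pr.sum_mem)
    fix m assume "m \<in> keys p"
    then have "keys m \<subseteq> {1..n}" using assms(2) by (auto simp: polys_def)
    then have "keys (m - sqf_monom {x}) \<subseteq> {1..n}"
      by (auto simp: in_keys_iff lookup_minus)
    then show "single (m - sqf_monom {x}) (lookup p m) \<in> polys n"
      by (rule single_in_polys)
  qed
  ultimately show ?thesis by blast
qed

text \<open>\<open>I\<close> is generated by elements that do not involve the variable \<open>x\<close>.\<close>

definition extended :: "nat \<Rightarrow> nat \<Rightarrow> 'k::field mpoly set \<Rightarrow> bool" where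
  "extended n x I \<longleftrightarrow> pr.idl n I \<and> (\<forall>p\<in>I. \<forall>k. slice x k p \<in> I) \<and> pr.nzd n I (var x)"

lemma extended_Pow:
  assumes "x \<in> F" "F \<subseteq> {1..n}"
  shows "extended n x (sr_ideal n (Pow F) :: 'k::field mpoly set)"
  unfolding extended_def
proof (intro conjI ballI allI)
  show "pr.idl n (sr_ideal n (Pow F) :: 'k mpoly set)" by (simp add: sr_ideal_idl)
  show "slice x k p \<in> sr_ideal n (Pow F)" if "p \<in> sr_ideal n (Pow F)" for p :: "'k mpoly" and k
    using that by (auto simp: sr_ideal_def restr_in_polys keys_restr)
  have "(var x :: 'k mpoly) \<notin> sr_ideal n (Pow F)" using assms by (auto simp: sr_ideal_def)
  moreover have "(var x :: 'k mpoly) \<in> polys n" using assms by auto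
  ultimately show "pr.nzd n (sr_ideal n (Pow F)) (var x :: 'k mpoly)"
    using sr_ideal_Pow_prim[of n F] unfolding pr.prim_def pr.nzd_def by blast
qed

lemma extended_adj:
  fixes g :: "'k::field mpoly"
  assumes "extended n x I" "g \<in> polys n" "free_of x g"
  shows "extended n x (pr.adj n I g)"
  unfolding extended_def
proof (intro conjI ballI allI)
  have I: "pr.idl n I" "\<And>p k. p \<in> I \<Longrightarrow> slice x k p \<in> I" "pr.nzd n I (var x)"
    using assms(1) by (auto simp: extended_def)
  show "pr.idl n (pr.adj n I g)" using I assms(2) by (simp add: pr.idl_adj)
  show "slice x k p \<in> pr.adj n I g" if p: "p \<in> pr.adj n I g" for p k
  proof -
    obtain a q where "a \<in> I" "q \<in> polys n" "p = a + g * q" using p by (rule pr.adjE)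
    then show ?thesis
      using I(2) by (auto simp: restr_add slice_mult_free[OF assms(3)] intro!: pr.adjI restr_in_polys)
  qed
  show "pr.nzd n (pr.adj n I g) (var x)"
    unfolding pr.nzd_def
  proof (intro ballI impI)
    fix q :: "'k mpoly" assume q: "q \<in> polys n" "var x * q \<in> pr.adj n I g"
    then obtain a p where a: "a \<in> I" "p \<in> polys n" "var x * q = a + g * p" by (auto elim: pr.adjE)
    have aP: "a \<in> polys n" using a I pr.idlD(1) by blast
    \<comment> \<open>The parts free of \<open>x\<close> on both sides: \<open>var x * q\<close> has
      none, so those of \<open>a\<close> and of \<open>g * p\<close> cancel, and what is left of
      \<open>a\<close> and of \<open>p\<close> is divisible by \<open>x\<close>.\<close>
    have "slice x 0 (var x * q) = 0"
      by (intro restr_0) (auto elim!: keys_multE simp: lookup_add)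
    then have "slice x 0 a + g * slice x 0 p = 0"
      using a(3) by (simp add: restr_add slice_mult_free[OF assms(3)])
    then have "var x * q = (a - slice x 0 a) + g * (p - slice x 0 p)"
      using a(3) by (simp add: algebra_simps)
    moreover obtain a' where a': "a' \<in> polys n" "a - slice x 0 a = var x * a'"
      using var_dvd[of "a - slice x 0 a" x n] aP restr_in_polys[OF aP]
      by (auto simp: restr_diff keys_restr)
    moreover obtain p' where p': "p' \<in> polys n" "p - slice x 0 p = var x * p'"
      using var_dvd[of "p - slice x 0 p" x n] a(2) restr_in_polys[OF a(2)]
      by (auto simp: restr_diff keys_restr)
    ultimately have "var x * q = var x * (a' + g * p')" by (simp add: algebra_simps)
    then have "q = a' + g * p'" by (simp only: mult_cancel_left) simp
    moreover have "a - slice x 0 a \<in> I" using a I pr.idlD(7) by blast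
    then have "a' \<in> I" using I(3) a' by (auto simp: pr.nzd_def)
    ultimately show "q \<in> pr.adj n I g" using p' by (auto intro: pr.adjI)
  qed
qed

text \<open>Leading coefficients with respect to \<open>x\<close>: the top slice of
  \<open>f * q\<close> is \<open>var x ^ s\<close> times the top slice \<open>q1\<close> of
  \<open>q\<close>. Since \<open>I\<close> contains the slices of its elements and \<open>x\<close>
  is a nonzerodivisor, \<open>q1\<close> is in \<open>I\<close>; subtracting it lowers the degree of
  \<open>q\<close> in \<open>x\<close>.\<close>

lemma nzd_monic:
  fixes f r :: "'k::field mpoly"
  assumes "extended n x I" "x \<in> {1..n}" "r \<in> polys n" "f = var x ^ s + r"
    and r: "\<And>m. m \<in> keys r \<Longrightarrow> lookup m x < s"
  shows "pr.nzd n I f"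
proof -
  have I: "pr.idl n I" "\<And>p k. p \<in> I \<Longrightarrow> slice x k p \<in> I" "pr.nzd n I (var x)"
    using assms(1) by (auto simp: extended_def)
  have fP: "f \<in> polys n" using assms by auto
  have keys_pow: "lookup m x = s" if "m \<in> keys (var x ^ s :: 'k mpoly)" for m s
    using that
    by (induction s arbitrary: m) (auto elim!: keys_multE simp: lookup_add)
  have pow: "q \<in> I" if "var x ^ s * q \<in> I" "q \<in> polys n" for s q
    using that
  proof (induction s)
    case (Suc s)
    have "(var x :: 'k mpoly) \<in> polys n" using assms(2) by (rule var_in_polys)
    then have "var x ^ s * q \<in> polys n" using Suc.prems(2) by blast
    moreover have "var x * (var x ^ s * q) \<in> I" using Suc.prems(1) by (simp add: mult.assoc)
    ultimately have "var x ^ s * q \<in> I" using pr.nzdD[OF I(3)] by blast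
    then show ?case using Suc by simp
  qed simp
  have "q \<in> I" if "\<And>m. m \<in> keys q \<Longrightarrow> lookup m x < N" "f * q \<in> I" "q \<in> polys n" for N q
    using that
  proof (induction N arbitrary: q)
    case 0
    then have "keys q = {}" by blast
    then have "q = 0" by simp
    then show ?case using I pr.idlD(2) by simp
  next
    case (Suc N)
    define q1 where "q1 = slice x N q"
    define q2 where "q2 = q - q1"
    have q12: "q1 \<in> polys n" "q2 \<in> polys n" using Suc.prems by (auto simp: q1_def q2_def restr_in_polys)
    have k1: "lookup m x = N" if "m \<in> keys q1" for m
      using that by (auto simp: q1_def keys_restr)
    have k2: "lookup m x < N" if "m \<in> keys q2" for m
      using that Suc.prems(1)[of m] by (auto simp: q2_def q1_def keys_restr restr_diff)
    have "f * q = var x ^ s * q1 + (var x ^ s * q2 + r * q)"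
      using assms(4) by (simp add: q2_def algebra_simps)
    then have "slice x (s + N) (f * q) = slice x (s + N) (var x ^ s * q1) +
        (slice x (s + N) (var x ^ s * q2) + slice x (s + N) (r * q))"
      by (simp only: restr_add)
    also have "slice x (s + N) (var x ^ s * q1) = var x ^ s * q1"
      by (intro restr_id) (auto elim!: keys_multE simp: lookup_add k1 keys_pow)
    also have "slice x (s + N) (var x ^ s * q2) = 0"
    proof (intro restr_0)
      fix m assume "m \<in> keys (var x ^ s * q2)"
      then obtain a b where "m = a + b" "a \<in> keys (var x ^ s :: 'k mpoly)" "b \<in> keys q2"
        by (rule keys_multE)
      then show "lookup m x \<noteq> s + N"
        using keys_pow[of a s] k2[of b] by (simp add: lookup_add)
    qed
    also have "slice x (s + N) (r * q) = 0"
    proof (intro restr_0)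
      fix m assume "m \<in> keys (r * q)"
      then obtain a b where "m = a + b" "a \<in> keys r" "b \<in> keys q"
        by (rule keys_multE)
      then show "lookup m x \<noteq> s + N"
        using r[of a] Suc.prems(1)[of b] by (simp add: lookup_add)
    qed
    finally have "var x ^ s * q1 \<in> I" using I(2)[OF Suc.prems(2), of "s + N"] by simp
    then have q1I: "q1 \<in> I" using pow q12 by blast
    have "f * q2 = f * q - f * q1" by (simp add: q2_def algebra_simps)
    moreover have "f * q1 \<in> I" using pr.idlD(4)[OF I(1) fP q1I] .
    ultimately have "f * q2 \<in> I" using Suc.prems(2) pr.idlD(7)[OF I(1)] by simp
    then have "q2 \<in> I" using Suc.IH[of q2] k2 q12 by blast
    then have "q1 + q2 \<in> I" using q1I pr.idlD(3)[OF I(1)] by blast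
    then show ?case by (simp add: q2_def)
  qed
  note main = this
  show ?thesis unfolding pr.nzd_def
  proof (intro ballI impI)
    fix q assume "q \<in> polys n" "f * q \<in> I"
    moreover have "lookup m x < Suc (Max ((\<lambda>m. lookup m x) ` keys q))"
      if "m \<in> keys q" for m
      using that by (auto simp: less_Suc_eq_le)
    ultimately show "q \<in> I" using main by blast
  qed
qed

text \<open>The complete homogeneous symmetric polynomial of degree \<open>i\<close> in the variables \<open>xs\<close>.\<close>

fun hsym :: "nat list \<Rightarrow> nat \<Rightarrow> 'k::field mpoly" where
  "hsym xs 0 = 1"
| "hsym [] (Suc i) = 0"
| "hsym (x # xs) (Suc i) = hsym xs (Suc i) + var x * hsym (x # xs) i"

lemma hsym_in_polys: "set xs \<subseteq> {1..n} \<Longrightarrow> hsym xs i \<in> polys n"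
  by (induction xs i rule: hsym.induct) auto

lemma hsym_free: "x \<notin> set xs \<Longrightarrow> free_of x (hsym xs i :: 'k::field mpoly)"
proof (induction xs i rule: hsym.induct)
  case (3 y xs i)
  have "lookup m x = 0" if "m \<in> keys (hsym (y # xs) (Suc i) :: 'k mpoly)" for m
  proof -
    have "m \<in> keys (hsym xs (Suc i) :: 'k mpoly) \<union> keys (var y * hsym (y # xs) i :: 'k mpoly)"
      using that keys_add[of "hsym xs (Suc i) :: 'k mpoly" "var y * hsym (y # xs) i"] by auto
    then show ?thesis
      using 3 by (auto elim!: keys_multE simp: free_of_def lookup_add lookup_single when_def)
  qed
  then show ?case by (simp add: free_of_def)
qed (auto simp: free_of_def)

lemma hsym_monic:
  assumes "x \<notin> set xs" "set (x # xs) \<subseteq> {1..n}"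
  shows "\<exists>r\<in>polys n. (hsym (x # xs) s :: 'k::field mpoly) = var x ^ s + r \<and>
    (\<forall>m\<in>keys r. lookup m x < s)"
proof (induction s)
  case (Suc s)
  then obtain r :: "'k mpoly" where r: "r \<in> polys n" "hsym (x # xs) s = var x ^ s + r"
    "\<forall>m\<in>keys r. lookup m x < s" by blast
  let ?r = "hsym xs (Suc s) + var x * r"
  have "(var x :: 'k mpoly) \<in> polys n" by (rule var_in_polys) (use assms(2) in simp)
  moreover have "hsym xs (Suc s) \<in> polys n" by (rule hsym_in_polys) (use assms(2) in simp)
  ultimately have "?r \<in> polys n" using r(1) by blast
  moreover have "hsym (x # xs) (Suc s) = var x ^ Suc s + ?r" using r by (simp add: algebra_simps)
  moreover have "lookup m x < Suc s" if "m \<in> keys ?r" for m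
  proof -
    have "m \<in> keys (hsym xs (Suc s) :: 'k mpoly) \<union> keys (var x * r)"
      using that keys_add[of "hsym xs (Suc s) :: 'k mpoly" "var x * r"] by auto
    then show ?thesis
      using r(3) hsym_free[OF assms(1), of "Suc s", where 'k = 'k]
      by (auto elim!: keys_multE simp: free_of_def lookup_add)
  qed
  ultimately show ?case by blast
qed (intro bexI[of _ 0], auto)

text \<open>Modulo \<open>h\<^sub>s(x\<^sub>1, \<dots>, x\<^sub>r)\<close> the polynomials \<open>h\<^bsub>s+1\<^esub>\<close> in \<open>x\<^sub>1, \<dots>, x\<^sub>r\<close> and in
  \<open>x\<^sub>2, \<dots>, x\<^sub>r\<close> agree, so the sequence of the \<open>h\<^sub>i\<close> may be replaced by a triangular one.\<close>

fun hsym_triangular :: "nat list \<Rightarrow> nat \<Rightarrow> nat \<Rightarrow> 'k::field mpoly list" where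
  "hsym_triangular (x # xs) s (Suc k) = hsym (x # xs) s # hsym_triangular xs (Suc s) k"
| "hsym_triangular _ _ _ = []"

lemma hsym_triangular_cases:
  "f \<in> set (hsym_triangular xs s k) \<Longrightarrow> \<exists>ys i. f = hsym ys i \<and> set ys \<subseteq> set xs"
proof (induction xs s k rule: hsym_triangular.induct)
  case (1 x xs s k)
  show ?case
  proof (cases "f = hsym (x # xs) s")
    case True then show ?thesis by blast
  next
    case False
    then obtain ys i where "f = hsym ys i" "set ys \<subseteq> set xs" using 1 by auto
    then show ?thesis by (intro exI[of _ ys] exI[of _ i]) auto
  qed
qed auto

text \<open>The members after the first do not involve \<open>x\<close>. Any ideal that some of them
  generate together with the face ideal is thus extended from the other variables, and modulo it a
  polynomial monic in \<open>x\<close> is a nonzerodivisor.\<close>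

lemma strongly_regular_hsym_triangular:
  assumes "distinct xs" "set xs \<subseteq> F" "F \<subseteq> {1..n}"
  shows "pr.strongly_regular n (sr_ideal n (Pow F)) (hsym_triangular xs s k :: 'k::field mpoly list)"
  using assms
proof (induction xs s k rule: hsym_triangular.induct)
  case (1 x xs s k)
  have "pr.nzd n (foldl (pr.adj n) (sr_ideal n (Pow F)) hs) (hsym (x # xs) s)"
    if hs: "set hs \<subseteq> set (hsym_triangular xs (Suc s) k)" for hs :: "'k mpoly list"
  proof -
    have h: "h \<in> polys n \<and> free_of x h" if hh: "h \<in> set hs" for h
    proof -
      obtain ys i where "h = hsym ys i" "set ys \<subseteq> set xs"
        using hsym_triangular_cases[of h xs "Suc s" k] hs hh by auto
      then show ?thesis using "1.prems" hsym_in_polys[of ys n i] hsym_free[of x ys i] by auto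
    qed
    have "extended n x (foldl (pr.adj n) I hs)" if "extended n x I" for I
      using h that by (induction hs arbitrary: I) (auto intro: extended_adj)
    then have "extended n x (foldl (pr.adj n) (sr_ideal n (Pow F)) hs)"
      using extended_Pow[of x F n] "1.prems" by auto
    moreover obtain r :: "'k mpoly" where "r \<in> polys n" "hsym (x # xs) s = var x ^ s + r"
      "\<forall>m\<in>keys r. lookup m x < s"
    proof -
      have "x \<notin> set xs" "set (x # xs) \<subseteq> {1..n}" using "1.prems" by auto
      then show ?thesis using hsym_monic[of x xs n s] that by blast
    qed
    ultimately show ?thesis using "1.prems" by (intro nzd_monic) auto
  qed
  then show ?case using 1 by simp
qed auto

text \<open>\<open>ys\<close> are the variables that the triangular sequence has already dropped,
  \<open>xs\<close> those still present. The last hypothesis is what the earlier members have left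
  in \<open>I\<close>; it makes h_{s+1} in \<open>ys @ xs\<close> and h_{s+1} in \<open>xs\<close>
  congruent modulo \<open>I\<close>. At the start \<open>ys\<close> is empty, and so is this
  hypothesis.\<close>

lemma wreg_hsym_of_triangular:
  assumes "pr.idl n I" "set (ys @ xs) \<subseteq> {1..n}" "k \<le> length xs"
    and "pr.wreg n I (hsym_triangular xs (Suc s) k :: 'k::field mpoly list)"
    and "\<And>us zs. ys = us @ zs \<Longrightarrow> zs \<noteq> [] \<Longrightarrow> hsym (zs @ xs) s \<in> I"
  shows "pr.wreg n I (map (hsym (ys @ xs)) [Suc s..<Suc s + k])"
  using assms
proof (induction k arbitrary: I xs ys s)
  case (Suc k)
  then obtain x xs' where xs: "xs = x # xs'" by (cases xs) auto
  \<comment> \<open>Telescoping along the recursion of \<open>hsym\<close>: removing the first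
    variable \<open>z\<close> changes h_{s+1} by \<open>var z\<close> times an h_s that is in
    \<open>I\<close>.\<close>
  have d: "hsym (zs @ xs) (Suc s) - hsym xs (Suc s) \<in> I" if "ys = us @ zs" for us zs
    using that
  proof (induction zs arbitrary: us)
    case Nil
    then show ?case using pr.idlD(2)[OF Suc.prems(1)] by simp
  next
    case (Cons z zs)
    have e: "hsym (z # zs @ xs) (Suc s) - hsym xs (Suc s) =
      (hsym (zs @ xs) (Suc s) - hsym xs (Suc s)) + var z * hsym (z # zs @ xs) s" by simp
    have "hsym (z # zs @ xs) s \<in> I" using Suc.prems(5)[of us "z # zs"] Cons.prems by simp
    moreover have "(var z :: 'k mpoly) \<in> polys n" using Cons.prems Suc.prems(2) by auto
    ultimately have "var z * hsym (z # zs @ xs) s \<in> I" using pr.idlD(4)[OF Suc.prems(1)] by blast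
    moreover have "hsym (zs @ xs) (Suc s) - hsym xs (Suc s) \<in> I"
      using Cons.IH[of "us @ [z]"] Cons.prems by simp
    ultimately have "hsym (z # zs @ xs) (Suc s) - hsym xs (Suc s) \<in> I"
      unfolding e using pr.idlD(3)[OF Suc.prems(1)] by blast
    then show ?case by (simp del: hsym.simps)
  qed
  let ?f = "hsym xs (Suc s) :: 'k mpoly"
  let ?g = "hsym (ys @ xs) (Suc s) :: 'k mpoly"
  have P: "?f \<in> polys n" "?g \<in> polys n" using Suc.prems(2) by (intro hsym_in_polys; auto)+
  have fg: "?g - ?f \<in> I" using d[of "[]" ys] by simp
  have w: "pr.nzd n I ?f" "pr.wreg n (pr.adj n I ?f) (hsym_triangular xs' (Suc (Suc s)) k)"
    using Suc.prems(4) xs by auto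
  have "pr.nzd n I ?g" by (rule pr.nzd_cong[OF Suc.prems(1) fg w(1)])
  moreover have "pr.adj n I ?g = pr.adj n I ?f" using pr.adj_cong[OF Suc.prems(1) fg P(2,1)] .
  moreover have "pr.wreg n (pr.adj n I ?f) (map (hsym ((ys @ [x]) @ xs')) [Suc (Suc s)..<Suc (Suc s) + k])"
  proof (rule Suc.IH)
    show idl: "pr.idl n (pr.adj n I ?f)" using Suc.prems(1) P by (simp add: pr.idl_adj)
    show "pr.wreg n (pr.adj n I ?f) (hsym_triangular xs' (Suc (Suc s)) k)" by (rule w)
    \<comment> \<open>The nonempty suffixes now end with \<open>x\<close>. For them h_{s+1} is
      congruent modulo \<open>I\<close> to \<open>?f\<close>, the element just adjoined.\<close>
    fix us zs assume u: "ys @ [x] = us @ zs" "zs \<noteq> []"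
    then obtain zs' where zs: "zs = zs' @ [x]" "ys = us @ zs'"
      by (metis append_butlast_last_id append_eq_append_conv2 butlast_append butlast_snoc last_appendR last_snoc)
    have "(hsym (zs' @ xs) (Suc s) - ?f) + ?f * 1 \<in> pr.adj n I ?f"
      using d[OF zs(2)] by (intro pr.adjI) auto
    then show "hsym (zs @ xs') (Suc s) \<in> pr.adj n I ?f" using zs xs by simp
  qed (use Suc.prems xs in auto)
  moreover have "[Suc s..<Suc s + Suc k] = Suc s # [Suc (Suc s)..<Suc (Suc s) + k]"
    by (simp add: upt_conv_Cons)
  ultimately show ?case using xs by simp
qed simp

lemma hsym_filter_cong:
  assumes "set xs \<subseteq> {1..n}"
  shows "hsym xs i - hsym (filter (\<lambda>x. x \<in> F) xs) i \<in> (sr_ideal n (Pow F) :: 'k::field mpoly set)"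
  using assms
proof (induction xs i rule: hsym.induct)
  case (3 x xs i)
  let ?P = "sr_ideal n (Pow F) :: 'k mpoly set"
  have idl: "pr.idl n ?P" by (simp add: sr_ideal_idl)
  note d = pr.idlD[OF idl]
  have x: "(var x :: 'k mpoly) \<in> polys n" using 3 by auto
  have IH: "hsym xs (Suc i) - hsym (filter (\<lambda>x. x \<in> F) xs) (Suc i) \<in> ?P"
    "hsym (x # xs) i - hsym (filter (\<lambda>x. x \<in> F) (x # xs)) i \<in> ?P" using 3 by auto
  show ?case
  proof (cases "x \<in> F")
    case True
    have "hsym (x # xs) (Suc i) - hsym (filter (\<lambda>x. x \<in> F) (x # xs)) (Suc i) =
      (hsym xs (Suc i) - hsym (filter (\<lambda>x. x \<in> F) xs) (Suc i)) +
      var x * (hsym (x # xs) i - hsym (filter (\<lambda>x. x \<in> F) (x # xs)) i :: 'k mpoly)"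
      using True by (simp add: algebra_simps)
    then show ?thesis using d(3)[OF IH(1) d(4)[OF x IH(2)]] by metis
  next
    case False
    then have "(var x :: 'k mpoly) \<in> ?P" using 3 by (auto simp: sr_ideal_def)
    moreover have "(hsym (x # xs) i :: 'k mpoly) \<in> polys n" by (rule hsym_in_polys) (use 3 in auto)
    ultimately have "var x * hsym (x # xs) i \<in> ?P" using d(5) by blast
    moreover have "hsym (x # xs) (Suc i) - hsym (filter (\<lambda>x. x \<in> F) (x # xs)) (Suc i) =
      (hsym xs (Suc i) - hsym (filter (\<lambda>x. x \<in> F) xs) (Suc i)) + (var x * hsym (x # xs) i :: 'k mpoly)"
      using False by (simp add: algebra_simps)
    ultimately show ?thesis using d(3)[OF IH(1)] by metis
  qed
qed (simp_all add: sr_ideal_def)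

context subring_set
begin

lemma wreg_cong:
  assumes "idl I" "list_all2 (\<lambda>r s. r - s \<in> I \<and> r \<in> C \<and> s \<in> C) rs ss" "wreg I ss"
  shows "wreg I rs"
  using assms
proof (induction rs arbitrary: I ss)
  case (Cons r rs)
  then obtain s ss' where s: "ss = s # ss'" "r - s \<in> I" "r \<in> C" "s \<in> C"
    "list_all2 (\<lambda>r s. r - s \<in> I \<and> r \<in> C \<and> s \<in> C) rs ss'"
    by (auto simp: list_all2_Cons1)
  have "list_all2 (\<lambda>a b. a - b \<in> adj I s \<and> a \<in> C \<and> b \<in> C) rs ss'"
    using s(5) by (rule list_all2_mono) (simp add: adj_superset)
  then have "wreg (adj I s) rs" using Cons.IH[of "adj I s" ss'] Cons.prems s by (simp add: idl_adj)
  then show ?case using Cons.prems s nzd_cong[of I r s] adj_cong[of I r s] by simp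
qed simp

end

text \<open>Modulo the face ideal only the variables of \<open>F\<close> remain. Each member of the
  triangular sequence uses up one of them, whence the condition
  \<open>e \<le> card F\<close>.\<close>

lemma wreg_hsym_Pow:
  assumes "F \<subseteq> {1..n}" "e \<le> card F"
  shows "pr.wreg n (sr_ideal n (Pow F)) (map (hsym [1..<Suc n]) [1..<Suc e] :: 'k::field mpoly list)"
proof -
  let ?P = "sr_ideal n (Pow F) :: 'k mpoly set"
  define xs where "xs = filter (\<lambda>x. x \<in> F) [1..<Suc n]"
  have xs: "set xs = F" "distinct xs" using assms(1) by (auto simp: xs_def)
  then have len: "length xs = card F" using distinct_card by force
  have idl: "pr.idl n ?P" by (simp add: sr_ideal_idl)
  have "pr.wreg n ?P (hsym_triangular xs (Suc 0) e)"
  proof (rule pr.strongly_regular_imp_wreg[OF idl])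
    show "set (hsym_triangular xs (Suc 0) e) \<subseteq> (polys n :: 'k mpoly set)"
    proof
      fix f :: "'k mpoly" assume "f \<in> set (hsym_triangular xs (Suc 0) e)"
      then obtain ys i where "f = hsym ys i" "set ys \<subseteq> set xs"
        using hsym_triangular_cases[of f xs "Suc 0" e] by auto
      then show "f \<in> polys n" using hsym_in_polys[of ys n i] xs assms(1) by auto
    qed
  qed (use strongly_regular_hsym_triangular[of xs F n] xs assms in auto)
  then have "pr.wreg n ?P (map (hsym ([] @ xs)) [Suc 0..<Suc 0 + e])"
    using xs assms len by (intro wreg_hsym_of_triangular[OF idl]) auto
  then have w: "pr.wreg n ?P (map (hsym xs) [1..<Suc e])" by simp
  show ?thesis
  proof (rule pr.wreg_cong[OF idl _ w])
    show "list_all2 (\<lambda>r s. r - s \<in> ?P \<and> r \<in> polys n \<and> s \<in> polys n)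
      (map (hsym [1..<Suc n]) [1..<Suc e]) (map (hsym xs) [1..<Suc e])"
    proof -
      have s: "set [1..<Suc n] \<subseteq> {1..n}" "set xs \<subseteq> {1..n}" using xs assms(1) by auto
      have "hsym [1..<Suc n] i - hsym xs i \<in> ?P \<and> hsym [1..<Suc n] i \<in> (polys n :: 'k mpoly set) \<and>
          hsym xs i \<in> (polys n :: 'k mpoly set)" for i
        unfolding xs_def
        by (intro conjI hsym_filter_cong[OF s(1)] hsym_in_polys[OF s(1)] hsym_in_polys[OF s(2)[unfolded xs_def]])
      then show ?thesis by (simp add: list_all2_conv_all_nth del: upt_Suc)
    qed
  qed
qed

lemma wreg_hsym_interval_filt:
  assumes "interval_filt 1 n e D"
  shows "pr.wreg n (sr_ideal n D) (map (hsym [1..<Suc n]) [1..<Suc e] :: 'k::field mpoly list)"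
  using assms
proof (induction rule: interval_filt.induct)
  case empty
  have "set (map (hsym [1..<Suc n]) [1..<Suc e]) \<subseteq> (polys n :: 'k mpoly set)"
    by (auto intro!: hsym_in_polys simp del: upt_Suc)
  then show ?case by (simp add: pr.wreg_carrier del: upt_Suc)
next
  case (step D R F)
  have "\<forall>G. G \<subseteq> F \<longrightarrow> \<not> R \<subseteq> G \<longrightarrow> G \<in> D" using step.hyps(6) by blast
  note s = sr_ideal_interval[OF step.hyps(1-5) this, where 'k = 'k]
  have R: "R \<subseteq> {1..n}" using step.hyps by auto
  show ?case
  proof (rule pr.wreg_extension[OF s(1) sqf_in_polys[OF R]])
    show "pr.wreg n (pr.adj n (sr_ideal n (D \<union> {G. R \<subseteq> G \<and> G \<subseteq> F})) (sqf R))
        (map (hsym [1..<Suc n]) [1..<Suc e] :: 'k mpoly list)"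
      unfolding s(2) by (rule step.IH)
    show "pr.wreg n {z \<in> polys n. sqf R * z \<in> sr_ideal n (D \<union> {G. R \<subseteq> G \<and> G \<subseteq> F})}
        (map (hsym [1..<Suc n]) [1..<Suc e] :: 'k mpoly list)"
      unfolding s(3) by (rule wreg_hsym_Pow[OF step.hyps(3,4)])
  qed (auto intro!: hsym_in_polys simp del: upt_Suc)
qed

section \<open>Algebraic dependence, depth and Krull dimension\<close>

text \<open>Fewer equations than unknowns. In Gaussian elimination a pivot \<open>M b0 t\<close>
  removes the equation \<open>t\<close> together with the unknown \<open>b0\<close>.\<close>

lemma left_kernel_nontrivial:
  fixes M :: "'b \<Rightarrow> 't \<Rightarrow> 'k::field"
  assumes "finite T" "finite B" "card T < card B"
  shows "\<exists>c. (\<exists>b\<in>B. c b \<noteq> 0) \<and> (\<forall>t\<in>T. (\<Sum>b\<in>B. c b * M b t) = 0)"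
  using assms
proof (induction T arbitrary: B M rule: finite_induct)
  case empty
  then obtain b where "b \<in> B" by (metis card.empty all_not_in_conv less_numeral_extra(3))
  then show ?case by (intro exI[of _ "\<lambda>_. 1"]) auto
next
  case (insert t T)
  show ?case
  proof (cases "\<forall>b\<in>B. M b t = 0")
    case True
    obtain c where "\<exists>b\<in>B. c b \<noteq> 0" "\<forall>t\<in>T. (\<Sum>b\<in>B. c b * M b t) = 0"
      using insert.IH[of B M] insert.prems insert.hyps by auto
    then show ?thesis using True by (intro exI[of _ c]) auto
  next
    case False
    then obtain b0 where b0: "b0 \<in> B" "M b0 t \<noteq> 0" by blast
    define B' where "B' = B - {b0}"
    have B': "finite B'" "B = insert b0 B'" "b0 \<notin> B'" using insert.prems b0 by (auto simp: B'_def)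
    then have "card T < card B'" using insert.prems insert.hyps by simp
    then obtain c' where c': "\<exists>b\<in>B'. c' b \<noteq> 0"
      "\<forall>s\<in>T. (\<Sum>b\<in>B'. c' b * (M b s - M b t / M b0 t * M b0 s)) = 0"
      using insert.IH[of B' "\<lambda>b s. M b s - M b t / M b0 t * M b0 s"] B'(1) by blast
    define w where "w = (\<Sum>b\<in>B'. c' b * (M b t / M b0 t))"
    define c where "c = c'(b0 := - w)"
    have c_sum: "(\<Sum>b\<in>B. c b * M b s) = - w * M b0 s + (\<Sum>b\<in>B'. c' b * M b s)" for s
    proof -
      have "(\<Sum>b\<in>B'. c b * M b s) = (\<Sum>b\<in>B'. c' b * M b s)"
        using B' by (intro sum.cong) (auto simp: c_def)
      then show ?thesis using B' by (simp add: c_def)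
    qed
    have "(\<Sum>b\<in>B. c b * M b s) = 0" if "s \<in> T" for s
    proof -
      have "(\<Sum>b\<in>B'. c' b * M b s) - w * M b0 s = (\<Sum>b\<in>B'. c' b * (M b s - M b t / M b0 t * M b0 s))"
        unfolding w_def sum_distrib_right sum_subtractf[symmetric]
        by (intro sum.cong refl) (simp add: algebra_simps)
      then have "(\<Sum>b\<in>B'. c' b * M b s) - w * M b0 s = 0" using c'(2) that by simp
      then show ?thesis unfolding c_sum by simp
    qed
    moreover have "(\<Sum>b\<in>B. c b * M b t) = 0"
      unfolding c_sum w_def using b0 by (simp add: sum_distrib_right)
    moreover have "\<exists>b\<in>B. c b \<noteq> 0" using c'(1) B' by (auto simp: c_def)
    ultimately show ?thesis by blast
  qed
qed

section \<open>Algebraic dependence by counting monomials\<close>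

lemma bounded_exponents_finite:
  assumes "finite F"
  shows "finite {m :: nat \<Rightarrow>\<^sub>0 nat. keys m \<subseteq> F \<and> (\<forall>i. lookup m i \<le> D)}" (is "finite ?T")
    and "card {m :: nat \<Rightarrow>\<^sub>0 nat. keys m \<subseteq> F \<and> (\<forall>i. lookup m i \<le> D)} \<le> (D + 1) ^ card F"
proof -
  let ?f = "\<lambda>m :: nat \<Rightarrow>\<^sub>0 nat. restrict (lookup m) F"
  have inj: "inj_on ?f ?T"
  proof (rule inj_onI, rule poly_mapping_eqI)
    fix a b i assume ab: "a \<in> ?T" "b \<in> ?T" "?f a = ?f b"
    show "lookup a i = lookup b i"
    proof (cases "i \<in> F")
      case True then show ?thesis using fun_cong[OF ab(3), of i] by simp
    next
      case False
      then have "i \<notin> keys a" "i \<notin> keys b" using ab by auto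
      then show ?thesis by (simp add: in_keys_iff)
    qed
  qed
  have sub: "?f ` ?T \<subseteq> F \<rightarrow>\<^sub>E {..D}" by (auto simp: PiE_iff)
  have fin: "finite (F \<rightarrow>\<^sub>E {..D})" using assms by (simp add: finite_PiE)
  then show "finite ?T" using inj sub by (meson finite_imageD finite_subset)
  have "card ?T \<le> card (F \<rightarrow>\<^sub>E {..D})" by (rule card_inj_on_le[OF inj sub fin])
  then show "card ?T \<le> (D + 1) ^ card F" using assms by (simp add: card_PiE)
qed

lemma exponents_mult:
  assumes "\<And>m. m \<in> keys p \<Longrightarrow> lookup m i \<le> a"
    and "\<And>m. m \<in> keys q \<Longrightarrow> lookup m i \<le> b"
    and "m \<in> keys (p * q)"
  shows "lookup m i \<le> a + (b::nat)"
  using assms(3) by (rule keys_multE) (use assms(1,2) in \<open>auto simp: lookup_add intro: add_mono\<close>)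

lemma exponents_power:
  assumes "\<And>m. m \<in> keys p \<Longrightarrow> lookup m i \<le> a" "m \<in> keys (p ^ k)"
  shows "lookup m i \<le> k * (a::nat)"
  using assms(2)
proof (induction k arbitrary: m)
  case (Suc k)
  then have "m \<in> keys (p * p ^ k)" by simp
  then show ?case using exponents_mult[OF assms(1) Suc.IH] by simp
qed simp

text \<open>There are \<open>N ^ length fs\<close> products of powers with exponents below
  \<open>N\<close>, while the monomials on \<open>F\<close> that occur in them have exponents linear
  in \<open>N\<close>, so their number is at most of order \<open>N ^ card F\<close>. For large
  \<open>N\<close> some combination of the products has no monomial on \<open>F\<close>, that is,
  lies in the face ideal.\<close>

lemma algebraically_dependent:
  fixes fs :: "'k::field mpoly list"
  assumes "set fs \<subseteq> polys n" "finite F" "card F < length fs"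
  shows "\<exists>A c. finite A \<and> A \<noteq> {} \<and> (\<forall>\<alpha>\<in>A. length \<alpha> = length fs \<and> c \<alpha> \<noteq> 0) \<and>
    (\<Sum>\<alpha>\<in>A. single 0 (c \<alpha>) * prod_list (map2 (^) fs \<alpha>)) \<in> sr_ideal n (Pow F)"
proof -
  let ?l = "length fs" and ?m = "card F"
  have "finite (\<Union>f\<in>set fs. \<Union>m\<in>keys f. Poly_Mapping.range m)" by auto
  then obtain E where E: "\<And>f m i. f \<in> set fs \<Longrightarrow> m \<in> keys f \<Longrightarrow> lookup m i \<le> E"
  proof -
    let ?R = "\<Union>f\<in>set fs. \<Union>m\<in>keys f. Poly_Mapping.range m"
    have "lookup m i \<le> Max (insert 0 ?R)" if "f \<in> set fs" "m \<in> keys f" for f m i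
    proof (cases "i \<in> keys m")
      case True
      then have "lookup m i \<in> Poly_Mapping.range m" by simp
      then have "lookup m i \<in> ?R" using that by blast
      then show ?thesis by (intro Max_ge) auto
    qed (simp add: in_keys_iff)
    then show ?thesis using that by blast
  qed
  \<comment> \<open>With l = \<open>?l\<close> and m = \<open>?m\<close> the aim is
    \<open>(D + 1) ^ m < N ^ l\<close>. As \<open>D + 1 \<le> N * (l * E + 1)\<close>, the left side
    is at most \<open>N ^ m * (l * E + 1) ^ m\<close>, and one more factor \<open>N\<close> exceeds
    the constant \<open>(l * E + 1) ^ m\<close>.\<close>
  define N where "N = (?l * E + 1) ^ ?m + 1"
  define D where "D = ?l * (N * E)"
  define T where "T = {m :: nat \<Rightarrow>\<^sub>0 nat. keys m \<subseteq> F \<and> (\<forall>i. lookup m i \<le> D)}"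
  define B where "B = {\<alpha>. set \<alpha> \<subseteq> {..<N} \<and> length \<alpha> = ?l}"
  have T: "finite T" "card T \<le> (D + 1) ^ ?m"
    unfolding T_def using bounded_exponents_finite[OF assms(2)] by auto
  have B: "finite B" "card B = N ^ ?l"
    unfolding B_def by (auto simp: finite_lists_length_eq card_lists_length_eq)
  have "D + 1 \<le> N * (?l * E + 1)" by (simp add: D_def N_def algebra_simps)
  then have "(D + 1) ^ ?m \<le> N ^ ?m * (?l * E + 1) ^ ?m"
    by (metis power_mono power_mult_distrib zero_le)
  also have "\<dots> < N ^ ?m * N" by (simp add: N_def)
  also have "\<dots> = N ^ Suc ?m" by simp
  also have "\<dots> \<le> N ^ ?l" using assms(3) by (intro power_increasing) (auto simp: N_def)
  finally have "card T < card B" using T B by simp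
  define v where "v \<alpha> = prod_list (map2 (^) fs \<alpha>)" for \<alpha>
  obtain c where c: "\<exists>\<alpha>\<in>B. c \<alpha> \<noteq> 0" "\<And>m. m \<in> T \<Longrightarrow> (\<Sum>\<alpha>\<in>B. c \<alpha> * lookup (v \<alpha>) m) = 0"
    using left_kernel_nontrivial[OF T(1) B(1) \<open>card T < card B\<close>, of "\<lambda>\<alpha>. lookup (v \<alpha>)"] by blast
  \<comment> \<open>Zero coefficients are dropped, since peeling requires invertible ones.\<close>
  define A where "A = {\<alpha> \<in> B. c \<alpha> \<noteq> 0}"
  have vP: "prod_list (map2 (^) gs \<alpha>) \<in> polys n" if "set gs \<subseteq> polys n" for gs :: "'k mpoly list" and \<alpha> :: "nat list"
    using that
  proof (induction gs arbitrary: \<alpha>)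
    case (Cons g gs) then show ?case by (cases \<alpha>) auto
  qed simp
  have bound: "lookup m i \<le> length gs * (N * E)"
    if "set gs \<subseteq> set fs" "set \<alpha> \<subseteq> {..<N}" "m \<in> keys (prod_list (map2 (^) gs \<alpha>))" for gs \<alpha> m i
    using that
  proof (induction gs arbitrary: \<alpha> m)
    case (Cons g gs)
    show ?case
    proof (cases \<alpha>)
      case (Cons a \<alpha>')
      then have "m \<in> keys (g ^ a * prod_list (map2 (^) gs \<alpha>'))" using Cons.prems by simp
      moreover have "lookup m i \<le> N * E" if "m \<in> keys (g ^ a)" for m
      proof -
        have "lookup m i \<le> a * E"
          using exponents_power[of g i E m a] E[of g] Cons.prems that by auto
        moreover have "a * E \<le> N * E" using Cons.prems \<open>\<alpha> = a # \<alpha>'\<close> by (intro mult_right_mono) auto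
        ultimately show ?thesis by linarith
      qed
      moreover have "lookup m i \<le> length gs * (N * E)"
        if "m \<in> keys (prod_list (map2 (^) gs \<alpha>'))" for m
        using Cons.IH[of \<alpha>' m] Cons.prems \<open>\<alpha> = a # \<alpha>'\<close> that by auto
      ultimately have "lookup m i \<le> N * E + length gs * (N * E)"
        by (intro exponents_mult) auto
      then show ?thesis by simp
    qed (use Cons in simp)
  qed simp
  let ?s = "\<Sum>\<alpha>\<in>A. single 0 (c \<alpha>) * v \<alpha>"
  have "?s \<in> polys n"
    unfolding v_def using vP[OF assms(1)] by (intro pr.sum_mem pr.mult_mem single_in_polys) auto
  moreover have "restr (\<lambda>m. keys m \<subseteq> F) ?s = 0"
  proof (rule poly_mapping_eqI)
    fix m
    have "lookup ?s m = (\<Sum>\<alpha>\<in>A. c \<alpha> * lookup (v \<alpha>) m)"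
      unfolding lookup_sum by (intro sum.cong refl) (metis add_0 lookup_single_mult)
    also have "\<dots> = (\<Sum>\<alpha>\<in>B. c \<alpha> * lookup (v \<alpha>) m)"
      using B by (intro sum.mono_neutral_left) (auto simp: A_def)
    finally have s: "lookup ?s m = (\<Sum>\<alpha>\<in>B. c \<alpha> * lookup (v \<alpha>) m)" .
    have "lookup ?s m = 0" if mF: "keys m \<subseteq> F"
    proof (cases "m \<in> T")
      case True then show ?thesis using s c by simp
    next
      case False
      then obtain i where "lookup m i > D" using mF by (auto simp: T_def not_le)
      then have "m \<notin> keys (v \<alpha>)" if "\<alpha> \<in> B" for \<alpha>
        using bound[of fs \<alpha> m i] that by (auto simp: B_def D_def v_def)
      then show ?thesis unfolding s by (intro sum.neutral) (auto simp: in_keys_iff)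
    qed
    then show "lookup (restr (\<lambda>m. keys m \<subseteq> F) ?s) m = lookup 0 m"
      by (simp add: lookup_restr)
  qed
  ultimately have "?s \<in> sr_ideal n (Pow F)" by (simp add: sr_ideal_Pow_iff)
  moreover have "A \<noteq> {}" "finite A" using c(1) B by (auto simp: A_def)
  ultimately show ?thesis
    by (intro exI[of _ A] exI[of _ c]) (auto simp: A_def B_def v_def)
qed

lemma const_unit:
  assumes "c \<noteq> (0::'k::field)"
  shows "(single 0 c :: 'k mpoly) \<in> polys n \<and>
    (\<exists>b\<in>polys n. b * (single 0 c :: 'k mpoly) = 1)"
proof -
  have "(single 0 (inverse c) :: 'k mpoly) * single 0 c = 1"
    using assms by (simp add: mult_single)
  then show ?thesis using single_in_polys[of 0 n] by (metis empty_subsetI keys_zero)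
qed

section \<open>Depth\<close>

lemma graded_maximal_ideal_eq: "(graded_maximal_ideal n :: 'k::field mpoly set) = sr_ideal n {{}}"
proof -
  have "(\<exists>g\<in>{single i 1 | i. i \<in> {1..n}}. \<exists>k. m = g + k) \<longleftrightarrow> keys m \<noteq> {}"
    if "keys m \<subseteq> {1..n}" for m :: "nat \<Rightarrow>\<^sub>0 nat"
  proof -
    have "{single i (1::nat) | i. i \<in> {1..n}} = (\<lambda>i. sqf_monom {i}) ` {1..n}"
      by (auto simp: sqf_monom_def)
    then have "(\<exists>g\<in>{single i 1 | i. i \<in> {1..n}}. \<exists>k. m = g + k) \<longleftrightarrow>
      (\<exists>i\<in>{1..n}. \<exists>k. m = sqf_monom {i} + k)" by simp
    also have "\<dots> \<longleftrightarrow> (\<exists>i\<in>{1..n}. i \<in> keys m)" by (simp add: sqf_monom_dvd_iff)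
    also have "\<dots> \<longleftrightarrow> keys m \<noteq> {}" using that by blast
    finally show ?thesis .
  qed
  then show ?thesis unfolding graded_maximal_ideal_def
    by (subst monomial_ideal_eq) (auto simp: sr_ideal_def polys_def)
qed

context subring_set
begin

lemma foldl_adj_least: "idl B \<Longrightarrow> I \<subseteq> B \<Longrightarrow> set rs \<subseteq> B \<Longrightarrow> foldl adj I rs \<subseteq> B"
proof (induction rs arbitrary: I)
  case (Cons r rs)
  then show ?case using Cons.IH[of "adj I r"] adj_least[of B I r] by simp
qed simp

end

text \<open>The powers \<open>r ^ Suc (card F)\<close> of the members of a regular sequence are again regular, and
  dependent modulo the prime \<open>sr_ideal n (Pow F)\<close>, the annihilator of \<open>sqf F\<close>, if there are more
  than \<open>card F\<close> of them. Peeling yields that \<open>sqf F\<close> is in the ideal generated by these powers, which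
  is impossible for degree reasons.\<close>

lemma length_regular_le:
  fixes rs :: "'k::field mpoly list"
  assumes D: "down_closed D" "F \<in> D" "F \<subseteq> {1..n}"
    and ann: "\<And>i. i \<in> {1..n} \<Longrightarrow> i \<notin> F \<Longrightarrow> insert i F \<notin> D"
    and rs: "set rs \<subseteq> graded_maximal_ideal n" "pr.wreg n (sr_ideal n D) rs"
  shows "length rs \<le> card F"
proof (rule ccontr)
  assume len: "\<not> length rs \<le> card F"
  have fin: "finite F" using D(3) by (rule finite_subset) simp
  let ?I = "sr_ideal n D :: 'k mpoly set"
  define fs where "fs = map (\<lambda>r. r ^ Suc (card F)) rs"
  have idl: "pr.idl n ?I" using D by (simp add: sr_ideal_idl)
  have rsP: "set rs \<subseteq> polys n" using rs(1) by (auto simp: graded_maximal_ideal_eq sr_ideal_def)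
  then have fsP: "set fs \<subseteq> polys n" by (auto simp: fs_def simp del: power_Suc)
  have reg: "pr.wreg n ?I fs" unfolding fs_def by (rule pr.wreg_powers[OF idl rsP rs(2)])
  obtain A c where Ac: "finite A" "A \<noteq> {}" "\<And>\<alpha>. \<alpha> \<in> A \<Longrightarrow> length \<alpha> = length fs \<and> c \<alpha> \<noteq> 0"
    "(\<Sum>\<alpha>\<in>A. single 0 (c \<alpha>) * prod_list (map2 (^) fs \<alpha>)) \<in> sr_ideal n (Pow F)" (is "?s \<in> _")
    using algebraically_dependent[OF fsP fin] len by (auto simp: fs_def)
  \<comment> \<open>Each monomial of the relation has a variable outside \<open>F\<close>, and
    \<open>F\<close> is a facet: multiplied by \<open>sqf F\<close> the relation falls into the
    ideal of \<open>D\<close>.\<close>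
  have "keys m \<union> F \<notin> D" if "m \<in> keys ?s" for m
  proof
    assume mD: "keys m \<union> F \<in> D"
    have "\<not> keys m \<subseteq> F" "keys m \<subseteq> {1..n}"
      using Ac(4) that by (auto simp: sr_ideal_def polys_def)
    then obtain i where "i \<in> keys m" "i \<notin> F" "i \<in> {1..n}" by blast
    then show False using ann down_closedD[OF D(1) mD, of "insert i F"] by auto
  qed
  then have "sqf F * ?s \<in> ?I"
  proof -
    have "?s \<in> polys n" using Ac(4) by (simp add: sr_ideal_def)
    then have "sqf F * ?s \<in> polys n" using sqf_in_polys[OF D(3)] by blast
    then show ?thesis
      using \<open>\<And>m. m \<in> keys ?s \<Longrightarrow> keys m \<union> F \<notin> D\<close>
      by (auto simp: sr_ideal_def keys_sqf_mult keys_add_nat fin Un_commute)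
  qed
  then have in0: "?s * sqf F \<in> foldl (pr.adj n) ?I (take 0 fs)" by (simp add: mult.commute)
  have "sqf F \<in> foldl (pr.adj n) ?I (take (length fs) fs)"
  proof (rule pr.lex_peel[where A = A and c = "\<lambda>\<alpha>. single 0 (c \<alpha>)"])
    show "pr.idl n (foldl (pr.adj n) ?I (take i fs))" for i
      using fsP by (intro pr.idl_foldl_adj idl) (auto dest: in_set_takeD)
    show "fs ! i \<in> polys n \<and> pr.nzd n (foldl (pr.adj n) ?I (take i fs)) (fs ! i) \<and>
        pr.adj n (foldl (pr.adj n) ?I (take i fs)) (fs ! i) \<subseteq> foldl (pr.adj n) ?I (take (Suc i) fs)"
      if "i < length fs" for i
      using reg fsP that by (auto simp: pr.wreg_iff_nth take_Suc_conv_app_nth)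
    show "sqf F \<in> polys n" using D(3) by (rule sqf_in_polys)
  qed (use Ac const_unit in0 in auto)
  then have sqf_in: "sqf F \<in> foldl (pr.adj n) ?I fs" by simp
  define deg where "deg m = (\<Sum>i=1..n. lookup m i)" for m :: "nat \<Rightarrow>\<^sub>0 nat"
  have deg_add: "deg (a + b) = deg a + deg b" for a b
    by (simp add: deg_def lookup_add sum.distrib)
  \<comment> \<open>An ideal that contains the ideal of \<open>D\<close> and all polynomials whose
    monomials have degree above \<open>card F\<close>, in particular the members of
    \<open>fs\<close>; this explains the exponent \<open>Suc (card F)\<close>. It misses
    \<open>sqf F\<close>, a monomial on a face of degree exactly \<open>card F\<close>.\<close>
  define Z where "Z = {p :: 'k mpoly. p \<in> polys n \<and>
    (\<forall>m\<in>keys p. keys m \<notin> D \<or> card F < deg m)}"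
  have Z: "pr.idl n Z"
    unfolding pr.idl_def
  proof (intro conjI ballI)
    fix p q :: "'k mpoly"
    show "p \<in> Z \<Longrightarrow> q \<in> Z \<Longrightarrow> p + q \<in> Z"
      using keys_add[of p q] by (auto simp: Z_def)
    assume p: "p \<in> polys n" and q: "q \<in> Z"
    have "keys m \<notin> D \<or> card F < deg m" if m: "m \<in> keys (p * q)" for m
    proof -
      obtain a b where ab: "m = a + b" "b \<in> keys q" using m by (rule keys_multE)
      then have "keys b \<notin> D \<or> card F < deg b" using q by (auto simp: Z_def)
      then show ?thesis
        using ab down_closedD[OF D(1), of "keys m" "keys b"]
        by (auto simp: keys_add_nat deg_add)
    qed
    then show "p * q \<in> Z" using p q by (auto simp: Z_def)
  qed (auto simp: Z_def)
  have "r ^ Suc (card F) \<in> Z" if "r \<in> set rs" for r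
  proof -
    have r: "r \<in> sr_ideal n {{}}" using rs(1) that by (auto simp: graded_maximal_ideal_eq)
    have d1: "1 \<le> deg m" if m: "m \<in> keys r" for m
    proof -
      have "keys m \<noteq> {}" "keys m \<subseteq> {1..n}"
        using r m by (auto simp: sr_ideal_def polys_def)
      then obtain i where "i \<in> keys m" "i \<in> {1..n}" by blast
      then have "1 \<le> lookup m i" "lookup m i \<le> deg m"
        unfolding deg_def by (auto simp: in_keys_iff Suc_le_eq intro!: member_le_sum)
      then show ?thesis by linarith
    qed
    have "k \<le> deg m" if "m \<in> keys (r ^ k)" for k m
      using that
    proof (induction k arbitrary: m)
      case (Suc k)
      then have "m \<in> keys (r * r ^ k)" by simp
      then obtain a b where "m = a + b" "a \<in> keys r" "b \<in> keys (r ^ k)"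
        by (rule keys_multE)
      then show ?case using d1[of a] Suc.IH[of b] by (simp add: deg_add)
    qed simp
    then have "card F < deg m" if "m \<in> keys (r ^ Suc (card F))" for m
      using that by (meson Suc_le_lessD)
    moreover have "r ^ Suc (card F) \<in> polys n" using rsP that by blast
    ultimately show ?thesis by (auto simp: Z_def simp del: power_Suc)
  qed
  then have "foldl (pr.adj n) ?I fs \<subseteq> Z"
    by (intro pr.foldl_adj_least Z) (auto simp: fs_def sr_ideal_def Z_def simp del: power_Suc)
  then have "sqf F \<in> Z" using sqf_in by blast
  then have "F \<notin> D \<or> card F < deg (sqf_monom F)"
    using fin by (auto simp: Z_def sqf_def monom_poly_def)
  moreover have "deg (sqf_monom F) = card F"
  proof -
    have "deg (sqf_monom F) = (\<Sum>i\<in>F. 1)"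
      unfolding deg_def using fin D(3) by (intro sum.mono_neutral_cong_right) (auto simp: lookup_sqf_monom)
    then show ?thesis by simp
  qed
  ultimately show False using D(2) by simp
qed

lemma hsym_in_graded_maximal_ideal:
  assumes "set xs \<subseteq> {1..n}"
  shows "hsym xs (Suc i) \<in> (graded_maximal_ideal n :: 'k::field mpoly set)"
proof -
  have idl: "pr.idl n (sr_ideal n {{}} :: 'k mpoly set)" by (simp add: sr_ideal_idl down_closed_def)
  have "hsym xs j \<in> (sr_ideal n {{}} :: 'k mpoly set)" if "j > 0" for j
    using assms that
  proof (induction xs j rule: hsym.induct)
    case (2 i) then show ?case using pr.idlD(2)[OF idl] by simp
  next
    case (3 x xs i)
    have "keys (single x (1::nat)) \<noteq> {}" by simp
    then have "(var x :: 'k mpoly) \<in> sr_ideal n {{}}"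
      unfolding var_def using 3 by (intro single_in_sr_ideal) auto
    moreover have "(hsym (x # xs) i :: 'k mpoly) \<in> polys n" by (rule hsym_in_polys) (use 3 in auto)
    ultimately have "var x * hsym (x # xs) i \<in> (sr_ideal n {{}} :: 'k mpoly set)"
      using pr.idlD(5)[OF idl] by blast
    then show ?case using pr.idlD(3)[OF idl "3.IH"(1)] 3 by simp
  qed simp
  then show ?thesis by (simp add: graded_maximal_ideal_eq)
qed

lemma depth_sr_ideal:
  assumes "interval_filt 1 n e D" "{} \<in> D" "F \<in> D" "F \<subseteq> {1..n}" "card F = e"
    and "\<And>i. i \<in> {1..n} \<Longrightarrow> i \<notin> F \<Longrightarrow> insert i F \<notin> D"
  shows "depth (poly_ring_vars n) (graded_maximal_ideal n)
    (quotient_module (poly_ring_vars n) (sr_ideal n D :: 'k::field mpoly set)) = enat e"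
proof -
  let ?I = "sr_ideal n D :: 'k mpoly set"
  have D: "down_closed D" using assms(1) by (rule interval_filt_down_closed)
  have idl: "pr.idl n ?I" using D by (rule sr_ideal_idl)
  let ?hs = "map (hsym [1..<Suc n]) [1..<Suc e] :: 'k mpoly list"
  have hs_max: "set ?hs \<subseteq> graded_maximal_ideal n"
  proof -
    have "hsym [1..<Suc n] i \<in> (graded_maximal_ideal n :: 'k mpoly set)" if "i \<ge> 1" for i
    proof -
      have "set [1..<Suc n] \<subseteq> {1..n}" "Suc (i - 1) = i" using that by auto
      then show ?thesis using hsym_in_graded_maximal_ideal[of "[1..<Suc n]" n "i - 1"] by simp
    qed
    then show ?thesis by (auto simp del: upt_Suc)
  qed
  have max: "pr.idl n (graded_maximal_ideal n :: 'k mpoly set)" "(1 :: 'k mpoly) \<notin> graded_maximal_ideal n"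
  proof -
    show "pr.idl n (graded_maximal_ideal n :: 'k mpoly set)"
      unfolding graded_maximal_ideal_eq by (rule sr_ideal_idl) (simp add: down_closed_def)
    show "(1 :: 'k mpoly) \<notin> graded_maximal_ideal n"
      unfolding graded_maximal_ideal_eq by (simp add: sr_ideal_def)
  qed
  have "regular_sequence (pr.RR n) (quotient_module (pr.RR n) ?I) ?hs"
    unfolding pr.regular_sequence_quotient_iff[OF idl]
  proof (intro conjI)
    show "set ?hs \<subseteq> polys n" using hs_max pr.idlD(1)[OF max(1)] by blast
    show "pr.wreg n ?I ?hs" by (rule wreg_hsym_interval_filt[OF assms(1)])
    have "?I \<subseteq> graded_maximal_ideal n"
      using assms(2) unfolding graded_maximal_ideal_eq by (intro sr_ideal_mono) auto
    then have "foldl (pr.adj n) ?I ?hs \<subseteq> graded_maximal_ideal n"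
      using hs_max max by (intro pr.foldl_adj_least) auto
    then show "foldl (pr.adj n) ?I ?hs \<noteq> polys n" using max(2) by (metis pr.one_mem subsetD)
  qed
  moreover have "length rs \<le> e"
    if "set rs \<subseteq> graded_maximal_ideal n" "regular_sequence (pr.RR n) (quotient_module (pr.RR n) ?I) rs" for rs
    using length_regular_le[OF D assms(3,4,6) that(1)] that(2) assms(5)
    unfolding pr.regular_sequence_quotient_iff[OF idl] by simp
  ultimately show ?thesis
    unfolding depth_def poly_ring_vars_eq using hs_max
    by (intro antisym Sup_least Sup_upper) (auto simp del: upt_Suc intro!: exI[of _ ?hs])
qed

section \<open>Chains of prime ideals\<close>

lemma sqf_insert: "finite F \<Longrightarrow> i \<notin> F \<Longrightarrow> sqf (insert i F) = var i * sqf F"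
  by (simp add: sqf_def var_def monom_poly_def mult_single sqf_monom_def)

lemma sqf_notin_prim:
  assumes "pr.prim n P" "F \<subseteq> {1..n}" "\<And>i. i \<in> F \<Longrightarrow> var i \<notin> P"
  shows "sqf F \<notin> P"
proof -
  have "finite F" using assms(2) by (rule finite_subset) simp
  then show ?thesis using assms(2,3)
  proof (induction F rule: finite_induct)
    case empty
    have "(1 :: 'a mpoly) \<notin> P"
    proof
      assume "1 \<in> P"
      then have "polys n \<subseteq> P" using assms(1) pr.idlD(4)[of n P _ 1] by (auto simp: pr.prim_def)
      then show False using assms(1) pr.idlD(1)[of n P] by (auto simp: pr.prim_def)
    qed
    then show ?case by (simp add: sqf_def sqf_monom_def monom_poly_def)
  next
    case (insert i F)
    have "var i * sqf F \<notin> P"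
      using insert assms(1) sqf_in_polys[of F n] unfolding pr.prim_def by blast
    then show ?case using insert.hyps by (simp add: sqf_insert)
  qed
qed

text \<open>An element of \<open>p (Suc i)\<close> outside \<open>p i\<close> is a nonzerodivisor
  modulo the prime \<open>p i\<close>. More than \<open>card F\<close> such elements satisfy a
  relation modulo \<open>p 0\<close>; peeling it with \<open>u = 1\<close> climbs the chain until 1
  lies in \<open>p l\<close>.\<close>

lemma prime_chain_length:
  fixes p :: "nat \<Rightarrow> 'k::field mpoly set"
  assumes "\<And>i. i \<le> l \<Longrightarrow> pr.prim n (p i)" "\<And>i. i < l \<Longrightarrow> p i \<subset> p (Suc i)"
    and "sr_ideal n (Pow F) \<subseteq> p 0" "finite F"
  shows "l \<le> card F"
proof (rule ccontr)
  assume l: "\<not> l \<le> card F"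
  have "\<exists>f. f \<in> p (Suc i) \<and> f \<notin> p i" if "i < l" for i using assms(2)[OF that] by auto
  then obtain f where f: "\<And>i. i < l \<Longrightarrow> f i \<in> p (Suc i) \<and> f i \<notin> p i" by metis
  have idl: "pr.idl n (p i)" if "i \<le> l" for i using assms(1)[OF that] by (simp add: pr.prim_def)
  have fP: "f i \<in> polys n" if "i < l" for i using f[OF that] idl[of "Suc i"] that pr.idlD(1) by fastforce
  define fs where "fs = map f [0..<l]"
  have len: "length fs = l" "\<And>i. i < l \<Longrightarrow> fs ! i = f i" by (auto simp: fs_def)
  have "set fs \<subseteq> polys n" using fP by (auto simp: fs_def)
  obtain A c where Ac: "finite A" "A \<noteq> {}" "\<And>\<alpha>. \<alpha> \<in> A \<Longrightarrow> length \<alpha> = length fs \<and> c \<alpha> \<noteq> 0"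
    "(\<Sum>\<alpha>\<in>A. single 0 (c \<alpha>) * prod_list (map2 (^) fs \<alpha>)) \<in> sr_ideal n (Pow F)"
    using algebraically_dependent[OF \<open>set fs \<subseteq> polys n\<close> assms(4)] l len by (simp add: not_le) blast
  have "1 \<in> p (length fs)"
  proof (rule pr.lex_peel[where A = A and c = "\<lambda>\<alpha>. single 0 (c \<alpha>)"])
    show "pr.idl n (p i)" if "i \<le> length fs" for i using idl that len by simp
    show "fs ! i \<in> polys n \<and> pr.nzd n (p i) (fs ! i) \<and> pr.adj n (p i) (fs ! i) \<subseteq> p (Suc i)"
      if "i < length fs" for i
    proof -
      have i: "i < l" using that len by simp
      have "pr.nzd n (p i) (f i)"
        using assms(1)[of i] i f[OF i] fP[OF i] unfolding pr.prim_def pr.nzd_def by auto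
      moreover have "pr.adj n (p i) (f i) \<subseteq> p (Suc i)"
        using idl[of "Suc i"] assms(2)[OF i] f[OF i] i by (intro pr.adj_least) auto
      ultimately show ?thesis using fP len i by simp
    qed
    show "(\<Sum>\<alpha>\<in>A. single 0 (c \<alpha>) * prod_list (map2 (^) fs \<alpha>)) * 1 \<in> p 0"
      using Ac(4) assms(3) by auto
  qed (use Ac const_unit in auto)
  then have "sqf {} \<in> p l" using len by (simp add: sqf_def sqf_monom_def monom_poly_def)
  then show False using sqf_notin_prim[of n "p l" "{}"] assms(1) by auto
qed

lemma krull_dim_sr_ideal:
  assumes "down_closed D" "D \<subseteq> Pow {1..n}" "{Suc j..n} \<in> D" "\<And>G. G \<in> D \<Longrightarrow> card G \<le> n - j"
  shows "krull_dim (poly_ring_vars n Quot (sr_ideal n D :: 'k::field mpoly set)) = enat (n - j)"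
proof -
  let ?I = "sr_ideal n D :: 'k mpoly set"
  have idl: "pr.idl n ?I" using assms(1) by (rule sr_ideal_idl)
  have up: "l \<le> n - j" if p: "\<forall>i\<le>l. pr.prim n (p i) \<and> ?I \<subseteq> p i" "\<forall>i<l. p i \<subset> p (Suc i)" for p l
  proof -
    \<comment> \<open>The variables outside the smallest prime \<open>p 0\<close>. Their product is
      not in \<open>p 0\<close>, so \<open>F\<close> is a face; all other variables are in
      \<open>p 0\<close>, so \<open>p 0\<close> contains the prime ideal of the simplex on
      \<open>F\<close>.\<close>
    define F where "F = {i \<in> {1..n}. var i \<notin> p 0}"
    have fin: "finite F" by (simp add: F_def)
    have p0: "pr.prim n (p 0)" "?I \<subseteq> p 0" using p by auto
    then have idl0: "pr.idl n (p 0)" by (simp add: pr.prim_def)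
    have "sqf F \<notin> p 0" by (rule sqf_notin_prim[OF p0(1)]) (auto simp: F_def)
    then have "sqf F \<notin> ?I" using p0 by blast
    moreover have Fn: "F \<subseteq> {1..n}" by (auto simp: F_def)
    ultimately have "F \<in> D"
      using fin single_in_sr_ideal[of "sqf_monom F" n D 1] by (auto simp: sqf_def monom_poly_def)
    moreover have "sr_ideal n (Pow F) \<subseteq> p 0"
    proof
      fix q :: "'k mpoly" assume q: "q \<in> sr_ideal n (Pow F)"
      show "q \<in> p 0"
      proof (rule idl_monomsI[OF idl0])
        fix m assume "m \<in> keys q"
        then have m: "\<not> keys m \<subseteq> F" "keys m \<subseteq> {1..n}"
          using q by (auto simp: sr_ideal_def polys_def)
        then obtain i where i: "i \<in> keys m" "var i \<in> p 0" by (auto simp: F_def)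
        have "single m (lookup q m) =
          var i * single (m - sqf_monom {i}) (lookup q m)"
          using sqf_dvd_single[of "{i}" m] i by (simp add: sqf_singleton)
        moreover have "keys (m - sqf_monom {i}) \<subseteq> {1..n}"
          using m(2) by (auto simp: in_keys_iff lookup_minus)
        ultimately show "single m (lookup q m) \<in> p 0"
          using pr.idlD(5)[OF idl0 single_in_polys i(2)] by metis
      qed
    qed
    then have "l \<le> card F" using p fin by (intro prime_chain_length[of l n p F]) auto
    ultimately show ?thesis using assms(4) by (meson order_trans)
  qed
  \<comment> \<open>Starting from the prime of the face \<open>{Suc j..n}\<close>, its variables are
    killed one by one; for \<open>i = n - j\<close> the empty face is reached.\<close>
  define P where "P i = (sr_ideal n (Pow {Suc j + i..n}) :: 'k mpoly set)" for i
  have "pr.prim n (P i)" for i unfolding P_def by (rule sr_ideal_Pow_prim)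
  moreover have "?I \<subseteq> P i" for i
  proof -
    have "{Suc j + i..n} \<subseteq> {Suc j..n}" by auto
    then have "Pow {Suc j + i..n} \<subseteq> D" using down_closedD[OF assms(1,3)] by blast
    then show ?thesis unfolding P_def by (rule sr_ideal_mono)
  qed
  moreover have "P i \<subset> P (Suc i)" if "i < n - j" for i
  proof
    show "P i \<subseteq> P (Suc i)" unfolding P_def by (intro sr_ideal_mono) auto
    have "(var (Suc j + i) :: 'k mpoly) \<in> P (Suc i)" "(var (Suc j + i) :: 'k mpoly) \<notin> P i"
      using that by (auto simp: P_def sr_ideal_def)
    then show "P i \<noteq> P (Suc i)" by blast
  qed
  ultimately have "\<exists>p. (\<forall>i\<le>n - j. pr.prim n (p i) \<and> ?I \<subseteq> p i) \<and> (\<forall>i<n - j. p i \<subset> p (Suc i))"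
    by (intro exI[of _ P]) auto
  then show ?thesis
    unfolding poly_ring_vars_eq pr.krull_dim_quotient[OF idl] using up
    by (intro antisym Sup_least Sup_upper) auto
qed

section \<open>Finite free resolutions\<close>

context subring_set
begin

definition smul :: "'a \<Rightarrow> ('i \<Rightarrow> 'a) \<Rightarrow> 'i \<Rightarrow> 'a" where
  "smul r f = (\<lambda>i. r * f i)"

definition submod :: "('i \<Rightarrow> 'a) set \<Rightarrow> bool" where
  "submod N \<longleftrightarrow> 0 \<in> N \<and> (\<forall>x\<in>N. \<forall>y\<in>N. x + y \<in> N) \<and> (\<forall>r\<in>C. \<forall>x\<in>N. smul r x \<in> N)"

lemma smul_simps:
  "smul r (f + g) = smul r f + smul r g" "smul (r + s) f = smul r f + smul s f"
  "smul r (f - g) = smul r f - smul r g" "smul (r - s) f = smul r f - smul s f"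
  "smul (r * s) f = smul r (smul s f)" "smul 1 f = f" "smul 0 f = 0" "smul r 0 = 0"
  by (auto simp: smul_def fun_eq_iff algebra_simps)

lemma smul_apply: "smul r f i = r * f i"
  by (simp add: smul_def)

lemma submodD:
  assumes "submod N"
  shows "0 \<in> N" "x \<in> N \<Longrightarrow> y \<in> N \<Longrightarrow> x + y \<in> N" "r \<in> C \<Longrightarrow> x \<in> N \<Longrightarrow> smul r x \<in> N"
    "x \<in> N \<Longrightarrow> - x \<in> N" "x \<in> N \<Longrightarrow> y \<in> N \<Longrightarrow> x - y \<in> N"
proof -
  show add: "x \<in> N \<Longrightarrow> y \<in> N \<Longrightarrow> x + y \<in> N" for x y using assms by (auto simp: submod_def)
  have "- x = smul (- 1) x" for x :: "'b \<Rightarrow> 'a" by (simp add: smul_def fun_eq_iff)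
  then show neg: "x \<in> N \<Longrightarrow> - x \<in> N" for x using assms by (auto simp: submod_def)
  show "x \<in> N \<Longrightarrow> y \<in> N \<Longrightarrow> x - y \<in> N" using add[of x "- y"] neg by simp
qed (use assms in \<open>auto simp: submod_def\<close>)

lemma submod_diff_iff: "submod N \<Longrightarrow> x - y \<in> N \<Longrightarrow> x \<in> N \<longleftrightarrow> y \<in> N"
  using submodD(2)[of N "x - y" y] submodD(5)[of N x "x - y"] by auto

text \<open>The free module of rank \<open>q\<close>, in one type for all ranks. Syzygies of
  syzygies then have the same type again, which allows \<open>has_resolution\<close> to be
  recursive.\<close>

definition free_vecs :: "nat \<Rightarrow> (nat \<Rightarrow> 'a) set" where
  "free_vecs q = {f. (\<forall>i. f i \<in> C) \<and> (\<forall>i\<ge>q. f i = 0)}"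

lemma submod_free_vecs: "submod (free_vecs q)"
  by (auto simp: submod_def free_vecs_def smul_def)

definition lin_comb :: "nat \<Rightarrow> (nat \<Rightarrow> 'i \<Rightarrow> 'a) \<Rightarrow> (nat \<Rightarrow> 'a) \<Rightarrow> 'i \<Rightarrow> 'a" where
  "lin_comb q F a = (\<Sum>i<q. smul (a i) (F i))"

lemma lin_comb_Suc: "lin_comb (Suc q) F a = lin_comb q F a + smul (a q) (F q)"
  by (simp add: lin_comb_def)

lemma lin_comb_0 [simp]: "lin_comb 0 F a = 0"
  by (simp add: lin_comb_def)

lemma lin_comb_add: "lin_comb q F (a + b) = lin_comb q F a + lin_comb q F b"
  by (simp add: lin_comb_def smul_simps sum.distrib)

lemma lin_comb_smul: "lin_comb q F (smul r a) = smul r (lin_comb q F a)"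
  by (induction q) (auto simp: lin_comb_Suc fun_eq_iff smul_def algebra_simps)

lemma lin_comb_diff_right: "lin_comb q (\<lambda>i. F i - G i) a = lin_comb q F a - lin_comb q G a"
  by (simp add: lin_comb_def smul_simps sum_subtractf)

lemma lin_comb_zero [simp]: "lin_comb q F 0 = 0"
  by (simp add: lin_comb_def smul_simps)

lemma lin_comb_in:
  assumes "submod N" "\<And>i. i < q \<Longrightarrow> F i \<in> N" "\<And>i. a i \<in> C"
  shows "lin_comb q F a \<in> N"
  using assms(2)
proof (induction q)
  case (Suc q)
  then show ?case unfolding lin_comb_Suc using assms by (intro submodD(2,3)[OF assms(1)]) auto
qed (use submodD(1)[OF assms(1)] in simp)

text \<open>The kernel of the map from the free module of rank \<open>q\<close> to a quotient by
  \<open>A\<close>; working modulo \<open>A\<close> avoids quotient types.\<close>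

definition syz :: "('i \<Rightarrow> 'a) set \<Rightarrow> nat \<Rightarrow> (nat \<Rightarrow> 'i \<Rightarrow> 'a) \<Rightarrow> (nat \<Rightarrow> 'a) set" where
  "syz A q F = {a \<in> free_vecs q. lin_comb q F a \<in> A}"

lemma free_vecsD: "a \<in> free_vecs q \<Longrightarrow> a i \<in> C" "a \<in> free_vecs q \<Longrightarrow> i \<ge> q \<Longrightarrow> a i = 0"
  by (auto simp: free_vecs_def)

lemma submod_syz: "submod A \<Longrightarrow> submod (syz A q F)"
  unfolding submod_def[of "syz A q F"]
  using submodD[OF submod_free_vecs[of q]] submodD[of A]
  by (auto simp: syz_def lin_comb_add lin_comb_smul)

definition gens :: "('i \<Rightarrow> 'a) set \<Rightarrow> ('i \<Rightarrow> 'a) set \<Rightarrow> nat \<Rightarrow> (nat \<Rightarrow> 'i \<Rightarrow> 'a) \<Rightarrow> bool" where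
  "gens B A q F \<longleftrightarrow> (\<forall>i<q. F i \<in> B) \<and> (\<forall>b\<in>B. \<exists>a\<in>free_vecs q. b - lin_comb q F a \<in> A)"

text \<open>\<open>has_resolution k B A\<close> says that \<open>B / A\<close> has a resolution of length at most \<open>k\<close> by free modules
  of finite rank.\<close>

fun has_resolution :: "nat \<Rightarrow> (nat \<Rightarrow> 'a) set \<Rightarrow> (nat \<Rightarrow> 'a) set \<Rightarrow> bool" where
  "has_resolution 0 B A \<longleftrightarrow> (\<exists>q F. gens B A q F \<and> syz A q F = {0})"
| "has_resolution (Suc k) B A \<longleftrightarrow> (\<exists>q F. gens B A q F \<and> has_resolution k (syz A q F) {0})"

lemma free_vecs_0 [simp]: "free_vecs 0 = {0}"
  by (auto simp: free_vecs_def fun_eq_iff)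

lemma submod_zero: "submod {0}"
  by (auto simp: submod_def smul_simps)

lemma gens_empty: "submod A \<Longrightarrow> gens A A 0 F \<and> syz A 0 F = {0}"
  using submodD(1)[of A] by (auto simp: gens_def syz_def)

lemma has_resolution_trivial:
  assumes "submod A" shows "has_resolution k A A"
  using assms
proof (induction k arbitrary: A)
  case 0
  then show ?case using gens_empty by (metis has_resolution.simps(1))
next
  case (Suc k)
  then show ?case using gens_empty[OF Suc.prems] Suc.IH[OF submod_zero] by (metis has_resolution.simps(2))
qed

lemma has_resolution_Suc:
  assumes "has_resolution k B A" shows "has_resolution (Suc k) B A"
  using assms
proof (induction k arbitrary: B A)
  case 0
  then obtain q F where "gens B A q F" "syz A q F = {0}" by auto
  then show ?case
    using has_resolution_trivial[OF submod_zero, of 0] by (metis has_resolution.simps(2))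
next
  case (Suc k)
  then show ?case using has_resolution.simps(2) by metis
qed

lemma has_resolution_mono: "has_resolution k B A \<Longrightarrow> k \<le> l \<Longrightarrow> has_resolution l B A"
  by (induction l) (auto simp: le_Suc_eq simp del: has_resolution.simps intro: has_resolution_Suc)

section \<open>Isomorphic quotients and exact sequences\<close>

definition linear_on :: "('i \<Rightarrow> 'a) set \<Rightarrow> (('i \<Rightarrow> 'a) \<Rightarrow> 'j \<Rightarrow> 'a) \<Rightarrow> bool" where
  "linear_on B \<phi> \<longleftrightarrow> (\<forall>x\<in>B. \<forall>y\<in>B. \<phi> (x + y) = \<phi> x + \<phi> y) \<and> (\<forall>r\<in>C. \<forall>x\<in>B. \<phi> (smul r x) = smul r (\<phi> x))"

lemma linear_on_zero: "linear_on B \<phi> \<Longrightarrow> submod B \<Longrightarrow> \<phi> 0 = 0"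
  using submodD(1)[of B] unfolding linear_on_def by (metis add_cancel_right_right)

lemma linear_on_diff:
  assumes "linear_on B \<phi>" "submod B" "x \<in> B" "y \<in> B" shows "\<phi> (x - y) = \<phi> x - \<phi> y"
proof -
  have "\<phi> ((x - y) + y) = \<phi> (x - y) + \<phi> y"
    using assms submodD(5)[OF assms(2,3,4)] unfolding linear_on_def by blast
  then show ?thesis by simp
qed

lemma linear_on_lin_comb:
  assumes "linear_on B \<phi>" "submod B" "\<And>i. i < q \<Longrightarrow> F i \<in> B" "\<And>i. a i \<in> C"
  shows "\<phi> (lin_comb q F a) = lin_comb q (\<lambda>i. \<phi> (F i)) a"
  using assms(3)
proof (induction q)
  case 0
  show ?case by (simp only: lin_comb_0 linear_on_zero[OF assms(1,2)])
next
  case (Suc q)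
  have "lin_comb q F a \<in> B" "smul (a q) (F q) \<in> B"
    using Suc assms lin_comb_in[OF assms(2)] submodD(3)[OF assms(2)] by auto
  then have "\<phi> (lin_comb (Suc q) F a) = \<phi> (lin_comb q F a) + \<phi> (smul (a q) (F q))"
    unfolding lin_comb_Suc using assms(1) unfolding linear_on_def by blast
  moreover have "\<phi> (smul (a q) (F q)) = smul (a q) (\<phi> (F q))"
    using assms(1,4) Suc.prems[of q] unfolding linear_on_def by blast
  moreover have "\<phi> (lin_comb q F a) = lin_comb q (\<lambda>i. \<phi> (F i)) a" using Suc by simp
  ultimately show ?case by (simp only: lin_comb_Suc)
qed

text \<open>\<open>\<phi>\<close> induces an isomorphism from \<open>B/A\<close> to
  \<open>B'/A'\<close>. It is onto only modulo \<open>A'\<close>, and the last clause says both that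
  the induced map is well defined and that it is injective.\<close>

definition quot_iso :: "('i \<Rightarrow> 'a) set \<Rightarrow> ('i \<Rightarrow> 'a) set \<Rightarrow> ('j \<Rightarrow> 'a) set \<Rightarrow> ('j \<Rightarrow> 'a) set \<Rightarrow>
    (('i \<Rightarrow> 'a) \<Rightarrow> 'j \<Rightarrow> 'a) \<Rightarrow> bool" where
  "quot_iso B A B' A' \<phi> \<longleftrightarrow> submod B \<and> submod A \<and> submod B' \<and> submod A' \<and> A' \<subseteq> B' \<and> linear_on B \<phi> \<and>
    \<phi> ` B \<subseteq> B' \<and> (\<forall>b'\<in>B'. \<exists>b\<in>B. b' - \<phi> b \<in> A') \<and> (\<forall>b\<in>B. \<phi> b \<in> A' \<longleftrightarrow> b \<in> A)"

text \<open>\<open>F'\<close> has to agree with the image of \<open>F\<close> only modulo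
  \<open>A'\<close>, so generators can be pushed forward as well as lifted. The same coefficient
  vectors are syzygies on both sides.\<close>

lemma quot_iso_gens_syz:
  assumes iso: "quot_iso B A B' A' \<phi>"
    and F: "\<And>i. i < q \<Longrightarrow> F i \<in> B" "\<And>i. i < q \<Longrightarrow> F' i \<in> B'" "\<And>i. i < q \<Longrightarrow> F' i - \<phi> (F i) \<in> A'"
  shows "gens B A q F \<longleftrightarrow> gens B' A' q F'" "syz A q F = syz A' q F'"
proof -
  have s: "submod B" "submod A" "submod B'" "submod A'" "A' \<subseteq> B'" and lin: "linear_on B \<phi>" and im: "\<phi> ` B \<subseteq> B'"
    and onto: "\<And>b'. b' \<in> B' \<Longrightarrow> \<exists>b\<in>B. b' - \<phi> b \<in> A'" and inj: "\<And>b. b \<in> B \<Longrightarrow> \<phi> b \<in> A' \<longleftrightarrow> b \<in> A"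
    using iso by (auto simp: quot_iso_def)
  have lB: "lin_comb q F a \<in> B" if "a \<in> free_vecs q" for a
    using F s free_vecsD(1)[OF that] by (intro lin_comb_in) auto
  have cmp: "lin_comb q F' a - \<phi> (lin_comb q F a) \<in> A'" if "a \<in> free_vecs q" for a
  proof -
    have "lin_comb q (\<lambda>i. F' i - \<phi> (F i)) a \<in> A'"
      using F s free_vecsD(1)[OF that] by (intro lin_comb_in) auto
    then show ?thesis
      using linear_on_lin_comb[OF lin s(1) F(1) free_vecsD(1)[OF that]] by (simp add: lin_comb_diff_right)
  qed
  show "syz A q F = syz A' q F'"
    using submod_diff_iff[OF s(4) cmp] inj lB by (auto simp: syz_def)
  have key: "b' - lin_comb q F' a \<in> A' \<longleftrightarrow> b - lin_comb q F a \<in> A"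
    if "a \<in> free_vecs q" "b \<in> B" "b' - \<phi> b \<in> A'" for a b b'
  proof -
    have "(b' - lin_comb q F' a) - \<phi> (b - lin_comb q F a) =
      (b' - \<phi> b) - (lin_comb q F' a - \<phi> (lin_comb q F a))"
      using linear_on_diff[OF lin s(1) that(2) lB[OF that(1)]] by simp
    also have "\<dots> \<in> A'" using that(3) cmp[OF that(1)] by (rule submodD(5)[OF s(4)])
    finally have "b' - lin_comb q F' a \<in> A' \<longleftrightarrow> \<phi> (b - lin_comb q F a) \<in> A'"
      by (rule submod_diff_iff[OF s(4)])
    then show ?thesis using inj submodD(5)[OF s(1) that(2) lB[OF that(1)]] by simp
  qed
  show "gens B A q F \<longleftrightarrow> gens B' A' q F'"
  proof
    assume g: "gens B A q F"
    show "gens B' A' q F'" unfolding gens_def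
    proof (intro conjI ballI)
      fix b' assume "b' \<in> B'"
      then obtain b where b: "b \<in> B" "b' - \<phi> b \<in> A'" using onto by blast
      then obtain a where "a \<in> free_vecs q" "b - lin_comb q F a \<in> A" using g by (auto simp: gens_def)
      then show "\<exists>a\<in>free_vecs q. b' - lin_comb q F' a \<in> A'" using key b by blast
    qed (use F in auto)
  next
    assume g: "gens B' A' q F'"
    show "gens B A q F" unfolding gens_def
    proof (intro conjI ballI)
      fix b assume b: "b \<in> B"
      then have "\<phi> b \<in> B'" using im by blast
      then obtain a where "a \<in> free_vecs q" "\<phi> b - lin_comb q F' a \<in> A'"
        using g by (auto simp: gens_def)
      then show "\<exists>a\<in>free_vecs q. b - lin_comb q F a \<in> A"
        using key[of a b "\<phi> b"] b submodD(1)[OF s(4)] by auto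
    qed (use F in auto)
  qed
qed

lemma has_resolution_iso:
  assumes iso: "quot_iso B A B' A' \<phi>"
  shows "has_resolution k B A \<longleftrightarrow> has_resolution k B' A'"
proof -
  have "\<exists>F'. gens B' A' q F' \<and> syz A' q F' = syz A q F" if g: "gens B A q F" for q F
  proof -
    have "F i \<in> B" if "i < q" for i using g that by (auto simp: gens_def)
    moreover from this have "\<phi> (F i) \<in> B'" if "i < q" for i using iso that by (auto simp: quot_iso_def)
    moreover have "0 \<in> A'" using iso submodD(1) by (auto simp: quot_iso_def)
    ultimately show ?thesis
      using quot_iso_gens_syz[OF iso, of q F "\<lambda>i. \<phi> (F i)"] g by (intro exI[of _ "\<lambda>i. \<phi> (F i)"]) auto
  qed
  moreover have "\<exists>F. gens B A q F \<and> syz A q F = syz A' q F'" if g: "gens B' A' q F'" for q F'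
  proof -
    have F': "F' i \<in> B'" if "i < q" for i using g that by (auto simp: gens_def)
    then have "\<exists>b\<in>B. F' i - \<phi> b \<in> A'" if "i < q" for i using iso that by (auto simp: quot_iso_def)
    then obtain F where "\<And>i. i < q \<Longrightarrow> F i \<in> B \<and> F' i - \<phi> (F i) \<in> A'" by metis
    then show ?thesis using quot_iso_gens_syz[OF iso, of q F F'] g F' by (intro exI[of _ F]) auto
  qed
  ultimately show ?thesis by (cases k) (simp_all, metis+)
qed

text \<open>Generators \<open>G\<close> of \<open>B/A\<close> and \<open>F\<close> of
  \<open>D/B\<close> together generate \<open>D/A\<close>. Dropping the first \<open>p\<close>
  coordinates maps the syzygies of the union onto those of \<open>F\<close>, with kernel those of
  \<open>G\<close>, which is the same situation one degree up.\<close>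

lemma has_resolution_horseshoe:
  assumes "submod A" "submod B" "submod D" "A \<subseteq> B" "B \<subseteq> D"
    and "has_resolution k B A" "has_resolution k D B"
  shows "has_resolution k D A"
  using assms
proof (induction k arbitrary: A B D)
  have step: "\<exists>H. gens D A (p + q) H \<and> submod (syz A (p + q) H) \<and> syz A p G \<subseteq> syz A (p + q) H \<and>
      quot_iso (syz A (p + q) H) (syz A p G) (syz B q F) {0} (\<lambda>a i. a (p + i))"
    if s: "submod A" "submod B" "submod D" "A \<subseteq> B" "B \<subseteq> D"
      and G: "gens B A p G" and F: "gens D B q F" for A B D p G q F
  proof -
    define H where "H i = (if i < p then G i else F (i - p))" for i
    have lH: "lin_comb (p + q) H a = lin_comb p G a + lin_comb q F (\<lambda>i. a (p + i))" for a
    proof (induction q)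
      case 0
      show ?case by (simp add: lin_comb_def H_def)
    next
      case (Suc q)
      then show ?case by (simp add: lin_comb_Suc H_def add.assoc)
    qed
    define join where "join a b i = (if i < p then a i else b (i - p))" for a b :: "nat \<Rightarrow> 'a" and i
    have join: "join a b \<in> free_vecs (p + q)" "lin_comb (p + q) H (join a b) = lin_comb p G a + lin_comb q F b"
      if ab: "a \<in> free_vecs p" "b \<in> free_vecs q" for a b
    proof -
      show "join a b \<in> free_vecs (p + q)" using ab by (auto simp: free_vecs_def join_def)
      have "lin_comb p G (join a b) = lin_comb p G a" by (simp add: lin_comb_def join_def)
      then show "lin_comb (p + q) H (join a b) = lin_comb p G a + lin_comb q F b"
        unfolding lH by (simp add: join_def)
    qed
    have GB: "lin_comb p G a \<in> B" if "\<And>i. a i \<in> C" for a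
      using G s that by (intro lin_comb_in) (auto simp: gens_def)
    have g: "gens D A (p + q) H"
      unfolding gens_def
    proof (intro conjI allI impI ballI)
      show "H i \<in> D" if "i < p + q" for i using that G F s by (auto simp: H_def gens_def)
      fix d assume "d \<in> D"
      then obtain b where b: "b \<in> free_vecs q" "d - lin_comb q F b \<in> B" using F by (auto simp: gens_def)
      then obtain a where a: "a \<in> free_vecs p" "d - lin_comb q F b - lin_comb p G a \<in> A"
        using G by (auto simp: gens_def)
      then show "\<exists>a\<in>free_vecs (p + q). d - lin_comb (p + q) H a \<in> A"
        using join[OF a(1) b(1)] by (intro bexI[of _ "join a b"]) (auto simp: algebra_simps)
    qed
    have sub: "syz A p G \<subseteq> syz A (p + q) H"
    proof
      fix a assume a: "a \<in> syz A p G"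
      then have "(\<lambda>i. a (p + i)) = 0" by (auto simp: syz_def free_vecs_def)
      then have "lin_comb (p + q) H a = lin_comb p G a" unfolding lH by simp
      then show "a \<in> syz A (p + q) H" using a by (auto simp: syz_def free_vecs_def)
    qed
    have "quot_iso (syz A (p + q) H) (syz A p G) (syz B q F) {0} (\<lambda>a i. a (p + i))"
      unfolding quot_iso_def
    proof (intro conjI ballI submod_syz s submod_zero)
      show "{0} \<subseteq> syz B q F" using submodD(1)[OF submod_syz[OF s(2)]] by blast
      show "linear_on (syz A (p + q) H) (\<lambda>a i. a (p + i))" by (auto simp: linear_on_def smul_def)
      show "(\<lambda>a i. a (p + i)) ` syz A (p + q) H \<subseteq> syz B q F"
      proof (intro image_subsetI)
        fix a assume a: "a \<in> syz A (p + q) H"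
        then have aC: "\<And>i. a i \<in> C" by (auto simp: syz_def free_vecs_def)
        have "lin_comb q F (\<lambda>i. a (p + i)) = lin_comb (p + q) H a - lin_comb p G a" by (simp add: lH)
        also have "\<dots> \<in> B" using a s GB[OF aC] by (intro submodD(5)[OF s(2)]) (auto simp: syz_def)
        finally show "(\<lambda>i. a (p + i)) \<in> syz B q F" using a by (auto simp: syz_def free_vecs_def)
      qed
      \<comment> \<open>A syzygy \<open>b\<close> of \<open>F\<close> modulo \<open>B\<close> is
        completed by coefficients that express \<open>- lin_comb q F b\<close>, an element of
        \<open>B\<close>, in terms of \<open>G\<close> modulo \<open>A\<close>.\<close>
      show "\<exists>a\<in>syz A (p + q) H. b - (\<lambda>i. a (p + i)) \<in> {0}" if bb: "b \<in> syz B q F" for b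
      proof -
        have b: "b \<in> free_vecs q" "- lin_comb q F b \<in> B" using bb submodD(4)[OF s(2)] by (auto simp: syz_def)
        then obtain a where a: "a \<in> free_vecs p" "- lin_comb q F b - lin_comb p G a \<in> A"
          using G by (auto simp: gens_def)
        have "- (- lin_comb q F b - lin_comb p G a) \<in> A" using a(2) by (rule submodD(4)[OF s(1)])
        then have "join a b \<in> syz A (p + q) H" using join[OF a(1) b(1)] by (simp add: syz_def algebra_simps)
        moreover have "(\<lambda>i. join a b (p + i)) = b" by (simp add: join_def)
        ultimately show ?thesis by (intro bexI[of _ "join a b"]) auto
      qed
      show "(\<lambda>i. a (p + i)) \<in> {0} \<longleftrightarrow> a \<in> syz A p G" if a: "a \<in> syz A (p + q) H" for a
      proof
        assume "(\<lambda>i. a (p + i)) \<in> {0}"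
        then have z: "(\<lambda>i. a (p + i)) = 0" by simp
        have "a i = 0" if "i \<ge> p" for i using fun_cong[OF z, of "i - p"] that by simp
        moreover have "lin_comb (p + q) H a = lin_comb p G a" unfolding lH z by simp
        ultimately show "a \<in> syz A p G" using a by (auto simp: syz_def free_vecs_def)
      qed (auto simp: syz_def free_vecs_def)
    qed
    then show ?thesis using g sub submod_syz[OF s(1)] by blast
  qed
  {
    case 0
    then obtain p G q F where GF: "gens B A p G" "syz A p G = {0}" "gens D B q F" "syz B q F = {0}" by auto
    then obtain H where H: "gens D A (p + q) H" 
        "quot_iso (syz A (p + q) H) {0} {0} {0} (\<lambda>a i. a (p + i))"
      using step[OF 0(1-5) GF(1,3)] by auto
    then have "syz A (p + q) H = {0}"
      using submodD(1)[OF submod_syz[OF 0(1)]] by (auto simp: quot_iso_def)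
    then show ?case using H by auto
  next
    case (Suc k)
    then obtain p G q F where GF: "gens B A p G" "has_resolution k (syz A p G) {0}"
      "gens D B q F" "has_resolution k (syz B q F) {0}" by auto
    then obtain H where H: "gens D A (p + q) H" "syz A p G \<subseteq> syz A (p + q) H"
        "quot_iso (syz A (p + q) H) (syz A p G) (syz B q F) {0} (\<lambda>a i. a (p + i))"
      using step[OF Suc.prems(1-5) GF(1,3)] by auto
    have "has_resolution k (syz A (p + q) H) (syz A p G)"
      using has_resolution_iso[OF H(3)] GF by simp
    then have "has_resolution k (syz A (p + q) H) {0}"
      using submodD(1)[OF submod_syz[OF Suc.prems(1)]]
      by (intro Suc.IH[OF submod_zero submod_syz[OF Suc.prems(1)] submod_syz[OF Suc.prems(1)] _ H(2) GF(2)]) simp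
    then show ?case using H(1) by auto
  }
qed

text \<open>Generators of \<open>B/A\<close> also generate \<open>B/N\<close>. Their syzygies modulo
  \<open>N\<close>, divided by those modulo \<open>A\<close>, are a copy of \<open>N/A\<close>, so
  the horseshoe lemma resolves them in length \<open>k\<close>.\<close>

lemma has_resolution_mapping_cone:
  assumes "submod A" "submod N" "submod B" "A \<subseteq> N" "N \<subseteq> B"
    and "has_resolution k N A" "has_resolution (Suc k) B A"
  shows "has_resolution (Suc k) B N"
proof -
  obtain q F where F: "gens B A q F" "has_resolution k (syz A q F) {0}" using assms(7) by auto
  have g: "gens B N q F" using F(1) assms(4) unfolding gens_def by blast
  have sub: "syz A q F \<subseteq> syz N q F" using assms(4) by (auto simp: syz_def)
  have "quot_iso (syz N q F) (syz A q F) N A (lin_comb q F)"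
    unfolding quot_iso_def
  proof (intro conjI ballI submod_syz assms)
    show "linear_on (syz N q F) (lin_comb q F)"
      by (simp add: linear_on_def lin_comb_add lin_comb_smul)
    show "\<exists>a\<in>syz N q F. x - lin_comb q F a \<in> A" if x: "x \<in> N" for x
    proof -
      obtain a where a: "a \<in> free_vecs q" "x - lin_comb q F a \<in> A"
        using F(1) x assms(5) unfolding gens_def by blast
      then have "lin_comb q F a \<in> N" using submod_diff_iff[OF assms(2)] x assms(4) by blast
      then show ?thesis using a by (auto simp: syz_def)
    qed
  qed (auto simp: syz_def)
  then have "has_resolution k (syz N q F) (syz A q F)" using has_resolution_iso assms(6) by blast
  then have "has_resolution k (syz N q F) {0}"
    using submodD(1)[OF submod_syz[OF assms(1)]]
    by (intro has_resolution_horseshoe[OF submod_zero submod_syz[OF assms(1)] submod_syz[OF assms(2)] _ sub F(2)]) simp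
  then show ?thesis using g by auto
qed

text \<open>Places an element in the first coordinate, so that ideals become submodules of the type
  on which \<open>has_resolution\<close> is defined.\<close>

definition emb :: "'a \<Rightarrow> nat \<Rightarrow> 'a" where
  "emb x = (\<lambda>i. if i = 0 then x else 0)"

lemma emb_simps: "emb (x + y) = emb x + emb y" "emb (x - y) = emb x - emb y" "smul r (emb x) = emb (r * x)"
  "emb 0 = 0" "emb x = emb y \<longleftrightarrow> x = y"
  by (auto simp: emb_def smul_def fun_eq_iff split: if_splits)

lemma emb_mem_iff [simp]: "emb x \<in> emb ` I \<longleftrightarrow> x \<in> I"
  by (auto simp: emb_simps)

lemma submod_emb: "idl I \<Longrightarrow> submod (emb ` I)"
  unfolding submod_def using idlD[of I] by (force simp: emb_simps simp flip: emb_simps(1,4))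

text \<open>Multiplication by \<open>x\<close> induces
  \<open>C/(I:x) \<cong> (I + xC)/I\<close>.\<close>

lemma quot_iso_mult:
  assumes "idl I" "idl Q" "x \<in> C" "Q = {z \<in> C. x * z \<in> I}"
  shows "quot_iso (emb ` C) (emb ` Q) (emb ` adj I x) (emb ` I) (smul x)"
  unfolding quot_iso_def
proof (intro conjI ballI submod_emb assms idl_adj idl_carrier)
  show "emb ` I \<subseteq> emb ` adj I x" by (auto intro: adj_superset)
  show "linear_on (emb ` C) (smul x)"
    by (auto simp: linear_on_def emb_simps algebra_simps simp flip: emb_simps(1))
  show "smul x ` emb ` C \<subseteq> emb ` adj I x" using assms by (auto simp: emb_simps intro: adj_gen)
  show "\<exists>b\<in>emb ` C. b' - smul x b \<in> emb ` I" if b': "b' \<in> emb ` adj I x" for b'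
  proof -
    obtain a y where "a \<in> I" "y \<in> C" "b' = emb (a + x * y)" using b' by (auto elim: adjE)
    then show ?thesis by (intro bexI[of _ "emb y"]) (auto simp: emb_simps)
  qed
  show "smul x b \<in> emb ` I \<longleftrightarrow> b \<in> emb ` Q" if "b \<in> emb ` C" for b
    using that assms(4) by (auto simp: emb_simps)
qed

lemma has_resolution_carrier: "has_resolution 0 (emb ` C) (emb ` {0})"
proof -
  have l: "lin_comb 1 (\<lambda>_. emb 1) a = emb (a 0)" for a by (simp add: lin_comb_def emb_simps)
  have "gens (emb ` C) (emb ` {0}) 1 (\<lambda>_. emb 1)"
    unfolding gens_def l
  proof (intro conjI ballI)
    fix b assume "b \<in> emb ` C"
    then obtain x where "x \<in> C" "b = emb x" by auto
    then show "\<exists>a\<in>free_vecs 1. b - emb (a 0) \<in> emb ` {0}"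
      by (intro bexI[of _ "emb x"]) (auto simp: emb_def free_vecs_def)
  qed auto
  moreover have "syz (emb ` {0}) 1 (\<lambda>_. emb 1) = {0}"
  proof -
    have "a = 0" if "a \<in> free_vecs 1" "a 0 = 0" for a
    proof
      fix i show "a i = 0 i" using that by (cases i) (auto simp: free_vecs_def)
    qed
    moreover have "emb x \<in> emb ` {0} \<longleftrightarrow> x = 0" for x by (simp only: emb_mem_iff singleton_iff)
    ultimately show ?thesis unfolding syz_def l using submodD(1)[OF submod_free_vecs[of 1]]
      by (auto simp: emb_simps)
  qed
  ultimately show ?thesis by auto
qed

text \<open>Since \<open>x\<close> is a nonzerodivisor, \<open>I : x = I\<close>. So
  \<open>(I + xC)/I\<close> is isomorphic to \<open>C/I\<close> and shares its resolution, and the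
  mapping cone is longer by one. Iteration yields a resolution of the length of the Koszul
  complex.\<close>

lemma has_resolution_adj:
  assumes "idl I" "x \<in> C" "nzd I x" "has_resolution k (emb ` C) (emb ` I)"
  shows "has_resolution (Suc k) (emb ` C) (emb ` adj I x)"
proof (rule has_resolution_mapping_cone)
  have "I = {z \<in> C. x * z \<in> I}" using assms idlD by (auto simp: nzd_def)
  then show "has_resolution k (emb ` adj I x) (emb ` I)"
    using has_resolution_iso[OF quot_iso_mult[OF assms(1,1,2)]] assms(4) by blast
  show "has_resolution (Suc k) (emb ` C) (emb ` I)" using assms(4) by (rule has_resolution_Suc)
  show "emb ` adj I x \<subseteq> emb ` C" using idlD(1)[OF idl_adj[OF assms(1,2)]] by blast
qed (use assms in \<open>auto intro!: submod_emb idl_adj idl_carrier adj_superset\<close>)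

lemma has_resolution_regular:
  assumes "set xs \<subseteq> C" "wreg {0} xs"
  shows "has_resolution (length xs) (emb ` C) (emb ` foldl adj {0} xs)"
  using assms
proof (induction xs rule: rev_induct)
  case Nil
  then show ?case using has_resolution_carrier by simp
next
  case (snoc x xs)
  have "idl {0}" by (auto simp: idl_def)
  then have "has_resolution (Suc (length xs)) (emb ` C) (emb ` adj (foldl adj {0} xs) x)"
    using snoc by (intro has_resolution_adj idl_foldl_adj) (auto simp: wreg_append)
  then show ?case by simp
qed

end

section \<open>Free and projective modules\<close>

lemma module_hom_finsum:
  assumes "Module.module R M" "Module.module R N" "f \<in> module_hom_set R M N"
    and "finite S" "\<And>z. z \<in> S \<Longrightarrow> c z \<in> carrier R" "\<And>z. z \<in> S \<Longrightarrow> x z \<in> carrier M"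
  shows "f (\<Oplus>\<^bsub>M\<^esub>z\<in>S. c z \<odot>\<^bsub>M\<^esub> x z) = (\<Oplus>\<^bsub>N\<^esub>z\<in>S. c z \<odot>\<^bsub>N\<^esub> f (x z))"
  using assms(4-)
proof (induction S rule: finite_induct)
  case empty
  interpret M: Module.module R M by fact
  interpret N: Module.module R N by fact
  have "f \<zero>\<^bsub>M\<^esub> = f (\<zero>\<^bsub>R\<^esub> \<odot>\<^bsub>M\<^esub> \<zero>\<^bsub>M\<^esub>)" by simp
  also have "\<dots> = \<zero>\<^bsub>R\<^esub> \<odot>\<^bsub>N\<^esub> f \<zero>\<^bsub>M\<^esub>"
    using assms(3) M.R.zero_closed M.zero_closed unfolding module_hom_set_def by blast
  also have "\<dots> = \<zero>\<^bsub>N\<^esub>" using assms(3) by (intro N.smult_l_null) (auto simp: module_hom_set_def)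
  finally show ?case by simp
next
  case (insert a S)
  interpret M: Module.module R M by fact
  interpret N: Module.module R N by fact
  have fN: "f y \<in> carrier N" if "y \<in> carrier M" for y using assms(3) that by (auto simp: module_hom_set_def)
  have "(\<Oplus>\<^bsub>M\<^esub>z\<in>insert a S. c z \<odot>\<^bsub>M\<^esub> x z) = c a \<odot>\<^bsub>M\<^esub> x a \<oplus>\<^bsub>M\<^esub> (\<Oplus>\<^bsub>M\<^esub>z\<in>S. c z \<odot>\<^bsub>M\<^esub> x z)"
    using insert by (intro M.finsum_insert) auto
  moreover have "(\<Oplus>\<^bsub>N\<^esub>z\<in>insert a S. c z \<odot>\<^bsub>N\<^esub> f (x z)) = c a \<odot>\<^bsub>N\<^esub> f (x a) \<oplus>\<^bsub>N\<^esub> (\<Oplus>\<^bsub>N\<^esub>z\<in>S. c z \<odot>\<^bsub>N\<^esub> f (x z))"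
    using insert fN by (intro N.finsum_insert) auto
  moreover have "(\<Oplus>\<^bsub>M\<^esub>z\<in>S. c z \<odot>\<^bsub>M\<^esub> x z) \<in> carrier M" using insert by (intro M.finsum_closed) auto
  ultimately show ?case using insert assms(3) by (simp add: module_hom_set_def)
qed

lemma module_hom_zero:
  assumes "Module.module R M" "Module.module R N" "f \<in> module_hom_set R M N"
  shows "f \<zero>\<^bsub>M\<^esub> = \<zero>\<^bsub>N\<^esub>"
proof -
  interpret M: Module.module R M by fact
  interpret N: Module.module R N by fact
  show ?thesis using module_hom_finsum[OF assms, of "{}"] by simp
qed

context subring_set
begin

text \<open>The free module on \<open>I\<close> as functions of finite support, the shape that the
  types in \<open>projective_module\<close> and \<open>proj_dim\<close> provide for.\<close>

definition fmod :: "'x set \<Rightarrow> ('a, 'x \<Rightarrow> 'a) module" where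
  "fmod I = \<lparr>carrier = {\<phi>. (\<forall>z. \<phi> z \<in> C) \<and> finite {z. \<phi> z \<noteq> 0} \<and> {z. \<phi> z \<noteq> 0} \<subseteq> I},
    monoid.mult = undefined, one = undefined, ring.zero = 0, add = (+), smult = smul\<rparr>"

lemma fmod_simps [simp]:
  "ring.zero (fmod I) = 0" "add (fmod I) = (+)" "smult (fmod I) = smul"
  by (simp_all add: fmod_def)

lemma fmod_iff:
  "\<phi> \<in> carrier (fmod I) \<longleftrightarrow> (\<forall>z. \<phi> z \<in> C) \<and> finite {z. \<phi> z \<noteq> 0} \<and> {z. \<phi> z \<noteq> 0} \<subseteq> I"
  by (simp add: fmod_def)

lemma fmodD:
  assumes "\<phi> \<in> carrier (fmod I)"
  shows "\<phi> z \<in> C" "finite {z. \<phi> z \<noteq> 0}" "{z. \<phi> z \<noteq> 0} \<subseteq> I" "\<phi> z \<noteq> 0 \<Longrightarrow> z \<in> I"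
  using assms by (auto simp: fmod_iff)

lemma fmod_closed:
  assumes "\<phi> \<in> carrier (fmod I)"
  shows "\<psi> \<in> carrier (fmod I) \<Longrightarrow> \<phi> + \<psi> \<in> carrier (fmod I)" "r \<in> C \<Longrightarrow> smul r \<phi> \<in> carrier (fmod I)"
    "- \<phi> \<in> carrier (fmod I)"
proof -
  assume "\<psi> \<in> carrier (fmod I)"
  moreover have "{z. (\<phi> + \<psi>) z \<noteq> 0} \<subseteq> {z. \<phi> z \<noteq> 0} \<union> {z. \<psi> z \<noteq> 0}" by auto
  ultimately show "\<phi> + \<psi> \<in> carrier (fmod I)" using assms by (auto simp: fmod_iff intro: finite_subset)
next
  assume "r \<in> C"
  moreover have "{z. smul r \<phi> z \<noteq> 0} \<subseteq> {z. \<phi> z \<noteq> 0}" by (auto simp: smul_def)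
  ultimately show "smul r \<phi> \<in> carrier (fmod I)" using assms
    by (auto simp: fmod_iff smul_def intro: finite_subset)
qed (use assms in \<open>auto simp: fmod_iff\<close>)

lemma module_fmod: "Module.module RR (fmod I)"
proof (rule moduleI)
  show "abelian_group (fmod I)"
  proof (rule abelian_groupI)
    fix x assume "x \<in> carrier (fmod I)"
    then show "\<exists>y\<in>carrier (fmod I). y \<oplus>\<^bsub>fmod I\<^esub> x = \<zero>\<^bsub>fmod I\<^esub>"
      using fmod_closed(3) by (intro bexI[of _ "- x"]) auto
  next
    fix x y assume "x \<in> carrier (fmod I)" "y \<in> carrier (fmod I)"
    then show "x \<oplus>\<^bsub>fmod I\<^esub> y \<in> carrier (fmod I)" using fmod_closed(1) by simp
  next
    show "\<zero>\<^bsub>fmod I\<^esub> \<in> carrier (fmod I)" by (simp add: fmod_iff)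
  qed (simp_all add: add.assoc add.commute)
  show "a \<odot>\<^bsub>fmod I\<^esub> x \<in> carrier (fmod I)" if "a \<in> carrier RR" "x \<in> carrier (fmod I)" for a x
    using fmod_closed(2) that by simp
qed (simp_all add: cring_RR smul_simps)

lemma finsum_fmod:
  assumes "finite S" "F \<in> S \<rightarrow> carrier (fmod I)"
  shows "finsum (fmod I) F S = (\<Sum>z\<in>S. F z)"
proof -
  interpret Module.module RR "fmod I" by (rule module_fmod)
  show ?thesis using assms by (induction S rule: finite_induct) (auto)
qed

definition unit_vec :: "'x \<Rightarrow> 'x \<Rightarrow> 'a" where
  "unit_vec z = (\<lambda>w. if w = z then 1 else 0)"

lemma unit_vec_in: "z \<in> I \<Longrightarrow> unit_vec z \<in> carrier (fmod I)"
  by (auto simp: unit_vec_def fmod_iff)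

lemma fmod_expand:
  assumes "\<phi> \<in> carrier (fmod I)"
  shows "\<phi> = finsum (fmod I) (\<lambda>z. smul (\<phi> z) (unit_vec z)) {z. \<phi> z \<noteq> 0}"
proof -
  have fin: "finite {z. \<phi> z \<noteq> 0}" using assms by (rule fmodD)
  have "smul (\<phi> z) (unit_vec z) \<in> carrier (fmod I)" if "\<phi> z \<noteq> 0" for z
    using fmodD[OF assms] that by (intro fmod_closed unit_vec_in)
  then have "finsum (fmod I) (\<lambda>z. smul (\<phi> z) (unit_vec z)) {z. \<phi> z \<noteq> 0} =
    (\<Sum>z\<in>{z. \<phi> z \<noteq> 0}. smul (\<phi> z) (unit_vec z))"
    using fin by (intro finsum_fmod) auto
  also have "\<dots> = \<phi>"
  proof
    fix w
    have "(\<Sum>z\<in>{z. \<phi> z \<noteq> 0}. smul (\<phi> z) (unit_vec z)) w = (\<Sum>z\<in>{z. \<phi> z \<noteq> 0}. smul (\<phi> z) (unit_vec z) w)"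
      using fin by (induction rule: finite_induct) auto
    also have "\<dots> = (\<Sum>z\<in>{z. \<phi> z \<noteq> 0}. if w = z then \<phi> z else 0)"
      by (intro sum.cong) (auto simp: smul_def unit_vec_def)
    also have "\<dots> = \<phi> w" using fin by (simp add: sum.delta')
    finally show "(\<Sum>z\<in>{z. \<phi> z \<noteq> 0}. smul (\<phi> z) (unit_vec z)) w = \<phi> w" .
  qed
  finally show ?thesis by simp
qed

text \<open>The homomorphism from a free module with prescribed values \<open>a\<close> on the
  basis.\<close>

definition ev :: "('a, 'b, 'm) module_scheme \<Rightarrow> ('x \<Rightarrow> 'b) \<Rightarrow> ('x \<Rightarrow> 'a) \<Rightarrow> 'b" where
  "ev A a \<phi> = (\<Oplus>\<^bsub>A\<^esub>z\<in>{z. \<phi> z \<noteq> 0}. \<phi> z \<odot>\<^bsub>A\<^esub> a z)"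

lemma ev_superset:
  assumes A: "Module.module RR A" and a: "a \<in> I \<rightarrow> carrier A" and \<phi>: "\<phi> \<in> carrier (fmod I)"
    and S: "finite S" "{z. \<phi> z \<noteq> 0} \<subseteq> S" "S \<subseteq> I"
  shows "ev A a \<phi> = (\<Oplus>\<^bsub>A\<^esub>z\<in>S. \<phi> z \<odot>\<^bsub>A\<^esub> a z)"
proof -
  interpret A: Module.module RR A by fact
  have c: "\<phi> z \<odot>\<^bsub>A\<^esub> a z \<in> carrier A" if "z \<in> I" for z
    using a fmodD[OF \<phi>] that by (intro A.smult_closed) auto
  have "\<phi> z \<odot>\<^bsub>A\<^esub> a z = \<zero>\<^bsub>A\<^esub>" if "z \<in> S - {z. \<phi> z \<noteq> 0}" for z
    using A.smult_l_null[of "a z"] that a S by auto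
  then show ?thesis unfolding ev_def using S c
    by (intro A.add.finprod_mono_neutral_cong_left[folded finsum_def]) auto
qed

lemma ev_hom:
  assumes A: "Module.module RR A" and a: "a \<in> I \<rightarrow> carrier A"
  shows "ev A a \<in> module_hom_set RR (fmod I) A"
proof -
  interpret A: Module.module RR A by fact
  have c: "\<phi> z \<odot>\<^bsub>A\<^esub> a z \<in> carrier A" if "\<phi> \<in> carrier (fmod I)" "z \<in> I" for \<phi> z
    using a fmodD[OF that(1)] that(2) by (intro A.smult_closed) auto
  have "ev A a \<phi> \<in> carrier A" if "\<phi> \<in> carrier (fmod I)" for \<phi>
    unfolding ev_def using c[OF that] fmodD[OF that] by (intro A.finsum_closed) blast
  moreover have "ev A a (\<phi> + \<psi>) = ev A a \<phi> \<oplus>\<^bsub>A\<^esub> ev A a \<psi>"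
    if \<phi>\<psi>: "\<phi> \<in> carrier (fmod I)" "\<psi> \<in> carrier (fmod I)" for \<phi> \<psi>
  proof -
    let ?S = "{z. \<phi> z \<noteq> 0} \<union> {z. \<psi> z \<noteq> 0}"
    have S: "finite ?S" "?S \<subseteq> I" using fmodD[OF \<phi>\<psi>(1)] fmodD[OF \<phi>\<psi>(2)] by auto
    have "ev A a (\<phi> + \<psi>) = (\<Oplus>\<^bsub>A\<^esub>z\<in>?S. (\<phi> + \<psi>) z \<odot>\<^bsub>A\<^esub> a z)"
      using S \<phi>\<psi> by (intro ev_superset[OF A a] fmod_closed) auto
    also have "\<dots> = (\<Oplus>\<^bsub>A\<^esub>z\<in>?S. \<phi> z \<odot>\<^bsub>A\<^esub> a z \<oplus>\<^bsub>A\<^esub> \<psi> z \<odot>\<^bsub>A\<^esub> a z)"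
    proof (rule A.finsum_cong')
      show "(\<lambda>z. \<phi> z \<odot>\<^bsub>A\<^esub> a z \<oplus>\<^bsub>A\<^esub> \<psi> z \<odot>\<^bsub>A\<^esub> a z) \<in> ?S \<rightarrow> carrier A"
        using c \<phi>\<psi> S by blast
      fix z assume "z \<in> ?S"
      then have "a z \<in> carrier A" using S a by blast
      then show "(\<phi> + \<psi>) z \<odot>\<^bsub>A\<^esub> a z = \<phi> z \<odot>\<^bsub>A\<^esub> a z \<oplus>\<^bsub>A\<^esub> \<psi> z \<odot>\<^bsub>A\<^esub> a z"
        using A.smult_l_distr[of "\<phi> z" "\<psi> z" "a z"] fmodD(1)[OF \<phi>\<psi>(1)] fmodD(1)[OF \<phi>\<psi>(2)] by simp
    qed simp
    also have "\<dots> = (\<Oplus>\<^bsub>A\<^esub>z\<in>?S. \<phi> z \<odot>\<^bsub>A\<^esub> a z) \<oplus>\<^bsub>A\<^esub> (\<Oplus>\<^bsub>A\<^esub>z\<in>?S. \<psi> z \<odot>\<^bsub>A\<^esub> a z)"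
      using c \<phi>\<psi> S by (intro A.finsum_addf) blast+
    also have "\<dots> = ev A a \<phi> \<oplus>\<^bsub>A\<^esub> ev A a \<psi>"
      using S \<phi>\<psi> ev_superset[OF A a, of \<phi> ?S] ev_superset[OF A a, of \<psi> ?S] by auto
    finally show ?thesis .
  qed
  moreover have "ev A a (smul r \<phi>) = r \<odot>\<^bsub>A\<^esub> ev A a \<phi>"
    if r: "r \<in> C" and \<phi>: "\<phi> \<in> carrier (fmod I)" for r \<phi>
  proof -
    let ?S = "{z. \<phi> z \<noteq> 0}"
    have S: "finite ?S" "?S \<subseteq> I" using fmodD[OF \<phi>] by auto
    have "{z. smul r \<phi> z \<noteq> 0} \<subseteq> ?S" by (auto simp: smul_def)
    then have "ev A a (smul r \<phi>) = (\<Oplus>\<^bsub>A\<^esub>z\<in>?S. smul r \<phi> z \<odot>\<^bsub>A\<^esub> a z)"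
      using S \<phi> r by (intro ev_superset[OF A a] fmod_closed) auto
    also have "\<dots> = (\<Oplus>\<^bsub>A\<^esub>z\<in>?S. r \<odot>\<^bsub>A\<^esub> (\<phi> z \<odot>\<^bsub>A\<^esub> a z))"
    proof (rule A.finsum_cong')
      show "(\<lambda>z. r \<odot>\<^bsub>A\<^esub> (\<phi> z \<odot>\<^bsub>A\<^esub> a z)) \<in> ?S \<rightarrow> carrier A"
      proof
        fix z assume "z \<in> ?S"
        then have "\<phi> z \<odot>\<^bsub>A\<^esub> a z \<in> carrier A" using c[OF \<phi>] S by blast
        then show "r \<odot>\<^bsub>A\<^esub> (\<phi> z \<odot>\<^bsub>A\<^esub> a z) \<in> carrier A" using r A.smult_closed[of r "\<phi> z \<odot>\<^bsub>A\<^esub> a z"] by simp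
      qed
      fix z assume "z \<in> ?S"
      then have "a z \<in> carrier A" "\<phi> z \<in> C" using S a fmodD(1)[OF \<phi>] by auto
      then show "smul r \<phi> z \<odot>\<^bsub>A\<^esub> a z = r \<odot>\<^bsub>A\<^esub> (\<phi> z \<odot>\<^bsub>A\<^esub> a z)"
        using A.smult_assoc1[of r "\<phi> z" "a z"] r by (simp add: smul_def)
    qed simp
    also have "\<dots> = r \<odot>\<^bsub>A\<^esub> ev A a \<phi>"
      unfolding ev_def
    proof (rule A.finsum_smult_ldistr[symmetric, OF S(1)])
      show "(\<lambda>z. \<phi> z \<odot>\<^bsub>A\<^esub> a z) \<in> ?S \<rightarrow> carrier A" using c[OF \<phi>] S by blast
    qed (use r in simp)
    finally show ?thesis .
  qed
  ultimately show ?thesis by (auto simp: module_hom_set_def)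
qed

lemma ev_unit_vec:
  assumes A: "Module.module RR A" and a: "a z \<in> carrier A"
  shows "ev A a (unit_vec z) = a z"
proof (cases "(1::'a) = 0")
  case False
  interpret A: Module.module RR A by fact
  have "{w. unit_vec z w \<noteq> (0::'a)} = {z}" using False by (auto simp: unit_vec_def)
  then have "ev A a (unit_vec z) = (\<Oplus>\<^bsub>A\<^esub>w\<in>{z}. unit_vec z w \<odot>\<^bsub>A\<^esub> a w)" by (simp add: ev_def)
  also have "\<dots> = unit_vec z z \<odot>\<^bsub>A\<^esub> a z"
    using a by (subst A.finsum_insert) (auto simp: unit_vec_def)
  also have "\<dots> = a z" using A.smult_one[OF a] by (simp add: unit_vec_def)
  finally show ?thesis .
next
  \<comment> \<open>The zero ring is a model of the locale. Over it every module is trivial, and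
    \<open>unit_vec z\<close> has empty support.\<close>
  case True
  interpret A: Module.module RR A by fact
  have "x = \<zero>\<^bsub>A\<^esub>" if "x \<in> carrier A" for x
    using A.smult_one[OF that] A.smult_l_null[OF that] True by simp
  moreover have "{w. unit_vec z w \<noteq> (0::'a)} = {}" using True by (auto simp: unit_vec_def)
  ultimately show ?thesis using a by (simp add: ev_def)
qed

lemma projective_fmod: "projective_module RR (fmod I :: ('a, 'x \<Rightarrow> 'a) module)"
  unfolding projective_module_def
proof (intro conjI allI impI module_fmod)
  fix A :: "('a, ('x \<Rightarrow> 'a) \<Rightarrow> 'a) module" and B :: "('a, 'x \<Rightarrow> 'a) module" and g f
  assume A: "Module.module RR A" and B: "Module.module RR B" and g: "g \<in> module_hom_set RR A B"
    "g ` carrier A = carrier B" and f: "f \<in> module_hom_set RR (fmod I) B"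
  have "\<exists>x\<in>carrier A. g x = f (unit_vec z)" if "z \<in> I" for z
  proof -
    have "f (unit_vec z) \<in> carrier B" using f unit_vec_in[OF that] by (auto simp: module_hom_set_def)
    then show ?thesis using g(2) by (metis imageE)
  qed
  then obtain a where a: "\<And>z. z \<in> I \<Longrightarrow> a z \<in> carrier A \<and> g (a z) = f (unit_vec z)" by metis
  have "g (ev A a \<phi>) = f \<phi>" if \<phi>: "\<phi> \<in> carrier (fmod I)" for \<phi>
  proof -
    let ?S = "{z. \<phi> z \<noteq> 0}"
    have S: "finite ?S" "?S \<subseteq> I" "\<And>z. \<phi> z \<in> carrier RR" using fmodD[OF \<phi>] by auto
    interpret B: Module.module RR B by fact
    have "g (ev A a \<phi>) = (\<Oplus>\<^bsub>B\<^esub>z\<in>?S. \<phi> z \<odot>\<^bsub>B\<^esub> g (a z))"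
      unfolding ev_def using S a by (intro module_hom_finsum[OF A B g(1)]) auto
    also have "\<dots> = (\<Oplus>\<^bsub>B\<^esub>z\<in>?S. \<phi> z \<odot>\<^bsub>B\<^esub> f (unit_vec z))"
    proof (rule B.finsum_cong')
      show "(\<lambda>z. \<phi> z \<odot>\<^bsub>B\<^esub> f (unit_vec z)) \<in> ?S \<rightarrow> carrier B"
      proof
        fix z assume "z \<in> ?S"
        then have "f (unit_vec z) \<in> carrier B"
          using f unit_vec_in[of z I] S by (auto simp: module_hom_set_def)
        then show "\<phi> z \<odot>\<^bsub>B\<^esub> f (unit_vec z) \<in> carrier B" using S(3) by (intro B.smult_closed)
      qed
    qed (use a S in auto)
    also have "\<dots> = f (finsum (fmod I) (\<lambda>z. \<phi> z \<odot>\<^bsub>fmod I\<^esub> unit_vec z) ?S)"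
    proof (rule module_hom_finsum[OF module_fmod B f S(1) _ _, symmetric])
      show "unit_vec z \<in> carrier (fmod I)" if "z \<in> ?S" for z using S(2) that by (intro unit_vec_in) auto
    qed (rule S(3))
    also have "\<dots> = f \<phi>" using fmod_expand[OF \<phi>] by simp
    finally show ?thesis .
  qed
  then show "\<exists>h\<in>module_hom_set RR (fmod I) A. \<forall>x\<in>carrier (fmod I). g (h x) = f x"
    using ev_hom[OF A, of a I] a by (intro bexI[of _ "ev A a"]) auto
qed

text \<open>The identity is lifted along the canonical surjection from the free module on
  \<open>carrier P\<close>. The section \<open>h\<close> makes \<open>P\<close> a direct summand of
  a module of functions.\<close>

lemma projective_retract:
  fixes P :: "('a, 'p) module"
  assumes "projective_module RR P"
  shows "\<exists>h\<in>module_hom_set RR P (fmod (carrier P)). \<forall>x\<in>carrier P. ev P (\<lambda>x. x) (h x) = x"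
proof -
  have P: "Module.module RR P" using assms by (simp add: projective_module_def)
  have g: "ev P (\<lambda>x. x) \<in> module_hom_set RR (fmod (carrier P)) P" by (rule ev_hom[OF P]) auto
  have "ev P (\<lambda>x. x) ` carrier (fmod (carrier P)) = carrier P"
  proof
    show "ev P (\<lambda>x. x) ` carrier (fmod (carrier P)) \<subseteq> carrier P" using g by (auto simp: module_hom_set_def)
    show "carrier P \<subseteq> ev P (\<lambda>x. x) ` carrier (fmod (carrier P))"
      using ev_unit_vec[OF P, of "\<lambda>x. x"] unit_vec_in[of _ "carrier P"] by (metis image_eqI subsetI)
  qed
  moreover have "(\<lambda>x. x) \<in> module_hom_set RR P P" by (auto simp: module_hom_set_def)
  ultimately show ?thesis using assms P g module_fmod[of "carrier P"] unfolding projective_module_def by blast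
qed

text \<open>The recursion unrolled. Only the first syzygies are taken modulo \<open>A\<close>; the
  later ones are kernels of maps between free modules, whence the case distinction. Rank 0 beyond
  \<open>k\<close> records the length.\<close>

lemma has_resolution_sequence:
  assumes "has_resolution k B A"
  shows "\<exists>q F. gens B A (q 0) (F 0) \<and> (\<forall>i>k. q i = 0) \<and>
    (\<forall>i. gens (syz (if i = 0 then A else {0}) (q i) (F i)) {0} (q (Suc i)) (F (Suc i)))"
  using assms
proof (induction k arbitrary: B A)
  case 0
  then obtain q F where qF: "gens B A q F" "syz A q F = {0}" by auto
  have z: "gens {0 :: nat \<Rightarrow> 'a} {0} 0 (\<lambda>_. 0)" "syz {0 :: nat \<Rightarrow> 'a} 0 (\<lambda>_. 0) = {0}"
    using gens_empty[OF submod_zero] by auto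
  show ?case
  proof (intro exI[of _ "case_nat q (\<lambda>_. 0)"] exI[of _ "case_nat F (\<lambda>_ _. 0)"] conjI allI impI)
    show "gens B A (case_nat q (\<lambda>_. 0) 0) (case_nat F (\<lambda>_ _. 0) 0)" using qF by simp
    show "case_nat q (\<lambda>_. 0) i = 0" if "0 < i" for i using that by (cases i) auto
    show "gens (syz (if i = 0 then A else {0}) (case_nat q (\<lambda>_. 0) i) (case_nat F (\<lambda>_ _. 0) i)) {0}
        (case_nat q (\<lambda>_. 0) (Suc i)) (case_nat F (\<lambda>_ _. 0) (Suc i))" for i
    proof (cases i)
      case 0
      have "(if (0::nat) = 0 then A else {0}) = A" by simp
      then show ?thesis unfolding 0 using qF z by (simp only: nat.case)
    next
      case (Suc j)
      have "(if Suc j = 0 then A else {0}) = {0}" by simp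
      then show ?thesis unfolding Suc using z by (simp only: nat.case)
    qed
  qed
next
  case (Suc k)
  then obtain q0 F0 where qF: "gens B A q0 F0" "has_resolution k (syz A q0 F0) {0}" by auto
  from Suc.IH[OF qF(2), unfolded if_cancel] obtain q F where IH:
    "gens (syz A q0 F0) {0} (q 0) (F 0)" "\<forall>i>k. q i = 0"
    "\<forall>i. gens (syz {0} (q i) (F i)) {0} (q (Suc i)) (F (Suc i))" by blast
  show ?case
  proof (intro exI[of _ "case_nat q0 q"] exI[of _ "case_nat F0 F"] conjI allI impI)
    show "gens B A (case_nat q0 q 0) (case_nat F0 F 0)" using qF by simp
    show "case_nat q0 q i = 0" if "Suc k < i" for i using IH(2) that by (cases i) auto
    show "gens (syz (if i = 0 then A else {0}) (case_nat q0 q i) (case_nat F0 F i)) {0}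
        (case_nat q0 q (Suc i)) (case_nat F0 F (Suc i))" for i
    proof (cases i)
      case 0
      have "(if (0::nat) = 0 then A else {0}) = A" by simp
      then show ?thesis unfolding 0 using IH(1) by (simp only: nat.case)
    next
      case (Suc j)
      have "(if Suc j = 0 then A else {0}) = {0}" by simp
      then show ?thesis unfolding Suc using IH(3) by (simp only: nat.case)
    qed
  qed
qed

lemma projective_resolution_exists:
  assumes J: "idl J" and res: "has_resolution k (emb ` C) (emb ` J)"
  shows "\<exists>(P :: nat \<Rightarrow> ('a, 'b \<times> 'a \<times> nat \<Rightarrow> 'a) module) \<delta> \<epsilon>.
    projective_resolution RR (quotient_module RR J) P \<delta> \<epsilon> \<and> (\<forall>i>k. carrier (P i) = {\<zero>\<^bsub>P i\<^esub>})"
proof -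
  obtain q F where qF: "gens (emb ` C) (emb ` J) (q 0) (F 0)" "\<And>i. i > k \<Longrightarrow> q i = 0"
    "\<And>i. gens (syz (if i = 0 then emb ` J else {0}) (q i) (F i)) {0} (q (Suc i)) (F (Suc i))"
    using has_resolution_sequence[OF res] by auto
  \<comment> \<open>The resolution has to live on functions on
    \<open>'b \<times> 'a \<times> nat\<close>. \<open>tag\<close> places the basis on a copy of the
    natural numbers there, with one arbitrary value in the other components; \<open>up\<close> and
    \<open>dn\<close> transport coordinate vectors.\<close>
  define tag where "tag j = (undefined :: 'b, undefined :: 'a, j)" for j :: nat
  have tag_inj: "tag i = tag j \<longleftrightarrow> i = j" for i j by (auto simp: tag_def)
  define up where "up v = (\<lambda>(b, a, j). if (b, a) = (undefined :: 'b, undefined :: 'a) then v j else 0)"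
    for v :: "nat \<Rightarrow> 'a"
  define dn where "dn \<phi> = (\<lambda>j. \<phi> (tag j))" for \<phi> :: "'b \<times> 'a \<times> nat \<Rightarrow> 'a"
  define P where "P i = (fmod (tag ` {..<q i}) :: ('a, 'b \<times> 'a \<times> nat \<Rightarrow> 'a) module)" for i
  have dn_up [simp]: "dn (up v) = v" for v by (simp add: dn_def up_def tag_def)
  have up_simps: "up (v + w) = up v + up w" "up (smul r v) = smul r (up v)" "up 0 = 0" "up v = 0 \<longleftrightarrow> v = 0" for v w r
    by (auto simp: up_def fun_eq_iff smul_def)
  have dn_simps: "dn (\<phi> + \<psi>) = dn \<phi> + dn \<psi>" "dn (smul r \<phi>) = smul r (dn \<phi>)" for \<phi> \<psi> r
    by (auto simp: dn_def smul_def)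
  have up_in: "up v \<in> carrier (P i)" if "v \<in> free_vecs (q i)" for v i
  proof -
    have "{z. up v z \<noteq> 0} \<subseteq> tag ` {..<q i}"
    proof
      fix z assume "z \<in> {z. up v z \<noteq> 0}"
      then obtain j where "z = tag j" "v j \<noteq> 0" by (cases z) (auto simp: up_def tag_def split: if_splits)
      then show "z \<in> tag ` {..<q i}" using that by (auto simp: free_vecs_def) (meson imageI lessThan_iff not_le)
    qed
    then show ?thesis using that by (auto simp: P_def fmod_iff free_vecs_def up_def intro: finite_subset)
  qed
  have dn_in: "dn \<phi> \<in> free_vecs (q i)" and up_dn: "up (dn \<phi>) = \<phi>" if "\<phi> \<in> carrier (P i)" for \<phi> i
  proof -
    have sup: "\<phi> z = 0" if "z \<notin> tag ` {..<q i}" for z using \<open>\<phi> \<in> carrier (P i)\<close> that unfolding P_def fmod_iff by blast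
    show "dn \<phi> \<in> free_vecs (q i)"
      unfolding free_vecs_def
    proof (intro CollectI conjI allI impI)
      show "dn \<phi> j \<in> C" for j using \<open>\<phi> \<in> carrier (P i)\<close> unfolding P_def dn_def by (rule fmodD)
      show "dn \<phi> j = 0" if "q i \<le> j" for j unfolding dn_def using that by (intro sup) (auto simp: tag_inj)
    qed
    show "up (dn \<phi>) = \<phi>"
    proof
      fix z :: "'b \<times> 'a \<times> nat"
      obtain b a j where z: "z = (b, a, j)" by (cases z)
      show "up (dn \<phi>) z = \<phi> z"
      proof (cases "b = undefined \<and> a = undefined")
        case True then show ?thesis by (simp add: z up_def dn_def tag_def)
      next
        case False
        then have "z \<notin> tag ` {..<q i}" by (auto simp: z tag_def)
        then show ?thesis using sup False by (auto simp: z up_def)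
      qed
    qed
  qed
  have carrier_P: "carrier (P i) = up ` free_vecs (q i)" for i
    using up_in dn_in up_dn by (metis (no_types, lifting) image_eqI image_subsetI subsetI subset_antisym)
  define \<delta> where "\<delta> i \<phi> = up (lin_comb (q (Suc i)) (F (Suc i)) (dn \<phi>))" for i \<phi>
  define \<epsilon> where "\<epsilon> \<phi> = coset J (lin_comb (q 0) (F 0) (dn \<phi>) 0)" for \<phi>
  have P_simps [simp]: "\<zero>\<^bsub>P i\<^esub> = 0" "add (P i) = (+)" "smult (P i) = smul" for i by (simp_all add: P_def)
  note Ms = quotient_module_simps[OF J]
  let ?A = "\<lambda>i::nat. if i = 0 then emb ` J else {0}"
  have syz_image: "syz (?A i) (q i) (F i) = lin_comb (q (Suc i)) (F (Suc i)) ` free_vecs (q (Suc i))" for i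
  proof -
    let ?S = "syz (?A i) (q i) (F i)"
    have S: "submod ?S" using submod_emb[OF J] submod_zero by (intro submod_syz) auto
    show ?thesis
    proof
      show "?S \<subseteq> lin_comb (q (Suc i)) (F (Suc i)) ` free_vecs (q (Suc i))"
        using qF(3)[of i] by (force simp: gens_def)
      show "lin_comb (q (Suc i)) (F (Suc i)) ` free_vecs (q (Suc i)) \<subseteq> ?S"
      proof (intro image_subsetI lin_comb_in[OF S])
        show "F (Suc i) j \<in> ?S" if "j < q (Suc i)" for j using qF(3)[of i] that unfolding gens_def by blast
      qed (rule free_vecsD(1))
    qed
  qed
  have emb_C: "lin_comb (q 0) (F 0) a \<in> emb ` C" if "a \<in> free_vecs (q 0)" for a
    using qF(1) free_vecsD(1)[OF that] by (intro lin_comb_in submod_emb idl_carrier) (auto simp: gens_def)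
  have emb0: "x = emb (x 0) \<and> x 0 \<in> C" if "x \<in> emb ` C" for x using that by (auto simp: emb_def)
  have "projective_resolution RR (quotient_module RR J) P \<delta> \<epsilon>"
    unfolding projective_resolution_def
  proof (intro conjI allI)
    show "projective_module RR (P i)" for i unfolding P_def by (rule projective_fmod)
    show "\<epsilon> \<in> module_hom_set RR (P 0) (quotient_module RR J)"
      unfolding module_hom_set_def
    proof (intro CollectI conjI ballI funcsetI)
      have c: "lin_comb (q 0) (F 0) (dn \<phi>) 0 \<in> C" if "\<phi> \<in> carrier (P 0)" for \<phi>
        using emb0[OF emb_C[OF dn_in[OF that]]] by simp
      show "\<epsilon> \<phi> \<in> carrier (quotient_module RR J)" if "\<phi> \<in> carrier (P 0)" for \<phi>
        using c[OF that] by (auto simp: \<epsilon>_def Ms)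
      show "\<epsilon> (\<phi> \<oplus>\<^bsub>P 0\<^esub> \<psi>) = \<epsilon> \<phi> \<oplus>\<^bsub>quotient_module RR J\<^esub> \<epsilon> \<psi>"
        if "\<phi> \<in> carrier (P 0)" "\<psi> \<in> carrier (P 0)" for \<phi> \<psi>
        using c that by (simp add: \<epsilon>_def Ms dn_simps lin_comb_add)
      show "\<epsilon> (r \<odot>\<^bsub>P 0\<^esub> \<phi>) = r \<odot>\<^bsub>quotient_module RR J\<^esub> \<epsilon> \<phi>"
        if "r \<in> carrier RR" "\<phi> \<in> carrier (P 0)" for r \<phi>
        using c[OF that(2)] that by (simp add: \<epsilon>_def Ms dn_simps lin_comb_smul smul_apply)
    qed
    show "\<delta> i \<in> module_hom_set RR (P (Suc i)) (P i)" for i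
      unfolding module_hom_set_def
    proof (intro CollectI conjI ballI funcsetI)
      show "\<delta> i \<phi> \<in> carrier (P i)" if "\<phi> \<in> carrier (P (Suc i))" for \<phi>
        using dn_in[OF that] syz_image[of i] by (auto simp: \<delta>_def syz_def intro!: up_in)
    qed (simp_all add: \<delta>_def dn_simps lin_comb_add lin_comb_smul up_simps)
    show "\<epsilon> ` carrier (P 0) = carrier (quotient_module RR J)"
    proof
      show "\<epsilon> ` carrier (P 0) \<subseteq> carrier (quotient_module RR J)"
        using emb0 emb_C dn_in by (auto simp: \<epsilon>_def Ms)
      show "carrier (quotient_module RR J) \<subseteq> \<epsilon> ` carrier (P 0)"
      proof
        fix Y assume "Y \<in> carrier (quotient_module RR J)"
        then obtain x where x: "x \<in> C" "Y = coset J x" by (auto simp: Ms)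
        then obtain a where a: "a \<in> free_vecs (q 0)" "emb x - lin_comb (q 0) (F 0) a \<in> emb ` J"
          using qF(1) by (auto simp: gens_def)
        then obtain y where "y \<in> J" "emb x - lin_comb (q 0) (F 0) a = emb y" by auto
        then have "x - lin_comb (q 0) (F 0) a 0 \<in> J" by (metis (no_types, lifting) emb_def minus_apply)
        then have "Y = \<epsilon> (up a)" using x coset_eq_iff[OF J] by (simp add: \<epsilon>_def)
        then show "Y \<in> \<epsilon> ` carrier (P 0)" using up_in[OF a(1)] by blast
      qed
    qed
    have syz0: "\<epsilon> (up a) = \<zero>\<^bsub>quotient_module RR J\<^esub> \<longleftrightarrow> a \<in> syz (emb ` J) (q 0) (F 0)"
      if "a \<in> free_vecs (q 0)" for a
    proof -
      have "\<epsilon> (up a) = \<zero>\<^bsub>quotient_module RR J\<^esub> \<longleftrightarrow> lin_comb (q 0) (F 0) a 0 \<in> J"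
        using coset_eq_iff[OF J] by (simp add: \<epsilon>_def Ms)
      also have "\<dots> \<longleftrightarrow> lin_comb (q 0) (F 0) a \<in> emb ` J"
        using emb0[OF emb_C[OF that]] emb_mem_iff by metis
      finally show ?thesis using that by (simp add: syz_def)
    qed
    have im: "\<delta> i ` carrier (P (Suc i)) = up ` syz (?A i) (q i) (F i)" for i
      unfolding carrier_P syz_image by (simp add: image_image \<delta>_def)
    show "\<delta> 0 ` carrier (P (Suc 0)) = {x \<in> carrier (P 0). \<epsilon> x = \<zero>\<^bsub>quotient_module RR J\<^esub>}"
      unfolding im using syz0 by (auto simp: carrier_P syz_def)
    show "\<delta> (Suc i) ` carrier (P (Suc (Suc i))) = {x \<in> carrier (P (Suc i)). \<delta> i x = \<zero>\<^bsub>P i\<^esub>}" for i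
      unfolding im by (auto simp: carrier_P syz_def \<delta>_def up_simps)
  qed
  moreover have "carrier (P i) = {\<zero>\<^bsub>P i\<^esub>}" if "i > k" for i
    unfolding carrier_P using qF(2)[OF that] by (simp add: up_simps)
  ultimately show ?thesis by blast
qed

end

section \<open>A lower bound for the length of projective resolutions\<close>

context subring_set
begin

text \<open>The submodule \<open>(ys ! 0, ..., ys ! (k - 1)) Z\<close>, by recursion because the
  arguments about it add one element at a time.\<close>

fun mult_sub :: "('i \<Rightarrow> 'a) set \<Rightarrow> 'a list \<Rightarrow> nat \<Rightarrow> ('i \<Rightarrow> 'a) set" where
  "mult_sub Z ys 0 = {0}"
| "mult_sub Z ys (Suc k) = {s + smul (ys ! k) x | s x. s \<in> mult_sub Z ys k \<and> x \<in> Z}"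

lemma smul_commute: "smul r (smul s x) = smul s (smul r x)"
  by (simp add: smul_def mult.left_commute)

lemma mult_sub_submod:
  assumes "submod Z" shows "submod (mult_sub Z ys k)"
proof (induction k)
  case 0
  then show ?case using submod_zero by simp
next
  case (Suc k)
  note d = submodD[OF assms] and e = submodD[OF Suc.IH]
  show ?case
    unfolding submod_def
  proof (intro conjI ballI)
    have "0 = 0 + smul (ys ! k) 0" by (simp add: smul_simps)
    then show "0 \<in> mult_sub Z ys (Suc k)" using d(1) e(1) unfolding mult_sub.simps by blast
    fix x y assume "x \<in> mult_sub Z ys (Suc k)" "y \<in> mult_sub Z ys (Suc k)"
    then obtain s a t b where *: "s \<in> mult_sub Z ys k" "a \<in> Z" "x = s + smul (ys ! k) a"
      "t \<in> mult_sub Z ys k" "b \<in> Z" "y = t + smul (ys ! k) b" by auto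
    then have "x + y = (s + t) + smul (ys ! k) (a + b)" by (simp add: smul_simps algebra_simps)
    then show "x + y \<in> mult_sub Z ys (Suc k)" using * d(2) e(2) unfolding mult_sub.simps by blast
  next
    fix r x assume r: "r \<in> C" and "x \<in> mult_sub Z ys (Suc k)"
    then obtain s a where *: "s \<in> mult_sub Z ys k" "a \<in> Z" "x = s + smul (ys ! k) a" by auto
    then have "smul r x = smul r s + smul (ys ! k) (smul r a)" by (simp add: smul_simps smul_commute)
    then show "smul r x \<in> mult_sub Z ys (Suc k)" using * r d(3) e(3) unfolding mult_sub.simps by blast
  qed
qed

lemma mult_sub_subset: "submod Z \<Longrightarrow> (\<And>j. j < k \<Longrightarrow> ys ! j \<in> C) \<Longrightarrow> mult_sub Z ys k \<subseteq> Z"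
proof (induction k)
  case (Suc k)
  show ?case
  proof
    fix y assume "y \<in> mult_sub Z ys (Suc k)"
    then obtain s x where s: "s \<in> mult_sub Z ys k" "x \<in> Z" "y = s + smul (ys ! k) x" by auto
    have "s \<in> Z" using Suc s by auto
    moreover have "smul (ys ! k) x \<in> Z" using submodD(3)[OF Suc.prems(1)] Suc.prems(2) s by auto
    ultimately show "y \<in> Z" unfolding s(3) by (rule submodD(2)[OF Suc.prems(1)])
  qed
qed (use submodD(1) in auto)

lemma mult_sub_image:
  assumes "submod Z" "linear_on Z \<phi>" "\<phi> ` Z \<subseteq> Z'" "\<And>j. j < k \<Longrightarrow> ys ! j \<in> C"
  shows "\<phi> ` mult_sub Z ys k \<subseteq> mult_sub Z' ys k"
  using assms(4)
proof (induction k)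
  case 0
  show ?case
    unfolding mult_sub.simps image_insert image_empty linear_on_zero[OF assms(2,1)] by (rule subset_refl)
next
  case (Suc k)
  show ?case
  proof (intro image_subsetI)
    fix y assume "y \<in> mult_sub Z ys (Suc k)"
    then obtain s x where s: "s \<in> mult_sub Z ys k" "x \<in> Z" "y = s + smul (ys ! k) x" by auto
    have "s \<in> Z" using mult_sub_subset[OF assms(1), of k ys] Suc.prems s by auto
    moreover have "smul (ys ! k) x \<in> Z" using submodD(3)[OF assms(1)] Suc.prems s by auto
    ultimately have "\<phi> y = \<phi> s + \<phi> (smul (ys ! k) x)" using assms(2) s(3) unfolding linear_on_def by blast
    also have "\<phi> (smul (ys ! k) x) = smul (ys ! k) (\<phi> x)"
      using assms(2) s(2) Suc.prems unfolding linear_on_def by blast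
    finally have "\<phi> y = \<phi> s + smul (ys ! k) (\<phi> x)" .
    moreover have "\<phi> s \<in> mult_sub Z' ys k" using Suc s by auto
    moreover have "\<phi> x \<in> Z'" using assms(3) s by auto
    ultimately show "\<phi> y \<in> mult_sub Z' ys (Suc k)" unfolding mult_sub.simps by blast
  qed
qed

text \<open>With \<open>N i\<close> the image of \<open>Z (i + 1)\<close>, the statement proved by descending induction on \<open>i\<close> is
  that \<open>z \<in> Z i\<close> is in \<open>N i + (ys ! 0, \<dots>, ys ! (i - 1)) Z i\<close>, if \<open>ys ! j * z\<close> is for all
  \<open>j \<ge> i\<close>.\<close>

lemma annihilated_cokernel_zero:
  fixes Z :: "nat \<Rightarrow> ('i \<Rightarrow> 'a) set"
  assumes Z: "\<And>i. submod (Z i)" and ys: "set ys \<subseteq> C" "l < length ys"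
    and D: "\<And>i. linear_on (Z (Suc i)) (D i)" "\<And>i. D i ` Z (Suc i) \<subseteq> Z i"
    and exact: "\<And>i. D (Suc i) ` Z (Suc (Suc i)) = {x \<in> Z (Suc i). D i x = 0}"
    and last: "Z (Suc l) = {0}"
    and reg: "\<And>i k x. k < length ys \<Longrightarrow> x \<in> Z i \<Longrightarrow> smul (ys ! k) x \<in> mult_sub (Z i) ys k \<Longrightarrow>
      x \<in> mult_sub (Z i) ys k"
    and z: "z \<in> Z 0" "\<And>j. j < length ys \<Longrightarrow> smul (ys ! j) z \<in> D 0 ` Z 1"
  shows "z \<in> D 0 ` Z 1"
proof -
  define Y where "Y i k = mult_sub (Z i) ys k" for i k
  define N where "N i = D i ` Z (Suc i)" for i
  have yC: "ys ! j \<in> C" if "j < length ys" for j using ys that by auto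
  have Yd: "submod (Y i k)" for i k unfolding Y_def using Z by (rule mult_sub_submod)
  have YX: "Y i k \<subseteq> Z i" if "k \<le> length ys" for i k
    unfolding Y_def using Z yC that by (intro mult_sub_subset) auto
  have DY: "D i s \<in> Y i k" if "s \<in> Y (Suc i) k" "k \<le> length ys" for i k s
    using mult_sub_image[OF Z D(1) D(2), where k = k and ys = ys] yC that unfolding Y_def by force
  have Y_Suc: "Y i (Suc k) = {s + smul (ys ! k) x | s x. s \<in> Y i k \<and> x \<in> Z i}" for i k
    by (simp add: Y_def)
  have reg': "x \<in> Y i k" if "k < length ys" "x \<in> Z i" "smul (ys ! k) x \<in> Y i k" for i k x
    using reg that unfolding Y_def by blast
  have Dadd: "D i (x + y) = D i x + D i y" and Dsmul: "r \<in> C \<Longrightarrow> D i (smul r x) = smul r (D i x)"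
    if "x \<in> Z (Suc i)" "y \<in> Z (Suc i)" for i x y r
    using D(1)[of i] that unfolding linear_on_def by blast+
  have Dsub: "D i (x - y) = D i x - D i y" if "x \<in> Z (Suc i)" "y \<in> Z (Suc i)" for i x y
    using linear_on_diff[OF D(1) Z that] .
  have DX: "D i x \<in> Z i" if "x \<in> Z (Suc i)" for i x using D(2) that by blast
  have DD: "D i (D (Suc i) x) = 0" if "x \<in> Z (Suc (Suc i))" for i x
    using exact[of i] that by blast
  note Xd = submodD[OF Z]
  \<comment> \<open>For \<open>k \<le> i\<close> the complex stays exact at \<open>Z (Suc i)\<close>
    when reduced modulo the first \<open>k\<close> elements. This is the vanishing of Tor against
    \<open>C/(ys ! 0, ..., ys ! (k - 1))\<close> above degree \<open>k\<close>.\<close>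
  have NY: "\<exists>q'\<in>Y (Suc i) k. D i q = D i q'"
    if "k \<le> i" "i \<le> length ys" "q \<in> Z (Suc i)" "D i q \<in> Y i k" for i k q
    using that
  proof (induction i arbitrary: k q)
    case 0
    then have "D 0 q = 0" by (simp add: Y_def)
    moreover have "D 0 0 = 0" by (rule linear_on_zero[OF D(1) Z])
    ultimately show ?case using 0 submodD(1)[OF Yd] by metis
  next
    case (Suc i)
    note outer = Suc.IH
    from Suc.prems show ?case
    proof (induction k arbitrary: q)
      case 0
      then have "D (Suc i) q = 0" by (simp add: Y_def)
      moreover have "D (Suc i) 0 = 0" by (rule linear_on_zero[OF D(1) Z])
      ultimately show ?case using submodD(1)[OF Yd] by metis
    next
      case (Suc k)
      note q = Suc.prems(3)
      have k: "k \<le> i" "k < length ys" using Suc.prems by auto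
      obtain s x where s: "s \<in> Y (Suc i) k" "x \<in> Z (Suc i)" "D (Suc i) q = s + smul (ys ! k) x"
        using Suc.prems(4) unfolding Y_Suc by auto
      have sX: "s \<in> Z (Suc i)" using YX[of k "Suc i"] s k by auto
      have yx: "smul (ys ! k) x \<in> Z (Suc i)" using Xd(3) yC k s by blast
      \<comment> \<open>Applying \<open>D i\<close> and cancelling \<open>ys ! k\<close> shows that
        \<open>x\<close> differs by a boundary from an element of \<open>Y (Suc i) k\<close>.
        Correcting \<open>q\<close> by a multiple of \<open>ys ! k\<close> then reduces to the case
        \<open>k\<close>.\<close>
      have "D i (s + smul (ys ! k) x) = 0" using DD[OF q] s(3) by simp
      then have "smul (ys ! k) (D i x) = - D i s"
        using Dadd[OF sX yx] Dsmul[OF s(2) s(2) yC[OF k(2)]] by (simp add: add_eq_0_iff)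
      also have "\<dots> \<in> Y i k" using DY[OF s(1)] k submodD(4)[OF Yd] by simp
      finally have "D i x \<in> Y i k" using reg'[OF k(2) DX[OF s(2)]] by blast
      then obtain x' where x': "x' \<in> Y (Suc i) k" "D i x = D i x'"
        using outer[OF k(1) _ s(2)] Suc.prems(2)
        by (meson Suc_leD)
      have x'Z: "x' \<in> Z (Suc i)" using YX[of k "Suc i"] x' k by auto
      have "D i (x - x') = 0" using Dsub[OF s(2) x'Z] x' by simp
      then have "x - x' \<in> D (Suc i) ` Z (Suc (Suc i))" using exact Xd(5)[OF s(2) x'Z] by blast
      then obtain q1 where q1: "q1 \<in> Z (Suc (Suc i))" "x - x' = D (Suc i) q1" by blast
      have yq1: "smul (ys ! k) q1 \<in> Z (Suc (Suc i))" using Xd(3) yC k q1 by blast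
      have Dyq1: "D (Suc i) (smul (ys ! k) q1) = smul (ys ! k) (x - x')"
        using Dsmul[OF q1(1) q1(1) yC[OF k(2)]] q1 by simp
      have "D (Suc i) (q - smul (ys ! k) q1) = s + smul (ys ! k) x'"
        unfolding Dsub[OF q yq1] s(3) Dyq1 by (simp add: smul_simps)
      also have "\<dots> \<in> Y (Suc i) k"
        using s(1) x'(1) yC k by (intro submodD(2,3)[OF Yd]) auto
      finally have "D (Suc i) (q - smul (ys ! k) q1) \<in> Y (Suc i) k" .
      then obtain q2 where q2: "q2 \<in> Y (Suc (Suc i)) k" "D (Suc i) (q - smul (ys ! k) q1) = D (Suc i) q2"
        using Suc.IH[OF le_SucI[OF k(1)] Suc.prems(2) Xd(5)[OF q yq1]] by blast
      have q2X: "q2 \<in> Z (Suc (Suc i))" using YX[of k "Suc (Suc i)"] q2 k by auto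
      have "D (Suc i) q = D (Suc i) q2 + D (Suc i) (smul (ys ! k) q1)"
        using q2(2) Dsub[OF q yq1] by (simp add: algebra_simps)
      also have "\<dots> = D (Suc i) (q2 + smul (ys ! k) q1)" using Dadd[OF q2X yq1] by simp
      finally show ?case using q2 q1 unfolding Y_Suc by blast
    qed
  qed
  have "z \<in> {a + b | a b. a \<in> N i \<and> b \<in> Y i i}"
    if "i \<le> l" "z \<in> Z i" "\<And>j. i \<le> j \<Longrightarrow> j < length ys \<Longrightarrow> smul (ys ! j) z \<in> {a + b | a b. a \<in> N i \<and> b \<in> Y i i}"
    for i z
    using that
  proof (induction arbitrary: z rule: inc_induct)
    case base
    \<comment> \<open>\<open>N l\<close> is zero because the complex ends at \<open>l\<close>; the
      element \<open>ys ! l\<close>, which exists by \<open>l < length ys\<close>, is cancelled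
      modulo \<open>Y l l\<close>.\<close>
    have "D l 0 = 0" by (rule linear_on_zero[OF D(1) Z])
    then have "N l = {0}" by (simp add: N_def last)
    then show ?case using base reg'[of l z l] ys by auto
  next
    case (step i)
    have il: "i < length ys" using step.hyps ys by simp
    have "\<exists>p s. p \<in> Z (Suc i) \<and> s \<in> Y i i \<and> smul (ys ! j) z = D i p + s" if "i \<le> j" "j < length ys" for j
      using step.prems(2)[OF that] unfolding N_def by blast
    then obtain p s where ps: "\<And>j. i \<le> j \<Longrightarrow> j < length ys \<Longrightarrow>
        p j \<in> Z (Suc i) \<and> s j \<in> Y i i \<and> smul (ys ! j) z = D i (p j) + s j" by metis
    define q where "q = p i"
    have q: "q \<in> Z (Suc i)" "s i \<in> Y i i" "smul (ys ! i) z = D i q + s i"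
      unfolding q_def using ps il by auto
    have "smul (ys ! j) q \<in> {a + b | a b. a \<in> N (Suc i) \<and> b \<in> Y (Suc i) (Suc i)}"
      if j: "Suc i \<le> j" "j < length ys" for j
    proof -
      have pj: "p j \<in> Z (Suc i)" "s j \<in> Y i i" "smul (ys ! j) z = D i (p j) + s j" using ps[of j] j by auto
      have in1: "smul (ys ! j) q \<in> Z (Suc i)" "smul (ys ! i) (p j) \<in> Z (Suc i)"
        using Xd(3) yC il j q pj by auto
      \<comment> \<open>\<open>q\<close> inherits the hypothesis one degree higher. Writing
        \<open>ys ! i * ys ! j * z\<close> in two ways shows that the image of this difference lies
        in \<open>Y i i\<close>; by \<open>NY\<close> the difference is a boundary up to an element
        of \<open>Y (Suc i) i\<close>.\<close>
      have "D i (smul (ys ! j) q - smul (ys ! i) (p j)) = smul (ys ! j) (D i q) - smul (ys ! i) (D i (p j))"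
        using Dsub[OF in1] Dsmul[OF q(1) q(1) yC[OF j(2)]] Dsmul[OF pj(1) pj(1) yC[OF il]] by simp
      also have "D i q = smul (ys ! i) z - s i" using q(3) by simp
      also have "D i (p j) = smul (ys ! j) z - s j" using pj(3) by simp
      also have "smul (ys ! j) (smul (ys ! i) z - s i) - smul (ys ! i) (smul (ys ! j) z - s j) =
          smul (ys ! i) (s j) - smul (ys ! j) (s i)"
        by (auto simp: smul_def fun_eq_iff algebra_simps)
      also have "\<dots> \<in> Y i i"
        using q(2) pj(2) yC il j by (intro submodD(5,3)[OF Yd]) auto
      finally obtain q' where q': "q' \<in> Y (Suc i) i"
        "D i (smul (ys ! j) q - smul (ys ! i) (p j)) = D i q'"
        using NY[OF le_refl less_imp_le[OF il] Xd(5)[OF in1]] by blast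
      have q'Z: "q' \<in> Z (Suc i)" using YX[of i "Suc i"] q' il by auto
      define w where "w = smul (ys ! j) q - smul (ys ! i) (p j) - q'"
      have "w \<in> Z (Suc i)" unfolding w_def using Xd(5)[OF Xd(5)[OF in1] q'Z] .
      moreover have "D i w = 0" unfolding w_def using Dsub[OF Xd(5)[OF in1] q'Z] q'(2) by simp
      ultimately have "w \<in> N (Suc i)" unfolding N_def using exact by blast
      moreover have "smul (ys ! j) q = w + (q' + smul (ys ! i) (p j))" by (simp add: w_def)
      moreover have "q' + smul (ys ! i) (p j) \<in> Y (Suc i) (Suc i)" using q' pj unfolding Y_Suc by blast
      ultimately show ?thesis by blast
    qed
    then have "q \<in> {a + b | a b. a \<in> N (Suc i) \<and> b \<in> Y (Suc i) (Suc i)}" using step.IH[OF q(1)] by blast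
    then obtain r s' x' where r: "r \<in> Z (Suc (Suc i))" "s' \<in> Y (Suc i) i" "x' \<in> Z (Suc i)"
      "q = D (Suc i) r + (s' + smul (ys ! i) x')" unfolding N_def Y_Suc by blast
    have s'Z: "s' \<in> Z (Suc i)" using YX[of i "Suc i"] r il by auto
    have yx': "smul (ys ! i) x' \<in> Z (Suc i)" using Xd(3) yC il r by blast
    have "D i q = D i (D (Suc i) r) + D i (s' + smul (ys ! i) x')"
      unfolding r(4) by (rule Dadd[OF DX[OF r(1)] Xd(2)[OF s'Z yx']])
    also have "D i (D (Suc i) r) = 0" by (rule DD[OF r(1)])
    also have "D i (s' + smul (ys ! i) x') = D i s' + smul (ys ! i) (D i x')"
      using Dadd[OF s'Z yx'] Dsmul[OF r(3) r(3) yC[OF il]] by simp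
    finally have Dq: "D i q = 0 + (D i s' + smul (ys ! i) (D i x'))" .
    have cancel: "0 + (a + b) + c - b = a + c" for a b c :: "'i \<Rightarrow> 'a" by simp
    \<comment> \<open>By the decomposition of \<open>q\<close>, \<open>ys ! i * z\<close> and
      \<open>ys ! i * D i x'\<close> agree up to \<open>Y i i\<close>. Cancelling
      \<open>ys ! i\<close> exhibits \<open>z\<close> as a boundary plus an element of
      \<open>Y i i\<close>.\<close>
    have "smul (ys ! i) (z - D i x') = smul (ys ! i) z - smul (ys ! i) (D i x')" by (rule smul_simps)
    also have "\<dots> = D i s' + s i" unfolding q(3) Dq by (rule cancel)
    also have "\<dots> \<in> Y i i" using DY[OF r(2)] il q(2) by (intro submodD(2)[OF Yd]) auto
    finally have "z - D i x' \<in> Y i i"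
      using reg'[OF il Xd(5)[OF step.prems(1) DX[OF r(3)]]] by blast
    moreover have "z = D i x' + (z - D i x')" by simp
    ultimately show ?case unfolding N_def using r(3) by blast
  qed
  from this[of 0 z] have "z \<in> {a + b | a b. a \<in> N 0 \<and> b \<in> Y 0 0}"
  proof
    have "x = x + 0" for x :: "'i \<Rightarrow> 'a" by simp
    then show "smul (ys ! j) z \<in> {a + b | a b. a \<in> N 0 \<and> b \<in> Y 0 0}" if "j < length ys" for j
      using z(2)[OF that] unfolding N_def Y_def mult_sub.simps One_nat_def by blast
  qed (use z in auto)
  then show ?thesis by (auto simp: N_def Y_def)
qed

section \<open>Regularity on free and projective modules\<close>

lemma submod_fmod: "submod (carrier (fmod I))"
proof -
  have "0 \<in> carrier (fmod I)" by (simp add: fmod_iff)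
  then show ?thesis using fmod_closed unfolding submod_def by blast
qed

lemma mult_sub_fmod_iff:
  assumes "x \<in> carrier (fmod I)" "k \<le> length ys" "set ys \<subseteq> C"
  shows "x \<in> mult_sub (carrier (fmod I)) ys k \<longleftrightarrow> (\<forall>z. x z \<in> foldl adj {0} (take k ys))"
  using assms(1,2)
proof (induction k arbitrary: x)
  case 0
  then show ?case by (auto simp: fun_eq_iff)
next
  case (Suc k)
  have take: "take (Suc k) ys = take k ys @ [ys ! k]" using Suc.prems by (simp add: take_Suc_conv_app_nth)
  let ?L = "foldl adj {0} (take k ys)"
  have yk: "ys ! k \<in> C" using Suc.prems assms(3) by auto
  have z0: "idl {0}" by (auto simp: idl_def)
  have L: "idl ?L" using assms(3) by (intro idl_foldl_adj z0) (auto dest: in_set_takeD)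
  note sm = submod_fmod[of I]
  show ?case
  proof
    assume "x \<in> mult_sub (carrier (fmod I)) ys (Suc k)"
    then obtain s w where s: "s \<in> mult_sub (carrier (fmod I)) ys k" "w \<in> carrier (fmod I)"
      "x = s + smul (ys ! k) w" unfolding mult_sub.simps by blast
    have "s \<in> carrier (fmod I)"
    proof -
      have "ys ! j \<in> C" if "j < k" for j using assms(3) Suc.prems(2) that by (auto intro!: subsetD[OF assms(3)])
      then show ?thesis using mult_sub_subset[OF sm, of k ys] s(1) by blast
    qed
    then have "s z \<in> ?L" for z using Suc.IH[of s] s(1) Suc.prems by simp
    then show "\<forall>z. x z \<in> foldl adj {0} (take (Suc k) ys)"
      using s(3) fmodD(1)[OF s(2)] by (auto simp: take smul_def intro!: adjI)
  next
    assume a: "\<forall>z. x z \<in> foldl adj {0} (take (Suc k) ys)"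
    \<comment> \<open>At a zero of \<open>x\<close> both summands are chosen to be zero, which keeps
      their supports finite.\<close>
    have "\<exists>s w. s \<in> ?L \<and> w \<in> C \<and> x z = s + ys ! k * w \<and> (x z = 0 \<longrightarrow> s = 0 \<and> w = 0)" for z
    proof (cases "x z = 0")
      case True
      then show ?thesis using idlD(2)[OF L] by (intro exI[of _ 0]) auto
    next
      case False
      have "x z \<in> adj ?L (ys ! k)" using a by (simp add: take)
      then show ?thesis using False by (auto elim!: adjE)
    qed
    then obtain s w where sw: "\<And>z. s z \<in> ?L \<and> w z \<in> C \<and> x z = s z + ys ! k * w z \<and> (x z = 0 \<longrightarrow> s z = 0 \<and> w z = 0)"
      by metis
    have "{z. s z \<noteq> 0} \<subseteq> {z. x z \<noteq> 0}" "{z. w z \<noteq> 0} \<subseteq> {z. x z \<noteq> 0}" using sw by blast+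
    then have in': "s \<in> carrier (fmod I)" "w \<in> carrier (fmod I)"
    proof -
      note x = fmodD(2,3)[OF Suc.prems(1)]
      have "\<forall>z. s z \<in> C" "\<forall>z. w z \<in> C" using sw idlD(1)[OF L] by blast+
      moreover have "finite {z. s z \<noteq> 0}" "finite {z. w z \<noteq> 0}"
        using \<open>{z. s z \<noteq> 0} \<subseteq> _\<close> \<open>{z. w z \<noteq> 0} \<subseteq> _\<close> x(1) by (simp_all add: finite_subset)
      moreover have "{z. s z \<noteq> 0} \<subseteq> I" "{z. w z \<noteq> 0} \<subseteq> I"
        using \<open>{z. s z \<noteq> 0} \<subseteq> _\<close> \<open>{z. w z \<noteq> 0} \<subseteq> _\<close> x(2) by (simp_all add: subset_trans)
      ultimately show "s \<in> carrier (fmod I)" "w \<in> carrier (fmod I)" unfolding fmod_iff by simp_all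
    qed
    have "\<forall>z. s z \<in> ?L" and x_eq: "x z = s z + ys ! k * w z" for z using sw by blast+
    then have "s \<in> mult_sub (carrier (fmod I)) ys k" using Suc.IH[OF in'(1)] Suc.prems(2) by simp
    moreover have "x = s + smul (ys ! k) w" by (rule ext) (simp add: smul_def x_eq)
    ultimately show "x \<in> mult_sub (carrier (fmod I)) ys (Suc k)"
      using in' unfolding mult_sub.simps by blast
  qed
qed

text \<open>With r = \<open>length ys\<close>, the elements of \<open>M\<close> killed by
  \<open>ys\<close> form Tor_r(C/(ys), M), as the Koszul complex shows, and a resolution of length
  less than r makes it zero. The diagram chase behind this is
  \<open>annihilated_cokernel_zero\<close>; here the resolution is brought into the form required
  there.\<close>

lemma projective_resolution_annihilated:
  fixes P :: "nat \<Rightarrow> ('a, 'p) module" and M :: "('a, 'b, 'm) module_scheme"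
  assumes res: "projective_resolution RR M P \<delta> \<epsilon>" and M: "Module.module RR M"
    and len: "carrier (P (Suc l)) = {\<zero>\<^bsub>P (Suc l)\<^esub>}" "l < length ys"
    and ys: "set ys \<subseteq> C" "wreg {0} ys"
    and m: "m \<in> carrier M" "\<And>j. j < length ys \<Longrightarrow> (ys ! j) \<odot>\<^bsub>M\<^esub> m = \<zero>\<^bsub>M\<^esub>"
  shows "m = \<zero>\<^bsub>M\<^esub>"
proof -
  have P: "projective_module RR (P i)" and \<delta>: "\<delta> i \<in> module_hom_set RR (P (Suc i)) (P i)"
    and \<epsilon>: "\<epsilon> \<in> module_hom_set RR (P 0) M" "\<epsilon> ` carrier (P 0) = carrier M"
    and ex0: "\<delta> 0 ` carrier (P (Suc 0)) = {x \<in> carrier (P 0). \<epsilon> x = \<zero>\<^bsub>M\<^esub>}"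
    and ex: "\<delta> (Suc i) ` carrier (P (Suc (Suc i))) = {x \<in> carrier (P (Suc i)). \<delta> i x = \<zero>\<^bsub>P i\<^esub>}" for i
    using res by (auto simp: projective_resolution_def)
  have Pm: "Module.module RR (P i)" for i using P by (simp add: projective_module_def)
  define g where "g i = ev (P i) (\<lambda>x. x)" for i
  have g: "g i \<in> module_hom_set RR (fmod (carrier (P i))) (P i)" for i
    unfolding g_def by (rule ev_hom[OF Pm]) auto
  obtain h where h: "\<And>i. h i \<in> module_hom_set RR (P i) (fmod (carrier (P i)))"
    "\<And>i x. x \<in> carrier (P i) \<Longrightarrow> g i (h i x) = x"
    using projective_retract[OF P] unfolding g_def by metis
  \<comment> \<open>\<open>P i\<close> is replaced by its copy \<open>Z i\<close> in the free module
    \<open>A i\<close>, where addition is pointwise and regularity can be tested on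
    coordinates.\<close>
  define A where "A i = carrier (fmod (carrier (P i)) :: ('a, 'p \<Rightarrow> 'a) module)" for i
  define Z where "Z i = h i ` carrier (P i)" for i
  define D where "D i x = h i (\<delta> i (g (Suc i) x))" for i x
  have hX: "h i p \<in> A i" if "p \<in> carrier (P i)" for i p
    using h(1)[of i] that by (auto simp: module_hom_set_def A_def)
  have h_add: "h i (p \<oplus>\<^bsub>P i\<^esub> p') = h i p + h i p'" and h_smult: "r \<in> C \<Longrightarrow> h i (r \<odot>\<^bsub>P i\<^esub> p) = smul r (h i p)"
    if "p \<in> carrier (P i)" "p' \<in> carrier (P i)" for i p p' r
    using h(1)[of i] that by (auto simp: module_hom_set_def)
  have h_zero: "h i \<zero>\<^bsub>P i\<^esub> = 0" for i using module_hom_zero[OF Pm module_fmod h(1)] by simp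
  have h_inj: "p = p'" if "h i p = h i p'" "p \<in> carrier (P i)" "p' \<in> carrier (P i)" for i p p'
    using h(2) that by metis
  have \<delta>c: "\<delta> i p \<in> carrier (P i)" if "p \<in> carrier (P (Suc i))" for i p
    using \<delta>[of i] that by (auto simp: module_hom_set_def)
  have Dh: "D i (h (Suc i) p) = h i (\<delta> i p)" if "p \<in> carrier (P (Suc i))" for i p
    by (simp add: D_def h(2)[OF that])
  have P_closed: "p \<oplus>\<^bsub>P i\<^esub> p' \<in> carrier (P i)" "r \<in> C \<Longrightarrow> r \<odot>\<^bsub>P i\<^esub> p \<in> carrier (P i)" "\<zero>\<^bsub>P i\<^esub> \<in> carrier (P i)"
    if "p \<in> carrier (P i)" "p' \<in> carrier (P i)" for i p p' r
  proof -
    interpret Module.module RR "P i" by (rule Pm)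
    show "p \<oplus>\<^bsub>P i\<^esub> p' \<in> carrier (P i)" "r \<in> C \<Longrightarrow> r \<odot>\<^bsub>P i\<^esub> p \<in> carrier (P i)" "\<zero>\<^bsub>P i\<^esub> \<in> carrier (P i)"
      using that smult_closed[of r p] by auto
  qed
  have P_zero: "\<zero>\<^bsub>P i\<^esub> \<in> carrier (P i)" for i
  proof -
    interpret Module.module RR "P i" by (rule Pm)
    show ?thesis by simp
  qed
  have Xs: "submod (Z i)" for i
    unfolding submod_def
  proof (intro conjI ballI)
    show "0 \<in> Z i" unfolding Z_def using h_zero P_zero by (metis imageI)
    fix x y assume "x \<in> Z i" "y \<in> Z i"
    then obtain p p' where p: "p \<in> carrier (P i)" "x = h i p" "p' \<in> carrier (P i)" "y = h i p'"
      by (auto simp: Z_def)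
    then have "x + y = h i (p \<oplus>\<^bsub>P i\<^esub> p')" using h_add by simp
    then show "x + y \<in> Z i" unfolding Z_def using P_closed(1)[OF p(1,3)] by blast
  next
    fix r x assume r: "r \<in> C" and "x \<in> Z i"
    then obtain p where p: "p \<in> carrier (P i)" "x = h i p" by (auto simp: Z_def)
    then have "smul r x = h i (r \<odot>\<^bsub>P i\<^esub> p)" using h_smult r by simp
    then show "smul r x \<in> Z i" unfolding Z_def using P_closed(2)[OF p(1,1) r] by blast
  qed
  have Dlin: "linear_on (Z (Suc i)) (D i)" for i
    unfolding linear_on_def
  proof (intro conjI ballI)
    fix x y assume "x \<in> Z (Suc i)" "y \<in> Z (Suc i)"
    then obtain p p' where p: "p \<in> carrier (P (Suc i))" "x = h (Suc i) p" "p' \<in> carrier (P (Suc i))" "y = h (Suc i) p'"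
      by (auto simp: Z_def)
    have "D i (x + y) = D i (h (Suc i) (p \<oplus>\<^bsub>P (Suc i)\<^esub> p'))" using p h_add by simp
    also have "\<dots> = h i (\<delta> i (p \<oplus>\<^bsub>P (Suc i)\<^esub> p'))" using p P_closed by (intro Dh) auto
    also have "\<delta> i (p \<oplus>\<^bsub>P (Suc i)\<^esub> p') = \<delta> i p \<oplus>\<^bsub>P i\<^esub> \<delta> i p'" using \<delta>[of i] p by (auto simp: module_hom_set_def)
    also have "h i (\<delta> i p \<oplus>\<^bsub>P i\<^esub> \<delta> i p') = h i (\<delta> i p) + h i (\<delta> i p')" using \<delta>c p by (intro h_add) auto
    finally show "D i (x + y) = D i x + D i y" by (simp only: p(2,4) Dh[OF p(1)] Dh[OF p(3)])
  next
    fix r x assume r: "r \<in> C" and "x \<in> Z (Suc i)"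
    then obtain p where p: "p \<in> carrier (P (Suc i))" "x = h (Suc i) p" by (auto simp: Z_def)
    have "D i (smul r x) = D i (h (Suc i) (r \<odot>\<^bsub>P (Suc i)\<^esub> p))" using p r h_smult by simp
    also have "\<dots> = h i (\<delta> i (r \<odot>\<^bsub>P (Suc i)\<^esub> p))" using p r P_closed by (intro Dh) auto
    also have "\<delta> i (r \<odot>\<^bsub>P (Suc i)\<^esub> p) = r \<odot>\<^bsub>P i\<^esub> \<delta> i p" using \<delta>[of i] p r by (auto simp: module_hom_set_def)
    also have "h i (r \<odot>\<^bsub>P i\<^esub> \<delta> i p) = smul r (h i (\<delta> i p))" using \<delta>c p r by (intro h_smult) auto
    finally show "D i (smul r x) = smul r (D i x)" by (simp only: p(2) Dh[OF p(1)])
  qed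
  have Dim: "D i ` Z (Suc i) = h i ` (\<delta> i ` carrier (P (Suc i)))" for i
  proof (intro equalityI subsetI)
    fix x assume "x \<in> D i ` Z (Suc i)"
    then obtain p where p: "p \<in> carrier (P (Suc i))" "x = D i (h (Suc i) p)" unfolding Z_def by blast
    show "x \<in> h i ` (\<delta> i ` carrier (P (Suc i)))" unfolding p(2) Dh[OF p(1)] using p(1) by blast
  next
    fix x assume "x \<in> h i ` (\<delta> i ` carrier (P (Suc i)))"
    then obtain p where p: "p \<in> carrier (P (Suc i))" "x = h i (\<delta> i p)" by blast
    show "x \<in> D i ` Z (Suc i)" unfolding p(2) Dh[OF p(1), symmetric] Z_def using p(1) by blast
  qed
  have "m \<in> \<epsilon> ` carrier (P 0)" using \<epsilon>(2) m(1) by simp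
  then obtain p where p: "p \<in> carrier (P 0)" "\<epsilon> p = m" by (elim imageE) simp
  have "h 0 p \<in> D 0 ` Z 1"
  proof (rule annihilated_cokernel_zero[where Z = Z and D = D and l = l, OF Xs ys(1) len(2) Dlin])
    show "D i ` Z (Suc i) \<subseteq> Z i" for i unfolding Dim unfolding Z_def using \<delta>c by blast
    show "D (Suc i) ` Z (Suc (Suc i)) = {x \<in> Z (Suc i). D i x = 0}" for i
      unfolding Dim ex
    proof (intro equalityI subsetI)
      fix x assume "x \<in> h (Suc i) ` {x \<in> carrier (P (Suc i)). \<delta> i x = \<zero>\<^bsub>P i\<^esub>}"
      then show "x \<in> {x \<in> Z (Suc i). D i x = 0}" using Dh h_zero by (auto simp: Z_def)
    next
      fix x assume x: "x \<in> {x \<in> Z (Suc i). D i x = 0}"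
      then obtain p where p: "p \<in> carrier (P (Suc i))" "x = h (Suc i) p" by (auto simp: Z_def)
      then have "h i (\<delta> i p) = h i \<zero>\<^bsub>P i\<^esub>" using x Dh h_zero by simp
      then have "\<delta> i p = \<zero>\<^bsub>P i\<^esub>" using h_inj \<delta>c p P_zero by blast
      then show "x \<in> h (Suc i) ` {x \<in> carrier (P (Suc i)). \<delta> i x = \<zero>\<^bsub>P i\<^esub>}" using p by blast
    qed
    show "Z (Suc l) = {0}" unfolding Z_def len(1) using h_zero by simp
    \<comment> \<open>\<open>Z i\<close> is a direct summand of \<open>A i\<close>: regularity holds
      on the free module by coordinates, and the projection \<open>h i \<circ> g i\<close> carries
      the resulting membership back to \<open>Z i\<close>.\<close>
    show "x \<in> mult_sub (Z i) ys k"
      if k: "k < length ys" and x: "x \<in> Z i" "smul (ys ! k) x \<in> mult_sub (Z i) ys k" for i k x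
    proof -
      have yC: "ys ! j \<in> C" if "j < length ys" for j using ys that by auto
      have XA: "Z i \<subseteq> A i" using hX by (auto simp: Z_def)
      have As: "submod (A i)" unfolding A_def by (rule submod_fmod)
      have "linear_on (Z i) (\<lambda>x. x)" by (simp add: linear_on_def)
      then have "smul (ys ! k) x \<in> mult_sub (A i) ys k"
        using mult_sub_image[of "Z i" "\<lambda>x. x" "A i" k ys] Xs XA yC k x(2) by auto
      moreover have xA: "x \<in> A i" using XA x by blast
      moreover have "smul (ys ! k) x \<in> A i" using submodD(3)[OF As yC[OF k] xA] .
      ultimately have "smul (ys ! k) x z \<in> foldl adj {0} (take k ys)" for z
        using mult_sub_fmod_iff[of "smul (ys ! k) x" "carrier (P i)" k ys] ys(1) k unfolding A_def by auto
      moreover have "nzd (foldl adj {0} (take k ys)) (ys ! k)" using ys(2) k by (simp add: wreg_iff_nth)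
      moreover have "x z \<in> C" for z using xA unfolding A_def by (rule fmodD)
      ultimately have "x z \<in> foldl adj {0} (take k ys)" for z by (simp add: nzd_def smul_def)
      then have xY: "x \<in> mult_sub (A i) ys k"
        using mult_sub_fmod_iff[of x "carrier (P i)" k ys] ys(1) k xA unfolding A_def by auto
      have gc: "g i a \<in> carrier (P i)" if "a \<in> A i" for a
        using g[of i] that by (auto simp: module_hom_set_def A_def)
      have "linear_on (A i) (\<lambda>x. h i (g i x))"
        unfolding linear_on_def
      proof (intro conjI ballI)
        show "h i (g i (a + b)) = h i (g i a) + h i (g i b)" if "a \<in> A i" "b \<in> A i" for a b
        proof -
          have "g i (a + b) = g i a \<oplus>\<^bsub>P i\<^esub> g i b"
            using g[of i] that by (auto simp: module_hom_set_def A_def)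
          then show ?thesis using h_add gc that by simp
        qed
        show "h i (g i (smul r a)) = smul r (h i (g i a))" if "r \<in> C" "a \<in> A i" for r a
        proof -
          have "g i (smul r a) = r \<odot>\<^bsub>P i\<^esub> g i a"
            using g[of i] that by (auto simp: module_hom_set_def A_def)
          then show ?thesis using h_smult[OF gc[OF that(2)] gc[OF that(2)] that(1)] by simp
        qed
      qed
      moreover have "(\<lambda>x. h i (g i x)) ` A i \<subseteq> Z i" using gc by (auto simp: Z_def)
      ultimately have "(\<lambda>x. h i (g i x)) ` mult_sub (A i) ys k \<subseteq> mult_sub (Z i) ys k"
        using yC k by (intro mult_sub_image[OF As]) auto
      moreover have "h i (g i x) = x" using x(1) h(2) by (auto simp: Z_def)
      ultimately show ?thesis using xY by (metis (no_types, lifting) image_subset_iff)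
    qed
    show "h 0 p \<in> Z 0" using p by (simp add: Z_def)
    show "smul (ys ! j) (h 0 p) \<in> D 0 ` Z 1" if j: "j < length ys" for j
    proof -
      have yj: "ys ! j \<in> C" using ys j by auto
      have "\<epsilon> ((ys ! j) \<odot>\<^bsub>P 0\<^esub> p) = (ys ! j) \<odot>\<^bsub>M\<^esub> m"
        using \<epsilon>(1) p yj by (auto simp: module_hom_set_def)
      then have "(ys ! j) \<odot>\<^bsub>P 0\<^esub> p \<in> \<delta> 0 ` carrier (P (Suc 0))"
        unfolding ex0 using m(2)[OF j] P_closed(2)[OF p(1) p(1) yj] by simp
      then have "h 0 ((ys ! j) \<odot>\<^bsub>P 0\<^esub> p) \<in> D 0 ` Z 1" using Dim[of 0] by auto
      then show ?thesis using h_smult[OF p(1) p(1) yj] by simp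
    qed
  qed
  then obtain p' where p': "p' \<in> \<delta> 0 ` carrier (P (Suc 0))" "h 0 p = h 0 p'" using Dim[of 0] by auto
  then have "p = p'" using h_inj[of 0 p p'] p ex0 by auto
  then show ?thesis using p' p ex0 by auto
qed

end

section \<open>The invariants of a lexsegment ideal\<close>

lemma sr_ideal_Pow_UNIV: "sr_ideal n (Pow {1..n}) = ({0} :: 'k::field mpoly set)"
proof -
  have "p = 0" if "p \<in> sr_ideal n (Pow {1..n})" for p :: "'k mpoly"
  proof -
    have "keys p = {}" using that by (auto simp: sr_ideal_def polys_def)
    then show ?thesis by simp
  qed
  then show ?thesis using pr.idlD(2)[OF sr_ideal_idl[OF down_closed_Pow]] by blast
qed

text \<open>Each variable is a nonzerodivisor modulo the prime generated by the preceding
  ones.\<close>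

lemma wreg_vars:
  assumes "distinct xs" "set xs \<subseteq> {1..n}"
  shows "pr.wreg n {0} (map var xs :: 'k::field mpoly list)"
    and "foldl (pr.adj n) {0} (map var xs) = (sr_ideal n (Pow ({1..n} - set xs)) :: 'k mpoly set)"
  using assms
proof (induction xs rule: rev_induct)
  case Nil
  {
    case 1
    then show ?case by simp
  next
    case 2
    then show ?case by (simp add: sr_ideal_Pow_UNIV flip: One_nat_def)
  }
next
  case (snoc x xs)
  let ?F = "{1..n} - set xs"
  have P: "pr.prim n (sr_ideal n (Pow ?F) :: 'k mpoly set)" by (rule sr_ideal_Pow_prim)
  {
    case 1
    then have "(var x :: 'k mpoly) \<notin> sr_ideal n (Pow ?F)" "(var x :: 'k mpoly) \<in> polys n"
      by (auto simp: sr_ideal_def)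
    then have "pr.nzd n (sr_ideal n (Pow ?F)) (var x :: 'k mpoly)"
      using P unfolding pr.prim_def pr.nzd_def by blast
    then show ?case using snoc 1 by (simp add: pr.wreg_append)
  next
    case 2
    have "pr.adj n (sr_ideal n (Pow ?F)) (sqf {x}) = (sr_ideal n (Pow (?F - {x})) :: 'k mpoly set)"
      using 2 by (intro sr_ideal_adj_sqf) auto
    moreover have "?F - {x} = {1..n} - set (xs @ [x])" by auto
    ultimately show ?case using snoc(2) 2 by (simp add: sqf_singleton)
  }
qed

text \<open>K[F] is the quotient by the \<open>n - card F\<close> variables outside
  \<open>F\<close>. The length is weakened to the bound \<open>n - e\<close> common to all factors,
  as the horseshoe lemma expects.\<close>

lemma has_resolution_Pow:
  assumes "F \<subseteq> {1..n}" "e \<le> card F"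
  shows "pr.has_resolution n (n - e) (pr.emb ` polys n) (pr.emb ` (sr_ideal n (Pow F) :: 'k::field mpoly set))"
proof -
  have "finite ({1..n} - F)" by simp
  then obtain xs where xs: "set xs = {1..n} - F" "distinct xs" using finite_distinct_list by blast
  let ?ys = "map var xs :: 'k mpoly list"
  have "pr.has_resolution n (length ?ys) (pr.emb ` polys n) (pr.emb ` foldl (pr.adj n) {0} ?ys)"
    using xs by (intro pr.has_resolution_regular wreg_vars) auto
  moreover have "{1..n} - set xs = F" using xs assms(1) by auto
  then have "foldl (pr.adj n) {0} ?ys = sr_ideal n (Pow F)"
    using wreg_vars(2)[of xs n] xs by simp
  moreover have "length ?ys = n - card F"
    using xs assms(1) distinct_card[of xs] by (simp add: card_Diff_subset finite_subset)
  ultimately show ?thesis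
    using pr.has_resolution_mono[of n "n - card F" _ _ "n - e"] assms(2) by (simp add: diff_le_mono2)
qed

lemma has_resolution_interval_filt:
  assumes "interval_filt 1 n e D"
  shows "pr.has_resolution n (n - e) (pr.emb ` polys n) (pr.emb ` (sr_ideal n D :: 'k::field mpoly set))"
  using assms
proof (induction rule: interval_filt.induct)
  case empty
  show ?case unfolding sr_ideal_empty
    by (intro pr.has_resolution_trivial pr.submod_emb pr.idl_carrier)
next
  case (step D R F)
  let ?I = "sr_ideal n D :: 'k mpoly set"
  let ?J = "sr_ideal n (D \<union> {G. R \<subseteq> G \<and> G \<subseteq> F}) :: 'k mpoly set"
  have "\<forall>G. G \<subseteq> F \<longrightarrow> \<not> R \<subseteq> G \<longrightarrow> G \<in> D" using step.hyps(6) by blast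
  note s = sr_ideal_interval[OF step.hyps(1-5) this, where 'k = 'k]
  have R: "R \<subseteq> {1..n}" using step.hyps by auto
  have IJ: "pr.idl n ?I" "?J \<subseteq> ?I"
    using step.hyps(1) by (auto intro!: sr_ideal_idl interval_filt_down_closed sr_ideal_mono)
  have "pr.quot_iso n (pr.emb ` polys n) (pr.emb ` (sr_ideal n (Pow F) :: 'k mpoly set))
    (pr.emb ` ?I) (pr.emb ` ?J) (pr.smul (sqf R))"
    using pr.quot_iso_mult[OF s(1) sr_ideal_idl[OF down_closed_Pow] sqf_in_polys[OF R] s(3)[symmetric]]
    unfolding s(2) .
  then have "pr.has_resolution n (n - e) (pr.emb ` ?I) (pr.emb ` ?J)"
    using pr.has_resolution_iso has_resolution_Pow[OF step.hyps(3,4)] by blast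
  moreover have "?I \<subseteq> polys n" using pr.idlD(1)[OF IJ(1)] by blast
  ultimately show ?case
    using step.IH IJ s(1)
    by (intro pr.has_resolution_horseshoe[of n "pr.emb ` ?J" "pr.emb ` ?I" "pr.emb ` polys n"])
      (auto intro!: pr.submod_emb pr.idl_carrier)
qed

lemma proj_dim_sr_ideal:
  fixes n :: nat
  defines "S \<equiv> poly_ring_vars n :: 'k::field mpoly ring"
  assumes "interval_filt 1 n e D" "F \<in> D" "F \<subseteq> {1..n}" "card F = e"
    and "\<And>i. i \<in> {1..n} \<Longrightarrow> i \<notin> F \<Longrightarrow> insert i F \<notin> D"
  shows "proj_dim S (quotient_module S (sr_ideal n D)) = enat (n - e)"
proof -
  let ?I = "sr_ideal n D :: 'k mpoly set"
  let ?M = "quotient_module (pr.RR n) ?I"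
  have S: "S = pr.RR n" by (simp add: S_def poly_ring_vars_eq)
  have D: "down_closed D" using assms(2) by (rule interval_filt_down_closed)
  have idl: "pr.idl n ?I" using D by (rule sr_ideal_idl)
  have fin: "finite F" using assms(4) by (rule finite_subset) simp
  have lower: "n - e \<le> l"
    if res: "projective_resolution (pr.RR n) ?M P \<delta> \<epsilon>" and len: "\<forall>i>l. carrier (P i) = {\<zero>\<^bsub>P i\<^esub>}"
    for P :: "nat \<Rightarrow> ('k mpoly, 'k mpoly set \<times> 'k mpoly \<times> nat \<Rightarrow> 'k mpoly) module" and \<delta> \<epsilon> l
  proof (rule ccontr)
    assume l: "\<not> n - e \<le> l"
    obtain xs where xs: "set xs = {1..n} - F" "distinct xs"
      using finite_distinct_list[of "{1..n} - F"] by auto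
    let ?ys = "map var xs :: 'k mpoly list"
    have "length ?ys = n - e"
      using xs assms(4,5) fin distinct_card[of xs] by (simp add: card_Diff_subset)
    have sqfP: "(sqf F :: 'k mpoly) \<in> polys n" using assms(4) by (rule sqf_in_polys)
    have "pr.coset n ?I (sqf F) = \<zero>\<^bsub>?M\<^esub>"
    proof (rule pr.projective_resolution_annihilated[OF res pr.module_quotient[OF idl]])
      show "carrier (P (Suc l)) = {\<zero>\<^bsub>P (Suc l)\<^esub>}" using len by simp
      show "l < length ?ys" using l \<open>length ?ys = n - e\<close> by simp
      show "set ?ys \<subseteq> polys n" using xs by auto
      show "pr.wreg n {0} ?ys" using xs by (intro wreg_vars) auto
      show "pr.coset n ?I (sqf F) \<in> carrier ?M" using sqfP by (simp add: pr.quotient_module_simps[OF idl])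
      fix j assume j: "j < length ?ys"
      have x: "xs ! j \<in> {1..n}" "xs ! j \<notin> F" using xs(1) j nth_mem[of j xs] by auto
      have "var (xs ! j) * sqf F = sqf (insert (xs ! j) F)" by (rule sqf_insert[OF fin x(2), symmetric])
      also have "\<dots> \<in> ?I"
        unfolding sqf_def monom_poly_def using x fin assms(4,6) by (intro single_in_sr_ideal) auto
      finally have "pr.coset n ?I (var (xs ! j) * sqf F) = pr.coset n ?I 0"
        using pr.coset_eq_iff[OF idl] by simp
      then show "(?ys ! j) \<odot>\<^bsub>?M\<^esub> pr.coset n ?I (sqf F) = \<zero>\<^bsub>?M\<^esub>"
        using j x sqfP by (simp add: pr.quotient_module_simps[OF idl])
    qed
    then have "sqf F \<in> ?I"
      using pr.coset_eq_iff[OF idl, of "sqf F" 0] by (simp add: pr.quotient_module_simps[OF idl])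
    then show False using assms(3) fin by (simp add: sr_ideal_def sqf_def monom_poly_def)
  qed
  have "\<exists>(P :: nat \<Rightarrow> ('k mpoly, 'k mpoly set \<times> 'k mpoly \<times> nat \<Rightarrow> 'k mpoly) module) \<delta> \<epsilon>.
      projective_resolution (pr.RR n) ?M P \<delta> \<epsilon> \<and> (\<forall>i>n - e. carrier (P i) = {\<zero>\<^bsub>P i\<^esub>})"
    by (rule pr.projective_resolution_exists[OF idl has_resolution_interval_filt[OF assms(2)]])
  then have "enat (n - e) \<in> {enat l | l.
     \<exists>(P :: nat \<Rightarrow> ('k mpoly, 'k mpoly set \<times> 'k mpoly \<times> nat \<Rightarrow> 'k mpoly) module) \<delta> \<epsilon>.
       projective_resolution (pr.RR n) ?M P \<delta> \<epsilon> \<and> (\<forall>i>l. carrier (P i) = {\<zero>\<^bsub>P i\<^esub>})}" by blast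
  then show ?thesis
    unfolding proj_dim_def S using lower by (intro antisym Inf_lower Inf_greatest) auto
qed

theorem corollary2p4:
  fixes n d t :: nat
    and js :: "nat list"
    and v :: "nat \<Rightarrow>\<^sub>0 nat"
    and S :: "'k::field mpoly ring"
    and J :: "'k mpoly set"
  assumes "n \<ge> 1" and "t \<ge> 1" and "d \<ge> 2"
    and "v \<in> spread_monoms n d t"
    and "length js = d" and "sorted_wrt (<) js" and "v = index_monom js"
    and "js ! 0 \<ge> 2"
    and "S = poly_ring_vars n"
    and "J = monomial_ideal n (initial_lexsegment n d t v)"
  shows "proj_dim S (quotient_module S J) = enat (n - (d - 1) * t)
    \<and> depth S (graded_maximal_ideal n) (quotient_module S J) = enat ((d - 1) * t)
    \<and> krull_dim (S Quot J) = enat (n - js ! 0)"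
proof -
  define D where "D = lex_complex t 1 n js"
  define F where "F = {1..(d - 1) * t}"
  have sm: "index_monom js \<in> spread_monoms n d t" using assms(4,7) by simp
  note ts = tspread_of_spread_monoms[OF assms(2,6) sm]
  have J: "J = sr_ideal n D"
    unfolding D_def assms(10,7) by (rule monomial_ideal_lexsegment[OF assms(2,6,5) sm])
  have len: "length js = Suc (d - 1)" and ne: "js \<noteq> []" using assms(3,5) by auto
  have hd: "hd js = js ! 0" using ne by (simp add: hd_conv_nth)
  have last: "last js \<le> n" "1 \<le> hd js"
    using subsetD[OF ts(2) last_in_set[OF ne]] subsetD[OF ts(2) hd_in_set[OF ne]] by auto
  \<comment> \<open>The spread of \<open>js\<close> makes \<open>{1..(d - 1) * t}\<close> fit into
    \<open>{1..n}\<close>; the subtractions in the claim are thus genuine.\<close>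
  have dn: "hd js + (d - 1) * t \<le> n" using tspread_last[OF ts(1) ne] last assms(5) by simp
  have filt: "interval_filt 1 n ((d - 1) * t) D"
    unfolding D_def using interval_filt_lex_complex[OF ts(1) len last(2,1) assms(2)] .
  have F: "F \<in> D" "F \<subseteq> {1..n}" "card F = (d - 1) * t"
    using initial_face[OF len, of t] dn by (auto simp: F_def D_def lex_complex_def)
  have maximal: "insert i F \<notin> D" if "i \<in> {1..n}" "i \<notin> F" for i
  proof -
    have "d - 1 \<ge> 1" "(d - 1) * t < i" using assms(3) that by (auto simp: F_def)
    then have "lex_nonface t js (insert i F)"
      using assms(2,8) hd unfolding F_def by (intro initial_face_maximal[OF len]) auto
    then show ?thesis by (simp add: D_def lex_complex_def)
  qed
  have D: "down_closed D" "D \<subseteq> Pow {1..n}" "{} \<in> D"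
    using down_closed_lex_complex F(1) down_closedD[of D F "{}"]
    by (auto simp: D_def lex_complex_def)
  have "proj_dim S (quotient_module S J) = enat (n - (d - 1) * t)"
    unfolding J assms(9) by (rule proj_dim_sr_ideal[OF filt F maximal])
  moreover have "depth S (graded_maximal_ideal n) (quotient_module S J) = enat ((d - 1) * t)"
    unfolding J assms(9) by (rule depth_sr_ideal[OF filt D(3) F maximal])
  moreover have "krull_dim (S Quot J) = enat (n - hd js)"
    unfolding J assms(9)
  proof (rule krull_dim_sr_ideal[OF D(1,2)])
    show "{Suc (hd js)..n} \<in> D" unfolding D_def using tail_face[OF ne] .
    show "card G \<le> n - hd js" if "G \<in> D" for G
      using card_face_le[OF ts(1) len last(1)] that unfolding D_def .
  qed
  ultimately show ?thesis by (simp add: hd)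
qed

end
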